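(* For each natural number $n$, the oriented simplex $\mathbf{\Delta}^n$ is a retract of the oriented cube $\square^n$ in $\infty\mathrm{Cat}$.
   Context: $\infty\mathrm{Cat}$ is the category of (not necessarily univalent) $(\infty,\infty)$-categories; Steiner $\infty$-categories form a full subcategory of it. A (strong) Steiner $\infty$-category is a strict $\infty$-category which is a polygraph (freely built by iterated attachment of cells $\partial\mathbb{D}^n\subset\mathbb{D}^n$ along sets $E_n$ of atomic generators) such that the preorder on $\coprod_n E_n$ generated by $x\le y$ whenever $x$ is a factor in the source of $y$ or $y$ is a factor in the target of $x$ is antisymmetric. Augmented directed complexes (ADC): nonnegatively graded augmented chain complexes of abelian groups with a graded submonoid on whose degree-$0$ part the augmentation takes values in $\mathbb{N}$. For a strict $\infty$-category $\mathcal{A}$, $\lambda(\mathcal{A})_q=\mathbb{Z}[\mathcal{A}_q]/(x\circ_p y-x-y)$ with differential target minus source, augmentation sending objects to $1$, and submonoid generated by the $q$-cells. By Steiner, $\lambda$ restricts to an equivalence from Steiner $\infty$-categories onto a full subcategory of ADCs (Steiner complexes), closed under the tensor product $\otimes$ of ADCs and under the join $A\diamond B:=(A\otimes\lambda(\mathbb{D}^1)\otimes B)\coprod_{A\otimes\lambda(\partial\mathbb{D}^1)\otimes B}(A\oplus B)$ (the $\{0\}$-end projects to $A$, the $\{1\}$-end to $B$). The corresponding operations on Steiner $\infty$-categories are the Gray tensor product $\boxtimes$ and the join $\star$. $\mathbb{D}^0$ is the terminal category and $\mathbb{D}^1=\{0\to1\}$. The oriented cube is $\square^n=(\mathbb{D}^1)^{\boxtimes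 n}$ and the oriented simplex (Street's $n$-th oriental) is the $(n+1)$-fold join $\mathbf{\Delta}^n=\mathbb{D}^0\star\cdots\star\mathbb{D}^0$. *)

theory Defs
  imports
    "HOL-Algebra.Free_Abelian_Groups"
    "HOL.Hull"
    "HOL-Library.Countable_Set"
    "HOL-Library.Poly_Mapping"
begin

section \<open>Strict omega-categories\<close>

text \<open>
  Single-sorted presentation (Street, Steiner) of strict \<open>\<infinity>\<close>-categories: a set of cells carrying,
  for every \<open>p\<close>, source and target operations to dimension \<open>p\<close> and a composition along
  \<open>p\<close>-dimensional boundaries.  A \<open>q\<close>-cell is a cell equal to its own \<open>q\<close>-source, so identities on
  lower-dimensional cells count as \<open>q\<close>-cells.  Composition is written in diagrammatic order:
  \<open>cmp C p x y\<close> is meaningful when the \<open>p\<close>-target of \<open>x\<close> is the \<open>p\<close>-source of \<open>y\<close>.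
\<close>

record 'c omega_cat =
  cells :: "'c set"
  src :: "nat \<Rightarrow> 'c \<Rightarrow> 'c"
  tgt :: "nat \<Rightarrow> 'c \<Rightarrow> 'c"
  cmp :: "nat \<Rightarrow> 'c \<Rightarrow> 'c \<Rightarrow> 'c"

definition composable :: "'c omega_cat \<Rightarrow> nat \<Rightarrow> 'c \<Rightarrow> 'c \<Rightarrow> bool"
  where "composable C p x y \<longleftrightarrow> x \<in> cells C \<and> y \<in> cells C \<and> tgt C p x = src C p y"

definition qcells :: "'c omega_cat \<Rightarrow> nat \<Rightarrow> 'c set"
  where "qcells C q = {x \<in> cells C. src C q x = x}"

locale strict_omega_category =
  fixes C :: "'c omega_cat"
  assumes src_closed: "x \<in> cells C \<Longrightarrow> src C p x \<in> cells C"
    and tgt_closed: "x \<in> cells C \<Longrightarrow> tgt C p x \<in> cells C"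
    and src_src: "x \<in> cells C \<Longrightarrow> src C q (src C p x) = (if q < p then src C q x else src C p x)"
    and src_tgt: "x \<in> cells C \<Longrightarrow> src C q (tgt C p x) = (if q < p then src C q x else tgt C p x)"
    and tgt_src: "x \<in> cells C \<Longrightarrow> tgt C q (src C p x) = (if q < p then tgt C q x else src C p x)"
    and tgt_tgt: "x \<in> cells C \<Longrightarrow> tgt C q (tgt C p x) = (if q < p then tgt C q x else tgt C p x)"
    and finite_dim: "x \<in> cells C \<Longrightarrow> \<exists>q. x \<in> qcells C q"
    and cmp_closed: "composable C p x y \<Longrightarrow> cmp C p x y \<in> cells C"
    and src_cmp: "composable C p x y \<Longrightarrow> src C p (cmp C p x y) = src C p x"
    and tgt_cmp: "composable C p x y \<Longrightarrow> tgt C p (cmp C p x y) = tgt C p y"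
    and src_cmp_high: "composable C p x y \<Longrightarrow> p < q \<Longrightarrow>
          src C q (cmp C p x y) = cmp C p (src C q x) (src C q y)"
    and tgt_cmp_high: "composable C p x y \<Longrightarrow> p < q \<Longrightarrow>
          tgt C q (cmp C p x y) = cmp C p (tgt C q x) (tgt C q y)"
    and left_unit: "x \<in> cells C \<Longrightarrow> cmp C p (src C p x) x = x"
    and right_unit: "x \<in> cells C \<Longrightarrow> cmp C p x (tgt C p x) = x"
    and assoc: "composable C p x y \<Longrightarrow> composable C p y z \<Longrightarrow>
          cmp C p (cmp C p x y) z = cmp C p x (cmp C p y z)"
    and interchange: "p < q \<Longrightarrow> composable C q x y \<Longrightarrow> composable C q x' y' \<Longrightarrow>
          composable C p x x' \<Longrightarrow> composable C p y y' \<Longrightarrow>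
          cmp C p (cmp C q x y) (cmp C q x' y') = cmp C q (cmp C p x x') (cmp C p y y')"

text \<open>Preservation of identities is preservation of dimension, hence automatic.\<close>

definition strict_functor :: "'c omega_cat \<Rightarrow> 'd omega_cat \<Rightarrow> ('c \<Rightarrow> 'd) \<Rightarrow> bool"
  where "strict_functor C D f \<longleftrightarrow>
    (\<forall>x \<in> cells C. f x \<in> cells D) \<and>
    (\<forall>p. \<forall>x \<in> cells C. f (src C p x) = src D p (f x) \<and> f (tgt C p x) = tgt D p (f x)) \<and>
    (\<forall>p x y. composable C p x y \<longrightarrow> f (cmp C p x y) = cmp D p (f x) (f y))"

definition omega_retract :: "'c omega_cat \<Rightarrow> 'd omega_cat \<Rightarrow> bool"
  where "omega_retract C D \<longleftrightarrow>
    strict_omega_category C \<and> strict_omega_category D \<and>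
    (\<exists>i r. strict_functor C D i \<and> strict_functor D C r \<and> (\<forall>x \<in> cells C. r (i x) = x))"

definition point :: "unit omega_cat"
  where "point = \<lparr>cells = UNIV, src = (\<lambda>_ x. x), tgt = (\<lambda>_ x. x), cmp = (\<lambda>_ x _. x)\<rparr>"

text \<open>
  The cell \<open>(a, b)\<close> of the walking arrow is the unique cell from \<open>a\<close> to \<open>b\<close>, where \<open>False\<close> and
  \<open>True\<close> stand for the objects 0 and 1.
\<close>

definition arrow :: "(bool \<times> bool) omega_cat"
  where "arrow =
    \<lparr>cells = {(a, b). a \<le> b},
     src = (\<lambda>p (a, b). if p = 0 then (a, a) else (a, b)),
     tgt = (\<lambda>p (a, b). if p = 0 then (b, b) else (a, b)),
     cmp = (\<lambda>p (a, b) (c, d). if p = 0 then (a, d) else (a, b))\<rparr>"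

definition arrow_boundary :: "(bool \<times> bool) omega_cat"
  where "arrow_boundary = arrow\<lparr>cells := {(False, False), (True, True)}\<rparr>"


section \<open>Presented abelian groups\<close>

text \<open>
  Groups are written multiplicatively in HOL-Algebra; the chain groups below are abelian and
  their operation plays the role of addition.
\<close>

definition presented :: "'g set \<Rightarrow> ('g \<Rightarrow>\<^sub>0 int) set \<Rightarrow> ('g \<Rightarrow>\<^sub>0 int) set monoid"
  where "presented S R = free_Abelian_group S Mod generate (free_Abelian_group S) R"

definition pclass :: "'g set \<Rightarrow> ('g \<Rightarrow>\<^sub>0 int) set \<Rightarrow> 'g \<Rightarrow> ('g \<Rightarrow>\<^sub>0 int) set"
  where "pclass S R x =
    generate (free_Abelian_group S) R #>\<^bsub>free_Abelian_group S\<^esub> frag_of x"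

text \<open>
  The homomorphism from a presented group to \<open>G\<close> determined by the values \<open>\<phi>\<close> on generators.
  It is evaluated on a representative, so it is meaningful only if \<open>\<phi>\<close> respects the relations.
\<close>

definition pextend :: "('h, 'm) monoid_scheme \<Rightarrow> ('g \<Rightarrow> 'h) \<Rightarrow> ('g \<Rightarrow>\<^sub>0 int) set \<Rightarrow> 'h"
  where "pextend G \<phi> X =
    (let c = (SOME c. c \<in> X)
     in finprod G (\<lambda>x. \<phi> x [^]\<^bsub>G\<^esub> Poly_Mapping.lookup c x) (Poly_Mapping.keys c))"


section \<open>Augmented directed complexes\<close>

text \<open>The differential \<open>bd K n\<close> starts in degree \<open>n\<close>; the value \<open>bd K 0\<close> is irrelevant.\<close>

record 'a adc =
  grp :: "nat \<Rightarrow> 'a monoid"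
  bd :: "nat \<Rightarrow> 'a \<Rightarrow> 'a"
  aug :: "'a \<Rightarrow> int"
  pos :: "nat \<Rightarrow> 'a set"

locale augmented_directed_complex =
  fixes K :: "'a adc"
  assumes grp_comm: "comm_group (grp K n)"
    and bd_hom: "bd K (Suc n) \<in> hom (grp K (Suc n)) (grp K n)"
    and bd_bd: "x \<in> carrier (grp K (Suc (Suc n))) \<Longrightarrow>
          bd K (Suc n) (bd K (Suc (Suc n)) x) = \<one>\<^bsub>grp K n\<^esub>"
    and aug_hom: "aug K \<in> hom (grp K 0) integer_group"
    and aug_bd: "x \<in> carrier (grp K 1) \<Longrightarrow> aug K (bd K 1 x) = 0"
    and pos_submonoid: "submonoid (pos K n) (grp K n)"
    and aug_pos: "x \<in> pos K 0 \<Longrightarrow> 0 \<le> aug K x"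


subsection \<open>The functors relating strict omega-categories and complexes\<close>

text \<open>
  The condition \<open>p < q\<close> in the relations is essential: every \<open>q\<close>-cell \<open>x\<close> satisfies
  \<open>cmp C q x x = x\<close>.
\<close>

definition lam_rels :: "'c omega_cat \<Rightarrow> nat \<Rightarrow> ('c \<Rightarrow>\<^sub>0 int) set"
  where "lam_rels C q =
    {frag_of (cmp C p x y) - frag_of x - frag_of y | p x y.
       p < q \<and> x \<in> qcells C q \<and> y \<in> qcells C q \<and> composable C p x y}"

definition lam_class :: "'c omega_cat \<Rightarrow> nat \<Rightarrow> 'c \<Rightarrow> ('c \<Rightarrow>\<^sub>0 int) set"
  where "lam_class C q = pclass (qcells C q) (lam_rels C q)"

definition lam :: "'c omega_cat \<Rightarrow> ('c \<Rightarrow>\<^sub>0 int) set adc"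
  where "lam C =
    (let L = (\<lambda>q. presented (qcells C q) (lam_rels C q))
     in \<lparr>grp = L,
         bd = (\<lambda>q. pextend (L (q - 1))
           (\<lambda>x. lam_class C (q - 1) (tgt C (q - 1) x)
                  \<otimes>\<^bsub>L (q - 1)\<^esub> inv\<^bsub>L (q - 1)\<^esub> lam_class C (q - 1) (src C (q - 1) x))),
         aug = pextend integer_group (\<lambda>_. 1),
         pos = (\<lambda>q. (\<lambda>H. submonoid H (L q)) hull (lam_class C q ` qcells C q))\<rparr>)"

definition lam_map ::
    "('c \<Rightarrow> 'd) \<Rightarrow> 'd omega_cat \<Rightarrow> nat \<Rightarrow> ('c \<Rightarrow>\<^sub>0 int) set \<Rightarrow> ('d \<Rightarrow>\<^sub>0 int) set"
  where "lam_map f D q = pextend (grp (lam D) q) (\<lambda>x. lam_class D q (f x))"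

text \<open>
  Steiner's right adjoint of \<open>lam\<close>, which is inverse to it between Steiner complexes and Steiner
  categories.  A cell is a table whose \<open>n\<close>-th entry is the pair of the negative and the positive
  \<open>n\<close>-dimensional component; composition along dimension \<open>p\<close> is addition of tables minus
  the common \<open>p\<close>-boundary.
\<close>

definition nu_cells :: "'a adc \<Rightarrow> (nat \<Rightarrow> 'a \<times> 'a) set"
  where "nu_cells K = {x.
    (\<forall>n. fst (x n) \<in> pos K n \<and> snd (x n) \<in> pos K n) \<and>
    aug K (fst (x 0)) = 1 \<and> aug K (snd (x 0)) = 1 \<and>
    (\<forall>n. \<forall>y \<in> {fst (x (Suc n)), snd (x (Suc n))}.
       bd K (Suc n) y = snd (x n) \<otimes>\<^bsub>grp K n\<^esub> inv\<^bsub>grp K n\<^esub> fst (x n)) \<and>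
    (\<exists>N. \<forall>n\<ge>N. x n = (\<one>\<^bsub>grp K n\<^esub>, \<one>\<^bsub>grp K n\<^esub>))}"

definition nu :: "'a adc \<Rightarrow> (nat \<Rightarrow> 'a \<times> 'a) omega_cat"
  where "nu K =
    \<lparr>cells = nu_cells K,
     src = (\<lambda>p x n. if n < p then x n
                    else if n = p then (fst (x p), fst (x p))
                    else (\<one>\<^bsub>grp K n\<^esub>, \<one>\<^bsub>grp K n\<^esub>)),
     tgt = (\<lambda>p x n. if n < p then x n
                    else if n = p then (snd (x p), snd (x p))
                    else (\<one>\<^bsub>grp K n\<^esub>, \<one>\<^bsub>grp K n\<^esub>)),
     cmp = (\<lambda>p x y n. if n < p then x n
                      else if n = p then (fst (x p), snd (y p))
                      else (fst (x n) \<otimes>\<^bsub>grp K n\<^esub> fst (y n),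
                            snd (x n) \<otimes>\<^bsub>grp K n\<^esub> snd (y n)))\<rparr>"


subsection \<open>Tensor product\<close>

text \<open>
  In degree \<open>n\<close> the tensor product is the direct sum of the groups \<open>A\<^sub>p \<otimes> B\<^sub>q\<close> with \<open>p + q = n\<close>; the
  generator \<open>(p, a, b)\<close> stands for \<open>a \<otimes> b\<close> with \<open>a\<close> in degree \<open>p\<close> and \<open>b\<close> in degree \<open>n - p\<close>.
\<close>

definition tensor_gens :: "'a adc \<Rightarrow> 'b adc \<Rightarrow> nat \<Rightarrow> (nat \<times> 'a \<times> 'b) set"
  where "tensor_gens A B n =
    {(p, a, b). p \<le> n \<and> a \<in> carrier (grp A p) \<and> b \<in> carrier (grp B (n - p))}"

definition tensor_rels :: "'a adc \<Rightarrow> 'b adc \<Rightarrow> nat \<Rightarrow> (nat \<times> 'a \<times> 'b \<Rightarrow>\<^sub>0 int) set"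
  where "tensor_rels A B n =
    {frag_of (p, a \<otimes>\<^bsub>grp A p\<^esub> a', b) - frag_of (p, a, b) - frag_of (p, a', b) | p a a' b.
       p \<le> n \<and> a \<in> carrier (grp A p) \<and> a' \<in> carrier (grp A p) \<and>
       b \<in> carrier (grp B (n - p))} \<union>
    {frag_of (p, a, b \<otimes>\<^bsub>grp B (n - p)\<^esub> b') - frag_of (p, a, b) - frag_of (p, a, b') | p a b b'.
       p \<le> n \<and> a \<in> carrier (grp A p) \<and>
       b \<in> carrier (grp B (n - p)) \<and> b' \<in> carrier (grp B (n - p))}"

definition tensor_class ::
    "'a adc \<Rightarrow> 'b adc \<Rightarrow> nat \<Rightarrow> nat \<times> 'a \<times> 'b \<Rightarrow> (nat \<times> 'a \<times> 'b \<Rightarrow>\<^sub>0 int) set"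
  where "tensor_class A B n = pclass (tensor_gens A B n) (tensor_rels A B n)"

definition tensor :: "'a adc \<Rightarrow> 'b adc \<Rightarrow> (nat \<times> 'a \<times> 'b \<Rightarrow>\<^sub>0 int) set adc"
  where "tensor A B =
    (let T = (\<lambda>n. presented (tensor_gens A B n) (tensor_rels A B n))
     in \<lparr>grp = T,
         bd = (\<lambda>n. pextend (T (n - 1)) (\<lambda>(p, a, b).
           (if p = 0 then \<one>\<^bsub>T (n - 1)\<^esub>
            else tensor_class A B (n - 1) (p - 1, bd A p a, b))
           \<otimes>\<^bsub>T (n - 1)\<^esub>
           (if p = n then \<one>\<^bsub>T (n - 1)\<^esub>
            else tensor_class A B (n - 1) (p, a, bd B (n - p) b)
                   [^]\<^bsub>T (n - 1)\<^esub> ((- 1 :: int) ^ p)))),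
         aug = pextend integer_group (\<lambda>(p, a, b). aug A a * aug B b),
         pos = (\<lambda>n. (\<lambda>H. submonoid H (T n)) hull
           {tensor_class A B n (p, a, b) | p a b. p \<le> n \<and> a \<in> pos A p \<and> b \<in> pos B (n - p)})\<rparr>)"

definition tensor_map ::
    "(nat \<Rightarrow> 'a \<Rightarrow> 'c) \<Rightarrow> (nat \<Rightarrow> 'b \<Rightarrow> 'd) \<Rightarrow> 'c adc \<Rightarrow> 'd adc \<Rightarrow>
     nat \<Rightarrow> (nat \<times> 'a \<times> 'b \<Rightarrow>\<^sub>0 int) set \<Rightarrow> (nat \<times> 'c \<times> 'd \<Rightarrow>\<^sub>0 int) set"
  where "tensor_map f g C D n =
    pextend (grp (tensor C D) n) (\<lambda>(p, a, b). tensor_class C D n (p, f p a, g (n - p) b))"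


subsection \<open>Direct sums, pushouts and joins\<close>

definition adc_sum :: "'a adc \<Rightarrow> 'b adc \<Rightarrow> ('a \<times> 'b) adc"
  where "adc_sum A B =
    \<lparr>grp = (\<lambda>n. grp A n \<times>\<times> grp B n),
     bd = (\<lambda>n (a, b). (bd A n a, bd B n b)),
     aug = (\<lambda>(a, b). aug A a + aug B b),
     pos = (\<lambda>n. pos A n \<times> pos B n)\<rparr>"

definition pushout_rels ::
    "'c adc \<Rightarrow> (nat \<Rightarrow> 'c \<Rightarrow> 'a) \<Rightarrow> (nat \<Rightarrow> 'c \<Rightarrow> 'b) \<Rightarrow> 'b adc \<Rightarrow> nat \<Rightarrow> ('a \<times> 'b) set"
  where "pushout_rels C f g B n = (\<lambda>c. (f n c, inv\<^bsub>grp B n\<^esub> g n c)) ` carrier (grp C n)"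

text \<open>
  The pushout of \<open>f : C \<rightarrow> A\<close> and \<open>g : C \<rightarrow> B\<close>: the quotient of the direct sum that identifies
  \<open>f c\<close> with \<open>g c\<close>, with the image submonoid.
\<close>

definition pushout ::
    "'c adc \<Rightarrow> (nat \<Rightarrow> 'c \<Rightarrow> 'a) \<Rightarrow> (nat \<Rightarrow> 'c \<Rightarrow> 'b) \<Rightarrow> 'a adc \<Rightarrow> 'b adc \<Rightarrow> ('a \<times> 'b) set adc"
  where "pushout C f g A B =
    (let S = adc_sum A B;
         q = (\<lambda>n z. pushout_rels C f g B n #>\<^bsub>grp S n\<^esub> z)
     in \<lparr>grp = (\<lambda>n. grp S n Mod pushout_rels C f g B n),
         bd = (\<lambda>n X. q (n - 1) (bd S n (SOME z. z \<in> X))),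
         aug = (\<lambda>X. aug S (SOME z. z \<in> X)),
         pos = (\<lambda>n. q n ` pos S n)\<rparr>)"

text \<open>
  \<open>end_coeff e\<close> is the coefficient of the object \<open>e\<close> in a degree 0 chain of the boundary of the
  arrow.  \<open>join_ends A B\<close> is the map from \<open>A \<otimes> \<lambda>(\<partial>D\<^sup>1) \<otimes> B\<close> to \<open>A \<oplus> B\<close> that sends \<open>a \<otimes> 0 \<otimes> b\<close> to
  \<open>\<epsilon>(b) a\<close> and \<open>a \<otimes> 1 \<otimes> b\<close> to \<open>\<epsilon>(a) b\<close>, augmentations being zero in positive degrees.
\<close>

definition end_coeff :: "bool \<Rightarrow> (bool \<times> bool \<Rightarrow>\<^sub>0 int) set \<Rightarrow> int"
  where "end_coeff e = pextend integer_group (\<lambda>x. if x = (e, e) then 1 else 0)"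

definition join_ends ::
    "'a adc \<Rightarrow> 'b adc \<Rightarrow> nat \<Rightarrow>
     (nat \<times> 'a \<times> (nat \<times> (bool \<times> bool \<Rightarrow>\<^sub>0 int) set \<times> 'b \<Rightarrow>\<^sub>0 int) set \<Rightarrow>\<^sub>0 int) set \<Rightarrow> 'a \<times> 'b"
  where "join_ends A B n =
    pextend (grp (adc_sum A B) n) (\<lambda>(p, a, y).
      (if p = n
       then a [^]\<^bsub>grp A n\<^esub> pextend integer_group (\<lambda>(k, x, b). end_coeff False x * aug B b) y
       else \<one>\<^bsub>grp A n\<^esub>,
       if p = 0
       then pextend (grp B n)
              (\<lambda>(k, x, b). if k = 0 then b [^]\<^bsub>grp B n\<^esub> end_coeff True x
                           else \<one>\<^bsub>grp B n\<^esub>) y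
              [^]\<^bsub>grp B n\<^esub> aug A a
       else \<one>\<^bsub>grp B n\<^esub>))"

definition adc_join where
  "adc_join A B =
    pushout (tensor A (tensor (lam arrow_boundary) B))
      (tensor_map (\<lambda>_ a. a) (tensor_map (lam_map id arrow) (\<lambda>_ b. b) (lam arrow) B)
         A (tensor (lam arrow) B))
      (join_ends A B)
      (tensor A (tensor (lam arrow) B))
      (adc_sum A B)"


section \<open>Oriented cubes and simplices\<close>

text \<open>
  The Gray tensor product and the join, transported from complexes along \<open>lam\<close> and its inverse
  \<open>nu\<close>.  They are meaningful on Steiner categories.
\<close>

definition gray where "gray C D = nu (tensor (lam C) (lam D))"

definition omega_join where "omega_join C D = nu (adc_join (lam C) (lam D))"

text \<open>
  The two operations change the type of cells, so iterating them requires a fixed type of cells: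
  \<open>encode\<close> relabels the cells of a category by natural numbers.  The relabelling is
  an isomorphism as soon as there are only countably many cells (\<open>encode_iso\<close>), and the Gray
  tensor product and the join preserve countability (\<open>countable_gray\<close>, \<open>countable_omega_join\<close>).
\<close>

definition relabel :: "('c \<Rightarrow> 'd) \<Rightarrow> 'c omega_cat \<Rightarrow> 'd omega_cat"
  where "relabel f C =
    (let g = inv_into (cells C) f
     in \<lparr>cells = f ` cells C,
         src = (\<lambda>p x. f (src C p (g x))),
         tgt = (\<lambda>p x. f (tgt C p (g x))),
         cmp = (\<lambda>p x y. f (cmp C p (g x) (g y)))\<rparr>)"

definition encode :: "'c omega_cat \<Rightarrow> nat omega_cat"
  where "encode C = relabel (to_nat_on (cells C)) C"

primrec oriented_cube :: "nat \<Rightarrow> nat omega_cat" where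
  "oriented_cube 0 = encode point"
| "oriented_cube (Suc n) = encode (gray arrow (oriented_cube n))"

primrec oriented_simplex :: "nat \<Rightarrow> nat omega_cat" where
  "oriented_simplex 0 = encode point"
| "oriented_simplex (Suc n) = encode (omega_join point (oriented_simplex n))"


subsection \<open>Encoding preserves the category\<close>

lemma encode_iso:
  assumes "strict_omega_category C" "countable (cells C)"
  shows "strict_functor C (encode C) (to_nat_on (cells C))"
    and "strict_functor (encode C) C (inv_into (cells C) (to_nat_on (cells C)))"
    and "bij_betw (to_nat_on (cells C)) (cells C) (cells (encode C))"
proof -
  interpret strict_omega_category C by fact
  let ?f = "to_nat_on (cells C)" and ?g = "inv_into (cells C) (to_nat_on (cells C))"
  have inj: "inj_on ?f (cells C)" using assms(2) by (rule inj_on_to_nat_on)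
  have gf: "?g (?f x) = x" if "x \<in> cells C" for x using inj that by simp
  show "bij_betw ?f (cells C) (cells (encode C))"
    using inj by (simp add: bij_betw_def encode_def relabel_def Let_def)
  show "strict_functor C (encode C) ?f"
    by (simp add: strict_functor_def encode_def relabel_def Let_def gf composable_def)
  show "strict_functor (encode C) C ?g"
    by (auto simp: strict_functor_def encode_def relabel_def Let_def composable_def gf
        src_closed tgt_closed inj_on_eq_iff[OF inj] intro!: gf cmp_closed)
qed

lemma countable_free_Abelian_group:
  assumes "countable S"
  shows "countable (carrier (free_Abelian_group S))"
proof -
  let ?h = "\<lambda>xs :: ('a \<times> int) list. \<Sum>(x, k) \<leftarrow> xs. frag_cmul k (frag_of x)"
  have "carrier (free_Abelian_group S) \<subseteq> ?h ` lists (S \<times> UNIV)"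
  proof
    fix c assume "c \<in> carrier (free_Abelian_group S)"
    then have sub: "Poly_Mapping.keys c \<subseteq> S" by (simp add: free_Abelian_group_def)
    obtain xs where xs: "set xs = Poly_Mapping.keys c" "distinct xs"
      using finite_distinct_list[OF finite_keys[of c]] by metis
    have "c = (\<Sum>x \<in> Poly_Mapping.keys c. frag_cmul (Poly_Mapping.lookup c x) (frag_of x))"
      using frag_expansion[of c] by (simp add: frag_extend_def)
    also have "\<dots> = ?h (map (\<lambda>x. (x, Poly_Mapping.lookup c x)) xs)"
      using xs by (simp add: sum_list_distinct_conv_sum_set comp_def case_prod_beta)
    finally show "c \<in> ?h ` lists (S \<times> UNIV)"
      using xs sub by (intro image_eqI[where x = "map (\<lambda>x. (x, Poly_Mapping.lookup c x)) xs"])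
        auto
  qed
  then show ?thesis
    using assms by (meson countable_SIGMA countableI_type countable_image countable_lists
        countable_subset)
qed

lemma countable_FactGroup:
  assumes "countable (carrier G)"
  shows "countable (carrier (G Mod H))"
proof -
  have "carrier (G Mod H) = (\<lambda>x. H #>\<^bsub>G\<^esub> x) ` carrier G"
    by (auto simp: FactGroup_def RCOSETS_def)
  then show ?thesis using assms by simp
qed

lemma countable_presented: "countable S \<Longrightarrow> countable (carrier (presented S R))"
  unfolding presented_def by (intro countable_FactGroup countable_free_Abelian_group)

lemma countable_lam: "countable (cells C) \<Longrightarrow> countable (carrier (grp (lam C) q))"
  by (auto simp: lam_def Let_def qcells_def intro!: countable_presented
      intro: countable_subset[rotated])

lemma countable_tensor:
  assumes "\<And>n. countable (carrier (grp A n))" "\<And>n. countable (carrier (grp B n))"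
  shows "countable (carrier (grp (tensor A B) n))"
proof -
  have "tensor_gens A B n = (SIGMA p:{..n}. carrier (grp A p) \<times> carrier (grp B (n - p)))"
    by (auto simp: tensor_gens_def)
  then have "countable (tensor_gens A B n)" using assms by simp
  then show ?thesis by (simp add: tensor_def Let_def countable_presented)
qed

lemma countable_adc_join:
  assumes "\<And>n. countable (carrier (grp A n))" "\<And>n. countable (carrier (grp B n))"
  shows "countable (carrier (grp (adc_join A B) n))"
  using assms
  by (auto simp: adc_join_def pushout_def Let_def adc_sum_def DirProd_def
      intro!: countable_FactGroup countable_SIGMA countable_tensor countable_lam)

lemma countable_nu:
  assumes "\<And>n. countable (carrier (grp K n))" "\<And>n. pos K n \<subseteq> carrier (grp K n)"
  shows "countable (cells (nu K))"
proof -
  let ?D = "\<Union>n. carrier (grp K n) \<times> carrier (grp K n)"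
  let ?h = "\<lambda>xs n. if n < length xs then xs ! n else (\<one>\<^bsub>grp K n\<^esub>, \<one>\<^bsub>grp K n\<^esub>)"
  have "cells (nu K) \<subseteq> ?h ` lists ?D"
  proof
    fix x assume "x \<in> cells (nu K)"
    then have x: "x \<in> nu_cells K" by (simp add: nu_def)
    then obtain N where N: "\<forall>n\<ge>N. x n = (\<one>\<^bsub>grp K n\<^esub>, \<one>\<^bsub>grp K n\<^esub>)"
      by (auto simp: nu_cells_def)
    have "x n \<in> ?D" for n
      using x assms(2)[of n] by (auto simp: nu_cells_def mem_Times_iff subset_iff)
    then have "map x [0..<N] \<in> lists ?D" by (auto simp only: in_lists_conv_set set_map)
    moreover have "x = ?h (map x [0..<N])" using N by auto
    ultimately show "x \<in> ?h ` lists ?D" by blast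
  qed
  moreover have "countable ?D" using assms(1) by (intro countable_UN countable_SIGMA) auto
  ultimately show ?thesis by (meson countable_image countable_lists countable_subset)
qed

lemma comm_group_presented:
  assumes "R \<subseteq> carrier (free_Abelian_group S)"
  shows "comm_group (presented S R)"
  unfolding presented_def
  by (intro comm_group.abelian_FactGroup abelian_free_Abelian_group
      group.generate_is_subgroup group_free_Abelian_group assms)

lemma pclass_closed: "x \<in> S \<Longrightarrow> pclass S R x \<in> carrier (presented S R)"
  unfolding presented_def pclass_def FactGroup_def RCOSETS_def by auto

lemma submonoid_hull_subset:
  assumes "comm_group G" "Y \<subseteq> carrier G"
  shows "(\<lambda>H. submonoid H G) hull Y \<subseteq> carrier G"
proof -
  interpret comm_group G by fact
  have "submonoid (carrier G) G" by unfold_locales auto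
  then show ?thesis using assms(2) by (auto simp: hull_def)
qed

lemma (in strict_omega_category) cmp_qcells:
  assumes "p < q" "x \<in> qcells C q" "y \<in> qcells C q" "composable C p x y"
  shows "cmp C p x y \<in> qcells C q"
  using assms src_cmp_high[OF assms(4,1)] cmp_closed[OF assms(4)] by (simp add: qcells_def)

lemma comm_group_lam:
  assumes "strict_omega_category C"
  shows "comm_group (grp (lam C) q)"
proof -
  interpret strict_omega_category C by fact
  have "lam_rels C q \<subseteq> carrier (free_Abelian_group (qcells C q))"
    by (auto simp: lam_rels_def cmp_qcells dest!: subsetD[OF keys_diff])
  then show ?thesis by (simp add: lam_def Let_def comm_group_presented)
qed

lemma pos_lam_subset:
  assumes "strict_omega_category C"
  shows "pos (lam C) q \<subseteq> carrier (grp (lam C) q)"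
  using submonoid_hull_subset[OF comm_group_lam[OF assms]]
  by (simp add: lam_def Let_def lam_class_def image_subset_iff pclass_closed)

lemma comm_group_tensor:
  assumes "\<And>n. comm_group (grp A n)" "\<And>n. comm_group (grp B n)"
  shows "comm_group (grp (tensor A B) n)"
proof -
  have A: "a \<otimes>\<^bsub>grp A p\<^esub> a' \<in> carrier (grp A p)"
    if "a \<in> carrier (grp A p)" "a' \<in> carrier (grp A p)" for p a a'
    using that assms(1)[of p] by (meson comm_groupE(1))
  have B: "b \<otimes>\<^bsub>grp B p\<^esub> b' \<in> carrier (grp B p)"
    if "b \<in> carrier (grp B p)" "b' \<in> carrier (grp B p)" for p b b'
    using that assms(2)[of p] by (meson comm_groupE(1))
  have "tensor_rels A B n \<subseteq> carrier (free_Abelian_group (tensor_gens A B n))"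
    by (auto simp: tensor_rels_def tensor_gens_def A B dest!: subsetD[OF keys_diff])
  then show ?thesis by (simp add: tensor_def Let_def comm_group_presented)
qed

lemma pos_tensor_subset:
  assumes "\<And>n. comm_group (grp A n)" "\<And>n. comm_group (grp B n)"
    and "\<And>n. pos A n \<subseteq> carrier (grp A n)" "\<And>n. pos B n \<subseteq> carrier (grp B n)"
  shows "pos (tensor A B) n \<subseteq> carrier (grp (tensor A B) n)"
proof -
  have "{tensor_class A B n (p, a, b) | p a b. p \<le> n \<and> a \<in> pos A p \<and> b \<in> pos B (n - p)}
      \<subseteq> carrier (grp (tensor A B) n)"
    using assms(3,4)
    by (fastforce simp: tensor_class_def tensor_def Let_def tensor_gens_def intro!: pclass_closed)
  from submonoid_hull_subset[OF comm_group_tensor[OF assms(1,2)] this] show ?thesis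
    by (simp add: tensor_def Let_def)
qed

lemma pos_pushout_subset:
  assumes "pos A n \<subseteq> carrier (grp A n)" "pos B n \<subseteq> carrier (grp B n)"
  shows "pos (pushout C f g A B) n \<subseteq> carrier (grp (pushout C f g A B) n)"
  using assms by (auto simp: pushout_def Let_def adc_sum_def DirProd_def FactGroup_def RCOSETS_def)

lemma strict_omega_category_arrow: "strict_omega_category arrow"
  by unfold_locales
    (auto simp: arrow_def qcells_def composable_def split: if_splits intro: exI[of _ 1])

lemma strict_omega_category_arrow_boundary: "strict_omega_category arrow_boundary"
  by unfold_locales
    (auto simp: arrow_boundary_def arrow_def qcells_def composable_def split: if_splits)

lemma strict_omega_category_point: "strict_omega_category point"
  by unfold_locales (auto simp: point_def qcells_def composable_def)

lemma countable_gray: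
  assumes "strict_omega_category C" "strict_omega_category D"
    and "countable (cells C)" "countable (cells D)"
  shows "countable (cells (gray C D))"
  unfolding gray_def
  by (intro countable_nu countable_tensor countable_lam pos_tensor_subset pos_lam_subset
      comm_group_lam assms)

lemma countable_omega_join:
  assumes "strict_omega_category C" "strict_omega_category D"
    and "countable (cells C)" "countable (cells D)"
  shows "countable (cells (omega_join C D))"
proof -
  have "pos (adc_sum (lam C) (lam D)) n \<subseteq> carrier (grp (adc_sum (lam C) (lam D)) n)" for n
    using pos_lam_subset[OF assms(1), of n] pos_lam_subset[OF assms(2), of n]
    by (auto simp: adc_sum_def DirProd_def)
  then have "pos (adc_join (lam C) (lam D)) n \<subseteq> carrier (grp (adc_join (lam C) (lam D)) n)" for n
    unfolding adc_join_def
    by (intro pos_pushout_subset pos_tensor_subset comm_group_tensor pos_lam_subset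
        comm_group_lam assms strict_omega_category_arrow)
  then show ?thesis
    unfolding omega_join_def by (intro countable_nu countable_adc_join countable_lam assms)
qed

end

theory Submission
  imports Defs
begin

text \<open>
  A contraction of a complex \<open>K\<close> is a positive homotopy \<open>h\<close> from the constant map at a positive
  point \<open>b\<close> to the identity, the algebraic trace of an initial object.  If \<open>B\<close> carries a
  contraction, the quotient map from \<open>\<lambda>(D\<^sup>1) \<otimes> B\<close> to the join \<open>\<lambda>(D\<^sup>0) \<diamond> B\<close>, which collapses the
  0-end to a point, has a positive section: it sends \<open>x\<close> to \<open>1 \<otimes> x\<close>, the cone point to
  \<open>0 \<otimes> b\<close>, and the cone on \<open>x\<close> to \<open>I \<otimes> x + 0 \<otimes> h x\<close>, where \<open>I\<close> is the 1-cell of \<open>D\<^sup>1\<close>.  Since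
  retracts are preserved by \<open>\<lambda>\<close>, \<open>\<otimes>\<close> and \<open>\<nu>\<close>, induction on \<open>n\<close> reduces the theorem to
  contracting the cubes.  A contraction of \<open>B\<close> induces one of \<open>\<lambda>(D\<^sup>1) \<otimes> B\<close>, and a contraction
  of \<open>K\<close> induces one of \<open>\<lambda>(\<nu> K)\<close> because \<open>h\<close> turns every cell of \<open>\<nu> K\<close> into a cone; this
  replaces Steiner's isomorphism between \<open>\<lambda>(\<nu> K)\<close> and \<open>K\<close>.
\<close>

section \<open>Homomorphisms of presented groups\<close>

text \<open>The correction \<open>0 \<otimes> h x\<close> is forced. The boundary of
  \<open>I \<otimes> x\<close> is \<open>1 \<otimes> x - 0 \<otimes> x - I \<otimes> d x\<close>,
  while the join has no term \<open>0 \<otimes> x\<close> in positive degrees; a section must cancel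
  it by a chain of the 0-end whose boundary is \<open>0 \<otimes> x\<close> up to a term in
  \<open>d x\<close> alone. Adding \<open>0 \<otimes> h x\<close>, with boundary
  \<open>0 \<otimes> x - 0 \<otimes> h (d x)\<close>, leaves \<open>1 \<otimes> x\<close> minus the
  value on the cone on \<open>d x\<close>. In degree 0 there remains \<open>1 \<otimes> x\<close>
  minus \<open>aug x\<close> times the value at the cone point. Maps of complexes preserve the
  positive submonoids, so \<open>h\<close> has to be positive, which is stronger than chain
  contractibility. Its direction, from \<open>b\<close> to the identity, matches the cone point
  sitting at the source of the edge. The obstacle is that each stage of the recursion applies
  \<open>lam\<close> to a category produced by \<open>nu\<close>. No basis of such a complex is ever
  computed: a contraction and a retraction are the only data handed from one stage to the
  next.\<close>

lemma diff_telescope: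
  assumes "comm_group G" "a \<in> carrier G" "b \<in> carrier G" "c \<in> carrier G"
  shows "(b \<otimes>\<^bsub>G\<^esub> inv\<^bsub>G\<^esub> a) \<otimes>\<^bsub>G\<^esub> (c \<otimes>\<^bsub>G\<^esub> inv\<^bsub>G\<^esub> b) = c \<otimes>\<^bsub>G\<^esub> inv\<^bsub>G\<^esub> a"
proof -
  interpret comm_group G by fact
  \<comment> \<open>The inverses stay opaque as \<open>u\<close> and \<open>v\<close>, so that
    \<open>m_ac\<close> can bring \<open>b\<close> next to its own inverse, after which plain
    cancellation finishes.\<close>
  have "(b \<otimes>\<^bsub>G\<^esub> u) \<otimes>\<^bsub>G\<^esub> (c \<otimes>\<^bsub>G\<^esub> v) = (c \<otimes>\<^bsub>G\<^esub> u) \<otimes>\<^bsub>G\<^esub> (b \<otimes>\<^bsub>G\<^esub> v)"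
    if "u \<in> carrier G" "v \<in> carrier G" for u v
    using assms(2-) that by (simp add: m_ac)
  from this[of "inv\<^bsub>G\<^esub> a" "inv\<^bsub>G\<^esub> b"] show ?thesis using assms(2-) by simp
qed

lemma diff_add_telescope:
  assumes "comm_group G" "a \<in> carrier G" "c \<in> carrier G" "w \<in> carrier G"
  shows "(c \<otimes>\<^bsub>G\<^esub> inv\<^bsub>G\<^esub> a) \<otimes>\<^bsub>G\<^esub> (a \<otimes>\<^bsub>G\<^esub> w) = c \<otimes>\<^bsub>G\<^esub> w"
proof -
  interpret comm_group G by fact
  have "inv\<^bsub>G\<^esub> a \<otimes>\<^bsub>G\<^esub> (a \<otimes>\<^bsub>G\<^esub> w) = (inv\<^bsub>G\<^esub> a \<otimes>\<^bsub>G\<^esub> a) \<otimes>\<^bsub>G\<^esub> w"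
    using assms(2-) by (intro m_assoc[symmetric]) auto
  also have "\<dots> = w" using assms(2-) by simp
  finally show ?thesis using assms(2-) by (simp add: m_assoc)
qed

lemma diff_diff_add_telescope:
  assumes "comm_group G" "t \<in> carrier G" "f \<in> carrier G" "j \<in> carrier G" "k \<in> carrier G"
  shows "((t \<otimes>\<^bsub>G\<^esub> inv\<^bsub>G\<^esub> f) \<otimes>\<^bsub>G\<^esub> inv\<^bsub>G\<^esub> j) \<otimes>\<^bsub>G\<^esub> (f \<otimes>\<^bsub>G\<^esub> inv\<^bsub>G\<^esub> k) = t \<otimes>\<^bsub>G\<^esub> inv\<^bsub>G\<^esub> (j \<otimes>\<^bsub>G\<^esub> k)"
proof -
  interpret comm_group G by fact
  have "((t \<otimes>\<^bsub>G\<^esub> inv\<^bsub>G\<^esub> f) \<otimes>\<^bsub>G\<^esub> u) \<otimes>\<^bsub>G\<^esub> (f \<otimes>\<^bsub>G\<^esub> v) = (t \<otimes>\<^bsub>G\<^esub> inv\<^bsub>G\<^esub> f) \<otimes>\<^bsub>G\<^esub> (f \<otimes>\<^bsub>G\<^esub> (u \<otimes>\<^bsub>G\<^esub> v))"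
    if "u \<in> carrier G" "v \<in> carrier G" for u v
    using assms(2-) that by (simp add: m_ac)
  then show ?thesis
    using assms by (simp add: diff_add_telescope inv_mult)
qed

lemma hom_mult_fun:
  assumes "comm_group G" "f \<in> hom A G" "g \<in> hom A G"
  shows "(\<lambda>x. f x \<otimes>\<^bsub>G\<^esub> g x) \<in> hom A G"
proof -
  interpret comm_group G by fact
  show ?thesis
    using assms(2,3) by (auto intro!: homI simp: hom_mult hom_in_carrier m_ac)
qed

lemma hom_one_fun: "comm_group G \<Longrightarrow> (\<lambda>_. \<one>\<^bsub>G\<^esub>) \<in> hom A G"
  by (auto intro!: homI simp: comm_group_def comm_monoid_def monoid.one_closed monoid.l_one)

lemma hom_inv_fun:
  assumes "comm_group G" "group A" "f \<in> hom A G"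
  shows "(\<lambda>x. inv\<^bsub>G\<^esub> f x) \<in> hom A G"
proof -
  interpret comm_group G by fact
  show ?thesis
    using assms(2,3) by (auto intro!: homI simp: hom_mult hom_in_carrier inv_mult)
qed

lemma hom_pow_fun:
  assumes "comm_group G" "f \<in> hom A G"
  shows "(\<lambda>x. f x [^]\<^bsub>G\<^esub> (k :: int)) \<in> hom A G"
proof -
  interpret comm_group G by fact
  show ?thesis
    using assms(2) by (auto intro!: homI simp: hom_mult hom_in_carrier int_pow_distrib)
qed

lemma hom_pow_exponent:
  assumes "group G" "e \<in> hom A integer_group" "x \<in> carrier G"
  shows "(\<lambda>a. x [^]\<^bsub>G\<^esub> e a) \<in> hom A G"
proof -
  interpret group G by fact
  show ?thesis
    using assms by (auto intro!: homI simp: hom_mult int_pow_mult)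
qed

lemma hom_comp: "f \<in> hom A B \<Longrightarrow> g \<in> hom B C \<Longrightarrow> (\<lambda>x. g (f x)) \<in> hom A C"
  using Group.hom_compose[of f A B g C] by (simp add: comp_def)

lemma hom_one_eq: "h \<in> hom A B \<Longrightarrow> comm_group A \<Longrightarrow> comm_group B \<Longrightarrow> h \<one>\<^bsub>A\<^esub> = \<one>\<^bsub>B\<^esub>"
  by (simp add: comm_group.axioms(2) hom_one)

lemma hom_inv_eq:
  assumes "h \<in> hom A B" "comm_group A" "comm_group B" "x \<in> carrier A"
  shows "h (inv\<^bsub>A\<^esub> x) = inv\<^bsub>B\<^esub> h x"
proof -
  interpret group_hom A B h
    using assms by (simp add: group_hom_def group_hom_axioms_def comm_group.axioms(2))
  show ?thesis using assms(4) by simp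
qed

lemma hom_pow_eq:
  assumes "h \<in> hom A B" "comm_group A" "comm_group B" "x \<in> carrier A"
  shows "h (x [^]\<^bsub>A\<^esub> (k :: int)) = h x [^]\<^bsub>B\<^esub> k"
proof -
  interpret group_hom A B h
    using assms by (simp add: group_hom_def group_hom_axioms_def comm_group.axioms(2))
  show ?thesis using assms(4) by (simp add: hom_int_pow)
qed

text \<open>The formula of \<open>pextend\<close> on an explicit chain instead of a chosen
  representative of a coset; \<open>pextend_hom\<close> shows that the choice is immaterial.\<close>

definition free_extend :: "('h, 'm) monoid_scheme \<Rightarrow> ('g \<Rightarrow> 'h) \<Rightarrow> ('g \<Rightarrow>\<^sub>0 int) \<Rightarrow> 'h"
  where "free_extend G \<phi> c =
    finprod G (\<lambda>x. \<phi> x [^]\<^bsub>G\<^esub> Poly_Mapping.lookup c x) (Poly_Mapping.keys c)"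

text \<open>Outside the support the exponents are zero. Enlarging the index set lets chains with
  different supports be compared factor by factor.\<close>

lemma free_extend_superset:
  assumes "comm_group G" "\<phi> \<in> A \<rightarrow> carrier G" "finite A" "Poly_Mapping.keys c \<subseteq> A"
  shows "free_extend G \<phi> c = finprod G (\<lambda>x. \<phi> x [^]\<^bsub>G\<^esub> Poly_Mapping.lookup c x) A"
proof -
  interpret comm_group G by fact
  show ?thesis unfolding free_extend_def
    using assms(2-) by (intro finprod_mono_neutral_cong_left) (auto simp: in_keys_iff)
qed

lemma free_extend_hom:
  assumes G: "comm_group G" and \<phi>: "\<phi> \<in> S \<rightarrow> carrier G"
  shows "free_extend G \<phi> \<in> hom (free_Abelian_group S) G"
proof (rule homI)
  interpret comm_group G by fact
  fix c assume c: "c \<in> carrier (free_Abelian_group S)"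
  then show "free_extend G \<phi> c \<in> carrier G"
    using \<phi> by (auto simp: free_extend_def intro!: finprod_closed)
  fix d assume d: "d \<in> carrier (free_Abelian_group S)"
  \<comment> \<open>Cancellation can make the support of \<open>c + d\<close> smaller than this
    union, hence all three products are taken over the union.\<close>
  let ?A = "Poly_Mapping.keys c \<union> Poly_Mapping.keys d"
  have \<phi>A: "\<phi> \<in> ?A \<rightarrow> carrier G" using \<phi> c d by auto
  have "free_extend G \<phi> (c + d) = finprod G (\<lambda>x. \<phi> x [^]\<^bsub>G\<^esub> Poly_Mapping.lookup (c + d) x) ?A"
    using Poly_Mapping.keys_add[of c d] by (intro free_extend_superset G \<phi>A) auto
  also have "\<dots> = finprod G (\<lambda>x. \<phi> x [^]\<^bsub>G\<^esub> Poly_Mapping.lookup c x \<otimes>\<^bsub>G\<^esub> \<phi> x [^]\<^bsub>G\<^esub> Poly_Mapping.lookup d x) ?A"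
    using \<phi>A by (intro finprod_cong') (auto simp: lookup_add Pi_iff simp flip: int_pow_mult)
  also have "\<dots> = finprod G (\<lambda>x. \<phi> x [^]\<^bsub>G\<^esub> Poly_Mapping.lookup c x) ?A \<otimes>\<^bsub>G\<^esub>
                  finprod G (\<lambda>x. \<phi> x [^]\<^bsub>G\<^esub> Poly_Mapping.lookup d x) ?A"
    using \<phi>A by (intro finprod_multf) auto
  also have "\<dots> = free_extend G \<phi> c \<otimes>\<^bsub>G\<^esub> free_extend G \<phi> d"
    using free_extend_superset[OF G \<phi>A, of c] free_extend_superset[OF G \<phi>A, of d] by simp
  finally show "free_extend G \<phi> (c \<otimes>\<^bsub>free_Abelian_group S\<^esub> d) =
      free_extend G \<phi> c \<otimes>\<^bsub>G\<^esub> free_extend G \<phi> d" by simp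
qed

lemma free_extend_of:
  assumes "comm_group G" "\<phi> x \<in> carrier G"
  shows "free_extend G \<phi> (frag_of x) = \<phi> x"
proof -
  interpret comm_group G by fact
  show ?thesis using assms(2) by (simp add: free_extend_def)
qed

text \<open>All relations of \<open>lam\<close> and \<open>tensor\<close> equate a generator with the sum of two generators.\<close>

definition triple_rels :: "'g set \<Rightarrow> ('g \<Rightarrow>\<^sub>0 int) set \<Rightarrow> ('g \<Rightarrow> 'g \<Rightarrow> 'g \<Rightarrow> bool) \<Rightarrow> bool"
  where "triple_rels S R T \<longleftrightarrow>
    (\<forall>r \<in> R. \<exists>a \<in> S. \<exists>b \<in> S. \<exists>c \<in> S. T a b c \<and> r = frag_of a - frag_of b - frag_of c)"

lemma triple_rels_subset: "triple_rels S R T \<Longrightarrow> R \<subseteq> carrier (free_Abelian_group S)"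
  by (fastforce simp: triple_rels_def dest!: subsetD[OF keys_diff])

text \<open>The subtracted generators are moved to the other side, so no inverse in \<open>G\<close>
  appears. Used both for \<open>free_extend\<close> and for the quotient map to a presented
  group.\<close>

lemma free_hom_of_diff:
  assumes "h \<in> hom (free_Abelian_group S) G" "comm_group G" "a \<in> S" "b \<in> S" "c \<in> S"
  shows "h (frag_of a - frag_of b - frag_of c) \<otimes>\<^bsub>G\<^esub> (h (frag_of b) \<otimes>\<^bsub>G\<^esub> h (frag_of c)) = h (frag_of a)"
proof -
  let ?F = "free_Abelian_group S"
  have car: "frag_of a \<in> carrier ?F" "frag_of b \<in> carrier ?F" "frag_of c \<in> carrier ?F"
    using assms(3-) by auto
  then have car': "frag_of a - frag_of b - frag_of c \<in> carrier ?F"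
      "frag_of b + frag_of c \<in> carrier ?F"
    using assms(3-) by (auto dest!: subsetD[OF keys_diff] subsetD[OF Poly_Mapping.keys_add])
  have "h (frag_of a) = h ((frag_of a - frag_of b - frag_of c) \<otimes>\<^bsub>?F\<^esub> (frag_of b \<otimes>\<^bsub>?F\<^esub> frag_of c))"
    by simp
  also have "\<dots> = h (frag_of a - frag_of b - frag_of c) \<otimes>\<^bsub>G\<^esub> h (frag_of b \<otimes>\<^bsub>?F\<^esub> frag_of c)"
    using car' by (intro hom_mult[OF assms(1)]) (simp_all only: mult_free_Abelian_group)
  also have "h (frag_of b \<otimes>\<^bsub>?F\<^esub> frag_of c) = h (frag_of b) \<otimes>\<^bsub>G\<^esub> h (frag_of c)"
    using car by (intro hom_mult[OF assms(1)]) 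
  finally show ?thesis by simp
qed

lemma normal_generate_free:
  assumes "R \<subseteq> carrier (free_Abelian_group S)"
  shows "generate (free_Abelian_group S) R \<lhd> free_Abelian_group S"
  by (intro comm_group.subgroup_imp_normal abelian_free_Abelian_group
      group.generate_is_subgroup group_free_Abelian_group assms)

lemma pclass_hom:
  assumes "R \<subseteq> carrier (free_Abelian_group S)"
  shows "(\<lambda>c. generate (free_Abelian_group S) R #>\<^bsub>free_Abelian_group S\<^esub> c)
    \<in> hom (free_Abelian_group S) (presented S R)"
  unfolding presented_def by (intro normal.r_coset_hom_Mod normal_generate_free assms)

text \<open>Each relation lies in the kernel of \<open>free_extend\<close>, hence so does the
  subgroup they generate. The value is therefore constant on cosets, whichever representative
  \<open>SOME\<close> picks in \<open>pextend\<close>.\<close>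

lemma pextend_hom:
  fixes G :: "('h, 'm) monoid_scheme"
  assumes G: "comm_group G" and \<phi>: "\<phi> \<in> S \<rightarrow> carrier G"
    and R: "triple_rels S R (\<lambda>a b c. \<phi> a = \<phi> b \<otimes>\<^bsub>G\<^esub> \<phi> c)"
  shows "pextend G \<phi> \<in> hom (presented S R) G"
    and "x \<in> S \<Longrightarrow> pextend G \<phi> (pclass S R x) = \<phi> x"
proof -
  interpret comm_group G by fact
  let ?F = "free_Abelian_group S" and ?h = "free_extend G \<phi>"
  let ?N = "generate ?F R"
  note h = free_extend_hom[OF G \<phi>]
  interpret gh: group_hom ?F G ?h
    using h by (simp add: group_hom_def group_hom_axioms_def is_group)
  have Rsub: "R \<subseteq> carrier ?F" by (rule triple_rels_subset[OF R])
  have "R \<subseteq> kernel ?F G ?h"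
  proof
    fix r assume r: "r \<in> R"
    then obtain a b c where abc: "a \<in> S" "b \<in> S" "c \<in> S" "\<phi> a = \<phi> b \<otimes>\<^bsub>G\<^esub> \<phi> c"
      "r = frag_of a - frag_of b - frag_of c" using R by (auto simp: triple_rels_def)
    have car: "\<phi> b \<in> carrier G" "\<phi> c \<in> carrier G" "?h r \<in> carrier G"
      using \<phi> abc Rsub r gh.hom_closed by blast+
    have "?h r \<otimes>\<^bsub>G\<^esub> (\<phi> b \<otimes>\<^bsub>G\<^esub> \<phi> c) = \<phi> b \<otimes>\<^bsub>G\<^esub> \<phi> c"
      using free_hom_of_diff[OF h G abc(1-3)] abc \<phi>
      by (auto simp: free_extend_of[OF G] Pi_iff)
    then have "?h r = \<one>\<^bsub>G\<^esub>" using car by (simp add: r_cancel_one)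
    then show "r \<in> kernel ?F G ?h" using Rsub r by (simp add: kernel_def subset_iff del: carrier_free_Abelian_group_iff)
  qed
  then have ker: "?N \<subseteq> kernel ?F G ?h"
    by (intro group.generate_subgroup_incl gh.subgroup_kernel) auto
  have nrm: "?N \<lhd> ?F" by (rule normal_generate_free[OF Rsub])
  have const: "?h x = ?h y" if "x \<in> carrier ?F" "y \<in> carrier ?F" "?N #>\<^bsub>?F\<^esub> x = ?N #>\<^bsub>?F\<^esub> y" for x y
  proof -
    have sN: "subgroup ?N ?F" using nrm by (simp add: normal_def)
    have "x \<in> ?N #>\<^bsub>?F\<^esub> y"
      using that(1,3) group.rcos_self[OF group_free_Abelian_group _ sN, of x] by simp
    then obtain k where k: "k \<in> ?N" "x = k \<otimes>\<^bsub>?F\<^esub> y" by (auto simp: r_coset_def)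
    then have "?h x = ?h k \<otimes>\<^bsub>G\<^esub> ?h y"
      using ker that by (auto simp only: kernel_def intro!: hom_mult[OF h])
    then show ?thesis using k ker that(2) by (auto simp: kernel_def)
  qed
  have val: "pextend G \<phi> (?N #>\<^bsub>?F\<^esub> c) = ?h c" if c: "c \<in> carrier ?F" for c
  proof -
    let ?d = "SOME d. d \<in> ?N #>\<^bsub>?F\<^esub> c"
    have sN: "subgroup ?N ?F" using nrm by (simp add: normal_def)
    have "c \<in> ?N #>\<^bsub>?F\<^esub> c" using group.rcos_self[OF group_free_Abelian_group _ sN] c by simp
    then have d: "?d \<in> ?N #>\<^bsub>?F\<^esub> c" by (rule someI)
    have dF: "?d \<in> carrier ?F"
      using d c subgroup.subset[OF sN] monoid.r_coset_subset_G[OF group.is_monoid[OF group_free_Abelian_group]] by blast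
    have "?N #>\<^bsub>?F\<^esub> c = ?N #>\<^bsub>?F\<^esub> ?d"
      using group.repr_independence[OF _ d c sN] by simp
    then show ?thesis
      using const[OF dF c] by (simp add: pextend_def Let_def free_extend_def)
  qed
  show "pextend G \<phi> \<in> hom (presented S R) G"
  proof (rule homI)
    fix X Y assume "X \<in> carrier (presented S R)" "Y \<in> carrier (presented S R)"
    then obtain x y where xy: "x \<in> carrier ?F" "y \<in> carrier ?F"
       "X = ?N #>\<^bsub>?F\<^esub> x" "Y = ?N #>\<^bsub>?F\<^esub> y"
      by (auto simp only: presented_def carrier_FactGroup)
    have "X \<otimes>\<^bsub>presented S R\<^esub> Y = ?N #>\<^bsub>?F\<^esub> (x \<otimes>\<^bsub>?F\<^esub> y)"
      using hom_mult[OF pclass_hom[OF Rsub] xy(1,2)] xy by simp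
    then show "pextend G \<phi> (X \<otimes>\<^bsub>presented S R\<^esub> Y) = pextend G \<phi> X \<otimes>\<^bsub>G\<^esub> pextend G \<phi> Y"
      using val[of x] val[of y] val[of "x \<otimes>\<^bsub>?F\<^esub> y"] xy hom_mult[OF h xy(1,2)] gh.G.m_closed[OF xy(1,2)]
      by simp
  next
    fix X assume "X \<in> carrier (presented S R)"
    then obtain x where "x \<in> carrier ?F" "X = ?N #>\<^bsub>?F\<^esub> x"
      by (auto simp only: presented_def carrier_FactGroup)
    then show "pextend G \<phi> X \<in> carrier G" using val[of x] by (simp add: gh.hom_closed)
  qed
  show "x \<in> S \<Longrightarrow> pextend G \<phi> (pclass S R x) = \<phi> x"
    using val[of "frag_of x"] \<phi> by (auto simp: pclass_def free_extend_of[OF G] Pi_iff)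
qed

lemma pclass_triple:
  assumes "R \<subseteq> carrier (free_Abelian_group S)" "frag_of a - frag_of b - frag_of c \<in> R"
    and "a \<in> S" "b \<in> S" "c \<in> S"
  shows "pclass S R a = pclass S R b \<otimes>\<^bsub>presented S R\<^esub> pclass S R c"
proof -
  let ?F = "free_Abelian_group S" let ?N = "generate ?F R"
  interpret P: comm_group "presented S R" by (rule comm_group_presented[OF assms(1)])
  have "?N #>\<^bsub>?F\<^esub> (frag_of a - frag_of b - frag_of c) = ?N"
    using assms by (intro subgroup.rcos_const[OF group.generate_is_subgroup] generate.incl) auto
  then have "?N #>\<^bsub>?F\<^esub> (frag_of a - frag_of b - frag_of c) = \<one>\<^bsub>presented S R\<^esub>"
    by (simp add: presented_def)
  then show ?thesis
    using free_hom_of_diff[OF pclass_hom[OF assms(1)] P.comm_group_axioms assms(3-)]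
      pclass_closed[OF assms(4), of R] pclass_closed[OF assms(5), of R]
    by (simp add: pclass_def)
qed

text \<open>Both maps pull back to homomorphisms on the free group, which is generated by the
  \<open>frag_of x\<close> under differences.\<close>

lemma presented_hom_eq:
  assumes R: "R \<subseteq> carrier (free_Abelian_group S)" and G: "comm_group G"
    and f: "f \<in> hom (presented S R) G" and g: "g \<in> hom (presented S R) G"
    and eq: "\<And>x. x \<in> S \<Longrightarrow> f (pclass S R x) = g (pclass S R x)"
    and X: "X \<in> carrier (presented S R)"
  shows "f X = g X"
proof -
  let ?F = "free_Abelian_group S" let ?N = "generate ?F R"
  let ?q = "\<lambda>c. ?N #>\<^bsub>?F\<^esub> c"
  interpret comm_group G by fact
  obtain c where c: "Poly_Mapping.keys c \<subseteq> S" "X = ?q c"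
    using X by (auto simp: presented_def carrier_FactGroup)
  note fq = hom_comp[OF pclass_hom[OF R] f] and gq = hom_comp[OF pclass_hom[OF R] g]
  interpret fq: group_hom ?F G "\<lambda>c. f (?q c)"
    using fq by (simp add: group_hom_def group_hom_axioms_def is_group)
  interpret gq: group_hom ?F G "\<lambda>c. g (?q c)"
    using gq by (simp add: group_hom_def group_hom_axioms_def is_group)
  have "f (?q c) = g (?q c)"
  proof (rule free_Abelian_group_induct[where P = "\<lambda>c. f (?q c) = g (?q c)", OF c(1)])
    fix a b assume 2: "Poly_Mapping.keys a \<subseteq> S" "Poly_Mapping.keys b \<subseteq> S"
      "f (?q a) = g (?q a)" "f (?q b) = g (?q b)"
    then have ab: "a \<in> carrier ?F" "inv\<^bsub>?F\<^esub> b \<in> carrier ?F" "b \<in> carrier ?F" by auto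
    have "a - b = a \<otimes>\<^bsub>?F\<^esub> inv\<^bsub>?F\<^esub> b" using 2 by simp
    then show "f (?q (a - b)) = g (?q (a - b))"
      using 2 fq.hom_mult[OF ab(1,2)] gq.hom_mult[OF ab(1,2)] fq.hom_inv[OF ab(3)] gq.hom_inv[OF ab(3)]
      by metis
  qed (use fq.hom_one gq.hom_one eq in \<open>auto simp: pclass_def\<close>)
  then show ?thesis using c by simp
qed

section \<open>Submonoids and their generators\<close>

lemma submonoid_vimage:
  assumes "comm_group A" "comm_group G" "h \<in> hom A G" "submonoid M G"
  shows "submonoid {x \<in> carrier A. h x \<in> M} A"
proof -
  interpret A: comm_group A by fact
  interpret M: submonoid M G by fact
  show ?thesis
    using hom_one_eq[OF assms(3,1,2)]
    by unfold_locales (auto simp: hom_mult[OF assms(3)])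
qed

lemma hull_submonoid_least:
  "submonoid M G \<Longrightarrow> Y \<subseteq> M \<Longrightarrow> (\<lambda>H. submonoid H G) hull Y \<subseteq> M"
  by (simp add: hull_minimal)

lemma submonoid_hull:
  assumes "comm_group G" "Y \<subseteq> carrier G"
  shows "submonoid ((\<lambda>H. submonoid H G) hull Y) G"
proof -
  interpret G: comm_group G by fact
  show ?thesis
  proof
    show "(\<lambda>H. submonoid H G) hull Y \<subseteq> carrier G" by (rule submonoid_hull_subset[OF assms])
  next
    fix x y assume "x \<in> (\<lambda>H. submonoid H G) hull Y" "y \<in> (\<lambda>H. submonoid H G) hull Y"
    then show "x \<otimes>\<^bsub>G\<^esub> y \<in> (\<lambda>H. submonoid H G) hull Y"
      by (auto simp: hull_def intro: submonoid.m_closed)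
  next
    show "\<one>\<^bsub>G\<^esub> \<in> (\<lambda>H. submonoid H G) hull Y"
      by (auto simp: hull_def intro: submonoid.one_closed)
  qed
qed

text \<open>The preimage of \<open>M\<close> is a submonoid, so it contains the hull of
  \<open>Y\<close> once it contains \<open>Y\<close>. Positivity claims below are reduced to
  generators in this way.\<close>

lemma hom_hull_subset:
  assumes "comm_group A" "comm_group G" "h \<in> hom A G" "submonoid M G"
    and "Y \<subseteq> carrier A" "\<And>y. y \<in> Y \<Longrightarrow> h y \<in> M"
  shows "h ` ((\<lambda>H. submonoid H A) hull Y) \<subseteq> M"
  using hull_submonoid_least[OF submonoid_vimage[OF assms(1-4)], of Y] assms(5,6) by auto

lemma submonoid_pow_nonneg:
  assumes "submonoid M G" "x \<in> M" "0 \<le> k"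
  shows "x [^]\<^bsub>G\<^esub> (k :: int) \<in> M"
proof -
  interpret submonoid M G by fact
  have "x [^]\<^bsub>G\<^esub> n \<in> M" for n :: nat
    by (induction n) (use assms(2) in auto)
  then show ?thesis using assms(3) by (metis int_pow_int nonneg_int_cases)
qed

lemma mem_submonoid_hull: "x \<in> Y \<Longrightarrow> x \<in> (\<lambda>H. submonoid H G) hull Y"
  by (simp add: hull_inc)

section \<open>Complexes and their cells\<close>

text \<open>
  An augmented directed complex stripped of \<open>bd_bd\<close>, \<open>aug_bd\<close> and \<open>aug_pos\<close>: the structure on which
  \<open>nu\<close> already takes values in strict omega-categories.
\<close>

locale precomplex =
  fixes K :: "'a adc"
  assumes grp_comm: "comm_group (grp K n)"
    and bd_hom: "bd K (Suc n) \<in> hom (grp K (Suc n)) (grp K n)"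
    and aug_hom: "aug K \<in> hom (grp K 0) integer_group"
    and pos_submonoid: "submonoid (pos K n) (grp K n)"
begin

sublocale G: comm_group "grp K n" for n by (rule grp_comm)

sublocale M: submonoid "pos K n" "grp K n" for n by (rule pos_submonoid)

lemma bd_closed: "x \<in> carrier (grp K (Suc n)) \<Longrightarrow> bd K (Suc n) x \<in> carrier (grp K n)"
  using bd_hom hom_in_carrier by fast

lemma bd_mult: "x \<in> carrier (grp K (Suc n)) \<Longrightarrow> y \<in> carrier (grp K (Suc n)) \<Longrightarrow>
    bd K (Suc n) (x \<otimes>\<^bsub>grp K (Suc n)\<^esub> y) = bd K (Suc n) x \<otimes>\<^bsub>grp K n\<^esub> bd K (Suc n) y"
  by (rule hom_mult[OF bd_hom])

lemma bd_one: "bd K (Suc n) \<one>\<^bsub>grp K (Suc n)\<^esub> = \<one>\<^bsub>grp K n\<^esub>"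
  by (rule hom_one_eq[OF bd_hom grp_comm grp_comm])

lemma pos_closed: "x \<in> pos K n \<Longrightarrow> x \<in> carrier (grp K n)"
  using M.subset by blast

lemma nu_cells_pos:
  assumes "x \<in> nu_cells K"
  shows "fst (x n) \<in> pos K n" "snd (x n) \<in> pos K n"
  using assms by (auto simp: nu_cells_def)

lemma nu_cells_closed:
  assumes "x \<in> nu_cells K"
  shows "fst (x n) \<in> carrier (grp K n)" "snd (x n) \<in> carrier (grp K n)"
  using nu_cells_pos[OF assms] by (auto intro: pos_closed)

lemma nu_cells_bd:
  assumes "x \<in> nu_cells K"
  shows "bd K (Suc n) (fst (x (Suc n))) = snd (x n) \<otimes>\<^bsub>grp K n\<^esub> inv\<^bsub>grp K n\<^esub> fst (x n)"
    "bd K (Suc n) (snd (x (Suc n))) = snd (x n) \<otimes>\<^bsub>grp K n\<^esub> inv\<^bsub>grp K n\<^esub> fst (x n)"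
  using assms by (auto simp: nu_cells_def)

lemma nu_composable:
  "composable (nu K) p x y \<longleftrightarrow> x \<in> nu_cells K \<and> y \<in> nu_cells K \<and>
     (\<forall>n<p. x n = y n) \<and> snd (x p) = fst (y p)"
proof -
  have "tgt (nu K) p x = src (nu K) p y \<longleftrightarrow> (\<forall>n<p. x n = y n) \<and> snd (x p) = fst (y p)"
  proof
    assume e: "tgt (nu K) p x = src (nu K) p y"
    have "x n = y n" if "n < p" for n
      using fun_cong[OF e, of n] that by (simp add: nu_def)
    then show "(\<forall>n<p. x n = y n) \<and> snd (x p) = fst (y p)"
      using fun_cong[OF e, of p] by (simp add: nu_def)
  qed (auto simp: nu_def fun_eq_iff)
  then show ?thesis by (simp add: composable_def) (simp add: nu_def)
qed

lemma nu_src_closed: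
  assumes x: "x \<in> nu_cells K"
  shows "src (nu K) p x \<in> nu_cells K"
proof -
  have pos: "fst (src (nu K) p x n) \<in> pos K n" "snd (src (nu K) p x n) \<in> pos K n" for n
    using nu_cells_pos[OF x] by (auto simp: nu_def)
  have aug: "aug K (fst (src (nu K) p x 0)) = 1" "aug K (snd (src (nu K) p x 0)) = 1"
    using x by (auto simp: nu_def nu_cells_def)
  have bd: "bd K (Suc n) y = snd (src (nu K) p x n) \<otimes>\<^bsub>grp K n\<^esub> inv\<^bsub>grp K n\<^esub> fst (src (nu K) p x n)"
    if "y \<in> {fst (src (nu K) p x (Suc n)), snd (src (nu K) p x (Suc n))}" for n y
    using that nu_cells_bd[OF x] nu_cells_closed[OF x]
    by (cases "Suc n < p"; cases "Suc n = p"; cases "n = p") (auto simp: nu_def bd_one)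
  have fin: "\<exists>N. \<forall>n\<ge>N. src (nu K) p x n = (\<one>\<^bsub>grp K n\<^esub>, \<one>\<^bsub>grp K n\<^esub>)"
    by (intro exI[of _ "Suc p"]) (auto simp: nu_def)
  show ?thesis
    unfolding nu_cells_def using pos aug bd fin by blast
qed

lemma nu_tgt_closed:
  assumes x: "x \<in> nu_cells K"
  shows "tgt (nu K) p x \<in> nu_cells K"
proof -
  have pos: "fst (tgt (nu K) p x n) \<in> pos K n" "snd (tgt (nu K) p x n) \<in> pos K n" for n
    using nu_cells_pos[OF x] by (auto simp: nu_def)
  have aug: "aug K (fst (tgt (nu K) p x 0)) = 1" "aug K (snd (tgt (nu K) p x 0)) = 1"
    using x by (auto simp: nu_def nu_cells_def)
  have bd: "bd K (Suc n) y = snd (tgt (nu K) p x n) \<otimes>\<^bsub>grp K n\<^esub> inv\<^bsub>grp K n\<^esub> fst (tgt (nu K) p x n)"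
    if "y \<in> {fst (tgt (nu K) p x (Suc n)), snd (tgt (nu K) p x (Suc n))}" for n y
    using that nu_cells_bd[OF x] nu_cells_closed[OF x]
    by (cases "Suc n < p"; cases "Suc n = p"; cases "n = p") (auto simp: nu_def bd_one)
  have fin: "\<exists>N. \<forall>n\<ge>N. tgt (nu K) p x n = (\<one>\<^bsub>grp K n\<^esub>, \<one>\<^bsub>grp K n\<^esub>)"
    by (intro exI[of _ "Suc p"]) (auto simp: nu_def)
  show ?thesis
    unfolding nu_cells_def using pos aug bd fin by blast
qed

lemma nu_cmp_closed:
  assumes "composable (nu K) p x y"
  shows "cmp (nu K) p x y \<in> nu_cells K"
proof -
  let ?z = "cmp (nu K) p x y"
  have x: "x \<in> nu_cells K" and y: "y \<in> nu_cells K" and low: "\<And>n. n < p \<Longrightarrow> x n = y n"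
    and eq: "snd (x p) = fst (y p)"
    using assms by (auto simp: nu_composable)
  note cl = nu_cells_closed[OF x] nu_cells_closed[OF y]
  have pos: "fst (?z n) \<in> pos K n" "snd (?z n) \<in> pos K n" for n
    using nu_cells_pos[OF x] nu_cells_pos[OF y] by (auto simp: nu_def)
  have aug: "aug K (fst (?z 0)) = 1" "aug K (snd (?z 0)) = 1"
    using x y by (auto simp: nu_def nu_cells_def)
  have bd: "bd K (Suc n) v = snd (?z n) \<otimes>\<^bsub>grp K n\<^esub> inv\<^bsub>grp K n\<^esub> fst (?z n)"
    if v: "v \<in> {fst (?z (Suc n)), snd (?z (Suc n))}" for n v
  proof -
    consider "Suc n < p" | "Suc n = p" | "n = p" | "p < n" by linarith
    then show ?thesis
    proof cases
      case 1
      then show ?thesis using v nu_cells_bd[OF x] by (auto simp: nu_def)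
    next
      \<comment> \<open>In degree \<open>p\<close> the composite takes one component from each
        factor; both have the required boundary because \<open>x\<close> and \<open>y\<close> agree
        in degree \<open>n\<close>.\<close>
      case 2
      then show ?thesis using v nu_cells_bd[OF x] nu_cells_bd[OF y] low[of n] by (auto simp: nu_def)
    next
      \<comment> \<open>Here \<open>v\<close> is a sum of components of \<open>x\<close> and
        \<open>y\<close> in degree \<open>Suc p\<close>, so its boundary is a sum of two differences
        in degree \<open>p\<close>, which telescopes at the common term given by
        \<open>eq\<close>.\<close>
      case 3
      have "bd K (Suc n) v = (snd (x p) \<otimes>\<^bsub>grp K p\<^esub> inv\<^bsub>grp K p\<^esub> fst (x p)) \<otimes>\<^bsub>grp K p\<^esub>
          (snd (y p) \<otimes>\<^bsub>grp K p\<^esub> inv\<^bsub>grp K p\<^esub> fst (y p))"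
        using v 3 cl nu_cells_bd[OF x] nu_cells_bd[OF y] by (auto simp: nu_def bd_mult)
      also have "\<dots> = snd (y p) \<otimes>\<^bsub>grp K p\<^esub> inv\<^bsub>grp K p\<^esub> fst (x p)"
        using cl[of p] eq by (simp add: diff_telescope[OF grp_comm])
      finally show ?thesis using 3 by (simp add: nu_def)
    next
      case 4
      then show ?thesis
        using v cl nu_cells_bd[OF x] nu_cells_bd[OF y]
        by (auto simp: nu_def bd_mult G.inv_mult G.m_ac)
    qed
  qed
  obtain N N' where "\<forall>n\<ge>N. x n = (\<one>\<^bsub>grp K n\<^esub>, \<one>\<^bsub>grp K n\<^esub>)" "\<forall>n\<ge>N'. y n = (\<one>\<^bsub>grp K n\<^esub>, \<one>\<^bsub>grp K n\<^esub>)"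
    using x y by (auto simp: nu_cells_def)
  then have fin: "\<exists>N. \<forall>n\<ge>N. ?z n = (\<one>\<^bsub>grp K n\<^esub>, \<one>\<^bsub>grp K n\<^esub>)"
    by (intro exI[of _ "max N N'"]) (auto simp: nu_def)
  show ?thesis
    unfolding nu_cells_def using pos aug bd fin by blast
qed

lemma nu_finite_dim:
  assumes "x \<in> nu_cells K"
  shows "\<exists>q. x \<in> qcells (nu K) q"
proof -
  obtain N where "\<forall>n\<ge>N. x n = (\<one>\<^bsub>grp K n\<^esub>, \<one>\<^bsub>grp K n\<^esub>)"
    using assms by (auto simp: nu_cells_def)
  then have "x \<in> qcells (nu K) N"
    using assms by (auto simp: qcells_def nu_def)
  then show ?thesis ..
qed

text \<open>Every operation of \<open>nu K\<close> selects or adds entries, so each axiom is an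
  identity in a single degree; interchange comes down to commutativity of the groups.\<close>

lemma strict_omega_category_nu: "strict_omega_category (nu K)"
proof
  have cells: "cells (nu K) = nu_cells K" by (simp add: nu_def)
  fix p q x
  assume x: "x \<in> cells (nu K)"
  show "src (nu K) p x \<in> cells (nu K)" "tgt (nu K) p x \<in> cells (nu K)"
      "\<exists>q. x \<in> qcells (nu K) q"
    using x nu_src_closed nu_tgt_closed nu_finite_dim by (simp_all add: cells)
  show "src (nu K) q (src (nu K) p x) = (if q < p then src (nu K) q x else src (nu K) p x)"
    "src (nu K) q (tgt (nu K) p x) = (if q < p then src (nu K) q x else tgt (nu K) p x)"
    "tgt (nu K) q (src (nu K) p x) = (if q < p then tgt (nu K) q x else src (nu K) p x)"
    "tgt (nu K) q (tgt (nu K) p x) = (if q < p then tgt (nu K) q x else tgt (nu K) p x)"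
    by (auto simp: nu_def)
  show "cmp (nu K) p (src (nu K) p x) x = x" "cmp (nu K) p x (tgt (nu K) p x) = x"
    using nu_cells_closed x by (auto simp: nu_def fun_eq_iff cells)
next
  fix p x y assume c: "composable (nu K) p x y"
  then show "cmp (nu K) p x y \<in> cells (nu K)"
    using nu_cmp_closed by (simp add: nu_def)
  show "src (nu K) p (cmp (nu K) p x y) = src (nu K) p x"
    by (auto simp: nu_def)
  show "tgt (nu K) p (cmp (nu K) p x y) = tgt (nu K) p y"
    using c by (auto simp: nu_composable) (auto simp: nu_def)
  fix q :: nat assume "p < q"
  then show "src (nu K) q (cmp (nu K) p x y) = cmp (nu K) p (src (nu K) q x) (src (nu K) q y)"
    "tgt (nu K) q (cmp (nu K) p x y) = cmp (nu K) p (tgt (nu K) q x) (tgt (nu K) q y)"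
    by (auto simp: nu_def)
next
  fix p x y z assume "composable (nu K) p x y" "composable (nu K) p y z"
  then show "cmp (nu K) p (cmp (nu K) p x y) z = cmp (nu K) p x (cmp (nu K) p y z)"
    by (auto simp: nu_composable fun_eq_iff) (auto simp: nu_def nu_cells_closed G.m_assoc)
next
  fix p q :: nat and x y x' y'
  assume "p < q" "composable (nu K) q x y" "composable (nu K) q x' y'"
    "composable (nu K) p x x'" "composable (nu K) p y y'"
  then show "cmp (nu K) p (cmp (nu K) q x y) (cmp (nu K) q x' y') =
      cmp (nu K) q (cmp (nu K) p x x') (cmp (nu K) p y y')"
    by (auto simp: nu_composable fun_eq_iff) (auto simp: nu_def nu_cells_closed G.m_ac)
qed

end

section \<open>Maps of complexes, retracts and the functoriality of \<open>nu\<close>\<close>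

definition adc_map :: "'a adc \<Rightarrow> 'b adc \<Rightarrow> (nat \<Rightarrow> 'a \<Rightarrow> 'b) \<Rightarrow> bool"
  where "adc_map K L f \<longleftrightarrow>
    (\<forall>n. f n \<in> hom (grp K n) (grp L n)) \<and>
    (\<forall>n. \<forall>x \<in> carrier (grp K (Suc n)). f n (bd K (Suc n) x) = bd L (Suc n) (f (Suc n) x)) \<and>
    (\<forall>x \<in> carrier (grp K 0). aug L (f 0 x) = aug K x) \<and>
    (\<forall>n. f n ` pos K n \<subseteq> pos L n)"

definition adc_retract :: "'a adc \<Rightarrow> 'b adc \<Rightarrow> bool"
  where "adc_retract K L \<longleftrightarrow>
    (\<exists>i r. adc_map K L i \<and> adc_map L K r \<and> (\<forall>n. \<forall>x \<in> carrier (grp K n). r n (i n x) = x))"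

lemma adc_mapD:
  assumes "adc_map K L f"
  shows "f n \<in> hom (grp K n) (grp L n)"
    "x \<in> carrier (grp K (Suc n)) \<Longrightarrow> f n (bd K (Suc n) x) = bd L (Suc n) (f (Suc n) x)"
    "y \<in> carrier (grp K 0) \<Longrightarrow> aug L (f 0 y) = aug K y"
    "z \<in> pos K n \<Longrightarrow> f n z \<in> pos L n"
  using assms by (auto simp: adc_map_def image_subset_iff)

definition nu_map :: "(nat \<Rightarrow> 'a \<Rightarrow> 'b) \<Rightarrow> (nat \<Rightarrow> 'a \<times> 'a) \<Rightarrow> nat \<Rightarrow> 'b \<times> 'b"
  where "nu_map f x = (\<lambda>n. (f n (fst (x n)), f n (snd (x n))))"

lemma strict_functor_nu_map:
  assumes K: "precomplex K" and L: "precomplex L" and f: "adc_map K L f"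
  shows "strict_functor (nu K) (nu L) (nu_map f)"
proof -
  interpret K: precomplex K by fact
  interpret L: precomplex L by fact
  note hf = adc_mapD(1)[OF f]
  have one: "f n \<one>\<^bsub>grp K n\<^esub> = \<one>\<^bsub>grp L n\<^esub>" for n
    by (rule hom_one_eq[OF hf K.grp_comm L.grp_comm])
  have inv: "f n (inv\<^bsub>grp K n\<^esub> x) = inv\<^bsub>grp L n\<^esub> f n x" if "x \<in> carrier (grp K n)" for n x
    by (rule hom_inv_eq[OF hf K.grp_comm L.grp_comm that])
  have "nu_map f x \<in> nu_cells L" if x: "x \<in> nu_cells K" for x
  proof -
    note cl = K.nu_cells_closed[OF x] and bd = K.nu_cells_bd[OF x]
    have "\<exists>N. \<forall>n\<ge>N. x n = (\<one>\<^bsub>grp K n\<^esub>, \<one>\<^bsub>grp K n\<^esub>)"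
      using x by (simp add: nu_cells_def)
    then have "\<exists>N. \<forall>n\<ge>N. nu_map f x n = (\<one>\<^bsub>grp L n\<^esub>, \<one>\<^bsub>grp L n\<^esub>)"
      using one by (fastforce simp: nu_map_def)
    moreover have "aug K (fst (x 0)) = 1" "aug K (snd (x 0)) = 1"
      using x by (auto simp: nu_cells_def)
    moreover have "bd L (Suc n) (f (Suc n) (fst (x (Suc n)))) =
        f n (snd (x n)) \<otimes>\<^bsub>grp L n\<^esub> inv\<^bsub>grp L n\<^esub> f n (fst (x n))"
      "bd L (Suc n) (f (Suc n) (snd (x (Suc n)))) =
        f n (snd (x n)) \<otimes>\<^bsub>grp L n\<^esub> inv\<^bsub>grp L n\<^esub> f n (fst (x n))" for n
      using cl bd by (simp_all add: adc_mapD(2)[OF f, symmetric] hom_mult[OF hf] inv)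
    ultimately show ?thesis
      using K.nu_cells_pos[OF x] cl
      by (auto simp: nu_cells_def nu_map_def adc_mapD(3,4)[OF f])
  qed
  then show ?thesis
    unfolding strict_functor_def K.nu_composable
    by (auto simp: nu_def nu_map_def fun_eq_iff one K.nu_cells_closed hom_mult[OF hf])
qed

lemma omega_retract_nu:
  assumes K: "precomplex K" and L: "precomplex L" and ret: "adc_retract K L"
  shows "omega_retract (nu K) (nu L)"
proof -
  interpret K: precomplex K by fact
  interpret L: precomplex L by fact
  obtain i r where i: "adc_map K L i" and r: "adc_map L K r"
    and ri: "\<And>n x. x \<in> carrier (grp K n) \<Longrightarrow> r n (i n x) = x"
    using ret by (auto simp: adc_retract_def)
  have "nu_map r (nu_map i x) = x" if "x \<in> nu_cells K" for x
    using K.nu_cells_closed[OF that] by (simp add: nu_map_def fun_eq_iff ri)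
  then show ?thesis
    unfolding omega_retract_def
    using strict_functor_nu_map[OF K L i] strict_functor_nu_map[OF L K r]
      K.strict_omega_category_nu L.strict_omega_category_nu
    by (intro conjI exI[of _ "nu_map i"] exI[of _ "nu_map r"]) (auto simp: nu_def)
qed

section \<open>The linearization of a strict omega-category\<close>

lemma grp_lam: "grp (lam C) q = presented (qcells C q) (lam_rels C q)"
  by (simp add: lam_def Let_def)

lemma pos_lam: "pos (lam C) q = (\<lambda>H. submonoid H (grp (lam C) q)) hull (lam_class C q ` qcells C q)"
  by (simp add: lam_def Let_def)

lemma lam_class_closed: "x \<in> qcells C q \<Longrightarrow> lam_class C q x \<in> carrier (grp (lam C) q)"
  by (simp add: grp_lam lam_class_def pclass_closed)

lemma lam_class_pos: "x \<in> qcells C q \<Longrightarrow> lam_class C q x \<in> pos (lam C) q"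
  by (simp add: pos_lam mem_submonoid_hull)

context strict_omega_category
begin

lemma qcells_cells: "x \<in> qcells C q \<Longrightarrow> x \<in> cells C"
  by (simp add: qcells_def)

lemma src_qcell: "x \<in> qcells C q \<Longrightarrow> q \<le> p \<Longrightarrow> src C p x = x"
  by (cases "p = q") (use src_src[of x p q] in \<open>auto simp: qcells_def\<close>)

lemma tgt_qcell: "x \<in> qcells C q \<Longrightarrow> q \<le> p \<Longrightarrow> tgt C p x = x"
  using tgt_src[of x p q] by (auto simp: qcells_def)

lemma qcells_mono: "p \<le> q \<Longrightarrow> qcells C p \<subseteq> qcells C q"
  using src_qcell by (auto simp: qcells_def)

lemma src_qcells: "x \<in> cells C \<Longrightarrow> src C q x \<in> qcells C q"
  using src_src[of x q q] src_closed by (simp add: qcells_def)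

lemma tgt_qcells: "x \<in> cells C \<Longrightarrow> tgt C q x \<in> qcells C q"
  using src_tgt[of x q q] tgt_closed by (simp add: qcells_def)

lemma composable_tgt: "composable C p x y \<Longrightarrow> p < q \<Longrightarrow> composable C p (tgt C q x) (tgt C q y)"
  by (simp add: composable_def tgt_closed tgt_tgt src_tgt)

lemma composable_src: "composable C p x y \<Longrightarrow> p < q \<Longrightarrow> composable C p (src C q x) (src C q y)"
  by (simp add: composable_def src_closed tgt_src src_src)

lemma lam_triple_rels:
  assumes "\<And>p x y. p < q \<Longrightarrow> x \<in> qcells C q \<Longrightarrow> y \<in> qcells C q \<Longrightarrow> composable C p x y \<Longrightarrow>
    T (cmp C p x y) x y"
  shows "triple_rels (qcells C q) (lam_rels C q) T"
  unfolding triple_rels_def lam_rels_def using assms cmp_qcells by blast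

lemma lam_rels_subset: "lam_rels C q \<subseteq> carrier (free_Abelian_group (qcells C q))"
  by (rule triple_rels_subset[OF lam_triple_rels[of _ "\<lambda>_ _ _. True"]]) simp

lemma lam_class_cmp:
  assumes "p < q" "x \<in> qcells C q" "y \<in> qcells C q" "composable C p x y"
  shows "lam_class C q (cmp C p x y) = lam_class C q x \<otimes>\<^bsub>grp (lam C) q\<^esub> lam_class C q y"
  unfolding lam_class_def grp_lam
  using assms by (intro pclass_triple lam_rels_subset cmp_qcells) (auto simp: lam_rels_def)

text \<open>The universal property of the presentation: \<open>lam_rels\<close> relates only
  compositions along dimensions below \<open>q\<close>, so \<open>add\<close> is all that
  well-definedness requires.\<close>

lemma lam_extend:
  assumes G: "comm_group G" and \<phi>: "\<And>x. x \<in> qcells C q \<Longrightarrow> \<phi> x \<in> carrier G"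
    and add: "\<And>p x y. p < q \<Longrightarrow> x \<in> qcells C q \<Longrightarrow> y \<in> qcells C q \<Longrightarrow> composable C p x y \<Longrightarrow>
      \<phi> (cmp C p x y) = \<phi> x \<otimes>\<^bsub>G\<^esub> \<phi> y"
  shows "pextend G \<phi> \<in> hom (grp (lam C) q) G"
    and "x \<in> qcells C q \<Longrightarrow> pextend G \<phi> (lam_class C q x) = \<phi> x"
  unfolding grp_lam lam_class_def
  by (rule pextend_hom[OF G _ lam_triple_rels] | use \<phi> add in blast)+

lemma lam_hom_eq:
  assumes "comm_group G" "f \<in> hom (grp (lam C) q) G" "g \<in> hom (grp (lam C) q) G"
    and "\<And>x. x \<in> qcells C q \<Longrightarrow> f (lam_class C q x) = g (lam_class C q x)"
    and "X \<in> carrier (grp (lam C) q)"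
  shows "f X = g X"
  using presented_hom_eq[OF lam_rels_subset assms(1), of f q g X] assms(2-)
  by (simp add: grp_lam lam_class_def)

lemma grp_lam_comm: "comm_group (grp (lam C) q)"
  by (rule comm_group_lam) (rule strict_omega_category_axioms)

text \<open>A \<open>p\<close>-cell composed with itself along \<open>p\<close> is itself, and since
  \<open>p < q\<close> the relations turn this into a class equal to its own double.\<close>

lemma lam_class_degenerate:
  assumes x: "x \<in> qcells C p" and "p < q"
  shows "lam_class C q x = \<one>\<^bsub>grp (lam C) q\<^esub>"
proof -
  interpret G: comm_group "grp (lam C) q" by (rule grp_lam_comm)
  have xq: "x \<in> qcells C q" using qcells_mono[of p q] assms by auto
  have c: "composable C p x x" "cmp C p x x = x"
    using src_qcell[OF x order_refl] tgt_qcell[OF x order_refl] left_unit[of x p] qcells_cells[OF x]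
    by (auto simp: composable_def)
  from lam_class_cmp[OF assms(2) xq xq c(1)] show ?thesis
    using lam_class_closed[OF xq] by (simp add: c(2))
qed

lemma bd_lam_hom: "bd (lam C) (Suc q) \<in> hom (grp (lam C) (Suc q)) (grp (lam C) q)"
  and bd_lam_class: "x \<in> qcells C (Suc q) \<Longrightarrow> bd (lam C) (Suc q) (lam_class C (Suc q) x) =
    lam_class C q (tgt C q x) \<otimes>\<^bsub>grp (lam C) q\<^esub> inv\<^bsub>grp (lam C) q\<^esub> lam_class C q (src C q x)"
proof -
  let ?L = "grp (lam C) q"
  interpret G: comm_group ?L by (rule grp_lam_comm)
  define \<phi> where "\<phi> = (\<lambda>x. lam_class C q (tgt C q x) \<otimes>\<^bsub>?L\<^esub> inv\<^bsub>?L\<^esub> lam_class C q (src C q x))"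
  have bd: "bd (lam C) (Suc q) = pextend ?L \<phi>"
    by (simp add: \<phi>_def lam_def Let_def)
  have cl: "lam_class C q (tgt C q x) \<in> carrier ?L" "lam_class C q (src C q x) \<in> carrier ?L"
    if "x \<in> qcells C (Suc q)" for x
    using that by (simp_all add: lam_class_closed tgt_qcells src_qcells qcells_cells)
  have add: "\<phi> (cmp C p x y) = \<phi> x \<otimes>\<^bsub>?L\<^esub> \<phi> y"
    if p: "p < Suc q" and x: "x \<in> qcells C (Suc q)" and y: "y \<in> qcells C (Suc q)"
      and c: "composable C p x y" for p x y
  \<comment> \<open>Along \<open>q\<close> the boundaries of the two factors telescope at their
    common \<open>q\<close>-cell. Along a lower dimension, source and target commute with the
    composition and the relations of degree \<open>q\<close> apply.\<close>
  proof (cases "p = q")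
    case True
    have "tgt C q x = src C q y" using c True by (simp add: composable_def)
    then show ?thesis
      using c True cl[OF x] cl[OF y]
      by (simp add: \<phi>_def src_cmp tgt_cmp diff_telescope[OF G.comm_group_axioms])
  next
    case False
    then have pq: "p < q" using p by simp
    show ?thesis
      using cl[OF x] cl[OF y] pq x y
      by (simp add: \<phi>_def src_cmp_high[OF c pq] tgt_cmp_high[OF c pq] composable_tgt[OF c]
          composable_src[OF c] lam_class_cmp[OF pq] tgt_qcells src_qcells qcells_cells G.inv_mult G.m_ac)
  qed
  show "bd (lam C) (Suc q) \<in> hom (grp (lam C) (Suc q)) ?L"
    unfolding bd using cl add by (intro lam_extend) (auto simp: \<phi>_def grp_lam_comm)
  assume x: "x \<in> qcells C (Suc q)"
  show "bd (lam C) (Suc q) (lam_class C (Suc q) x) =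
    lam_class C q (tgt C q x) \<otimes>\<^bsub>?L\<^esub> inv\<^bsub>?L\<^esub> lam_class C q (src C q x)"
    unfolding bd using cl add x by (subst lam_extend(2)) (auto simp: \<phi>_def grp_lam_comm)
qed

lemma aug_lam_hom: "aug (lam C) \<in> hom (grp (lam C) 0) integer_group"
  and aug_lam_class: "x \<in> qcells C 0 \<Longrightarrow> aug (lam C) (lam_class C 0 x) = 1"
proof -
  have aug: "aug (lam C) = pextend integer_group (\<lambda>_. 1)" by (simp add: lam_def Let_def)
  show "aug (lam C) \<in> hom (grp (lam C) 0) integer_group"
    unfolding aug by (intro lam_extend abelian_integer_group) auto
  assume "x \<in> qcells C 0"
  then show "aug (lam C) (lam_class C 0 x) = 1"
    unfolding aug by (intro lam_extend(2) abelian_integer_group) auto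
qed

lemma precomplex_lam: "precomplex (lam C)"
proof (rule precomplex.intro)
  show "comm_group (grp (lam C) n)" for n by (rule grp_lam_comm)
  show "bd (lam C) (Suc n) \<in> hom (grp (lam C) (Suc n)) (grp (lam C) n)" for n by (rule bd_lam_hom)
  show "aug (lam C) \<in> hom (grp (lam C) 0) integer_group" by (rule aug_lam_hom)
  show "submonoid (pos (lam C) n) (grp (lam C) n)" for n
    unfolding pos_lam by (intro submonoid_hull grp_lam_comm) (auto simp: lam_class_closed)
qed

text \<open>Source and target of a 1-cell both have augmentation one. Together with
  \<open>aug_lam_nonneg\<close> this supplies what \<open>join_retract\<close> asks for beyond
  \<open>precomplex\<close> and contractibility.\<close>

lemma aug_bd_lam:
  assumes "X \<in> carrier (grp (lam C) (Suc 0))"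
  shows "aug (lam C) (bd (lam C) (Suc 0) X) = 0"
proof (rule lam_hom_eq[OF abelian_integer_group _ _ _ assms])
  show "(\<lambda>X. aug (lam C) (bd (lam C) (Suc 0) X)) \<in> hom (grp (lam C) (Suc 0)) integer_group"
    by (rule hom_comp[OF bd_lam_hom aug_lam_hom])
  show "(\<lambda>_. 0) \<in> hom (grp (lam C) (Suc 0)) integer_group"
    using hom_one_fun[OF abelian_integer_group] by simp
  fix x assume x: "x \<in> qcells C (Suc 0)"
  interpret G: comm_group "grp (lam C) 0" by (rule grp_lam_comm)
  have "tgt C 0 x \<in> qcells C 0" "src C 0 x \<in> qcells C 0"
    using x by (auto simp: tgt_qcells src_qcells qcells_cells)
  then show "aug (lam C) (bd (lam C) (Suc 0) (lam_class C (Suc 0) x)) = 0"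
    using x by (simp add: bd_lam_class hom_mult[OF aug_lam_hom] lam_class_closed aug_lam_class
        hom_inv_eq[OF aug_lam_hom grp_lam_comm abelian_integer_group])
qed

lemma lam_hull_subset:
  assumes "comm_group G" "f \<in> hom (grp (lam C) q) G" "submonoid M G"
    and "\<And>x. x \<in> qcells C q \<Longrightarrow> f (lam_class C q x) \<in> M" and "X \<in> pos (lam C) q"
  shows "f X \<in> M"
proof -
  have "f ` pos (lam C) q \<subseteq> M"
    unfolding pos_lam
    by (rule hom_hull_subset[OF grp_lam_comm assms(1-3)]) (auto simp: assms(4) lam_class_closed)
  then show ?thesis using assms(5) by auto
qed

end

lemma adc_map_lam_map:
  assumes C: "strict_omega_category C" and D: "strict_omega_category D" and f: "strict_functor C D f"
  shows "adc_map (lam C) (lam D) (lam_map f D)"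
    and "x \<in> qcells C q \<Longrightarrow> lam_map f D q (lam_class C q x) = lam_class D q (f x)"
proof -
  interpret C: strict_omega_category C by fact
  interpret D: strict_omega_category D by fact
  have f_cells: "f x \<in> cells D" if "x \<in> cells C" for x using f that by (simp add: strict_functor_def)
  have f_q: "f x \<in> qcells D q" if "x \<in> qcells C q" for x q
    using f that by (auto simp: strict_functor_def qcells_def) metis
  have f_c: "composable D p (f x) (f y)" "f (cmp C p x y) = cmp D p (f x) (f y)"
    if "composable C p x y" for p x y
    using f that by (auto simp: strict_functor_def composable_def) metis
  have f_st: "f (src C p x) = src D p (f x)" "f (tgt C p x) = tgt D p (f x)" if "x \<in> cells C" for p x
    using f that by (auto simp: strict_functor_def)
  have hom: "lam_map f D q \<in> hom (grp (lam C) q) (grp (lam D) q)" for q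
    unfolding lam_map_def
    by (intro C.lam_extend D.grp_lam_comm) (auto simp: f_c f_q lam_class_closed D.lam_class_cmp)
  have val: "lam_map f D q (lam_class C q x) = lam_class D q (f x)" if "x \<in> qcells C q" for x q
    unfolding lam_map_def
    by (intro C.lam_extend(2) D.grp_lam_comm that) (auto simp: f_c f_q lam_class_closed D.lam_class_cmp)
  then show "x \<in> qcells C q \<Longrightarrow> lam_map f D q (lam_class C q x) = lam_class D q (f x)" .
  show "adc_map (lam C) (lam D) (lam_map f D)"
    unfolding adc_map_def
  proof (intro conjI allI ballI hom)
    fix n X assume X: "X \<in> carrier (grp (lam C) (Suc n))"
    show "lam_map f D n (bd (lam C) (Suc n) X) = bd (lam D) (Suc n) (lam_map f D (Suc n) X)"
    proof (rule C.lam_hom_eq[OF D.grp_lam_comm _ _ _ X])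
      show "(\<lambda>X. lam_map f D n (bd (lam C) (Suc n) X)) \<in> hom (grp (lam C) (Suc n)) (grp (lam D) n)"
        by (rule hom_comp[OF C.bd_lam_hom hom])
      show "(\<lambda>X. bd (lam D) (Suc n) (lam_map f D (Suc n) X)) \<in> hom (grp (lam C) (Suc n)) (grp (lam D) n)"
        by (rule hom_comp[OF hom D.bd_lam_hom])
      fix x assume x: "x \<in> qcells C (Suc n)"
      interpret G: comm_group "grp (lam C) n" by (rule C.grp_lam_comm)
      have "tgt C n x \<in> qcells C n" "src C n x \<in> qcells C n"
        using x by (auto simp: C.tgt_qcells C.src_qcells C.qcells_cells)
      then show "lam_map f D n (bd (lam C) (Suc n) (lam_class C (Suc n) x)) =
          bd (lam D) (Suc n) (lam_map f D (Suc n) (lam_class C (Suc n) x))"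
        using x by (simp add: C.bd_lam_class D.bd_lam_class val f_q hom_mult[OF hom] lam_class_closed
            hom_inv_eq[OF hom C.grp_lam_comm D.grp_lam_comm] f_st C.qcells_cells)
    qed
  next
    fix X assume X: "X \<in> carrier (grp (lam C) 0)"
    show "aug (lam D) (lam_map f D 0 X) = aug (lam C) X"
      by (rule C.lam_hom_eq[OF abelian_integer_group hom_comp[OF hom D.aug_lam_hom] C.aug_lam_hom _ X])
        (simp add: val f_q D.aug_lam_class C.aug_lam_class)
  next
    fix n show "lam_map f D n ` pos (lam C) n \<subseteq> pos (lam D) n"
      using C.lam_hull_subset[OF D.grp_lam_comm hom precomplex.pos_submonoid[OF D.precomplex_lam]]
      by (auto simp: val f_q lam_class_pos)
  qed
qed

lemma adc_retract_lam:
  assumes "omega_retract C D"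
  shows "adc_retract (lam C) (lam D)"
proof -
  obtain i r where C: "strict_omega_category C" and D: "strict_omega_category D"
    and i: "strict_functor C D i" and r: "strict_functor D C r"
    and ri: "\<And>x. x \<in> cells C \<Longrightarrow> r (i x) = x"
    using assms by (auto simp: omega_retract_def)
  interpret C: strict_omega_category C by fact
  interpret D: strict_omega_category D by fact
  note mi = adc_map_lam_map[OF C D i] and mr = adc_map_lam_map[OF D C r]
  have "lam_map r C n (lam_map i D n X) = X" if X: "X \<in> carrier (grp (lam C) n)" for n X
  proof (rule C.lam_hom_eq[OF C.grp_lam_comm hom_comp[OF adc_mapD(1)[OF mi(1)] adc_mapD(1)[OF mr(1)]] _ _ X])
    show "(\<lambda>X. X) \<in> hom (grp (lam C) n) (grp (lam C) n)" by (auto intro: homI)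
    fix x assume x: "x \<in> qcells C n"
    have "i x \<in> qcells D n"
      using i x by (auto simp: strict_functor_def qcells_def) metis
    then show "lam_map r C n (lam_map i D n (lam_class C n x)) = lam_class C n x"
      using x by (simp add: mi(2) mr(2) ri C.qcells_cells)
  qed
  then show ?thesis unfolding adc_retract_def using mi(1) mr(1) by blast
qed

section \<open>Tensor products\<close>

lemma grp_tensor: "grp (tensor A B) n = presented (tensor_gens A B n) (tensor_rels A B n)"
  by (simp add: tensor_def Let_def)

locale precomplex_pair = A: precomplex A + B: precomplex B
  for A :: "'a adc" and B :: "'b adc"
begin

lemma tensor_triple_rels:
  assumes "\<And>p a a' b. p \<le> n \<Longrightarrow> a \<in> carrier (grp A p) \<Longrightarrow> a' \<in> carrier (grp A p) \<Longrightarrow>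
      b \<in> carrier (grp B (n - p)) \<Longrightarrow> T (p, a \<otimes>\<^bsub>grp A p\<^esub> a', b) (p, a, b) (p, a', b)"
    and "\<And>p a b b'. p \<le> n \<Longrightarrow> a \<in> carrier (grp A p) \<Longrightarrow> b \<in> carrier (grp B (n - p)) \<Longrightarrow>
      b' \<in> carrier (grp B (n - p)) \<Longrightarrow> T (p, a, b \<otimes>\<^bsub>grp B (n - p)\<^esub> b') (p, a, b) (p, a, b')"
  shows "triple_rels (tensor_gens A B n) (tensor_rels A B n) T"
proof -
  have "\<exists>x \<in> tensor_gens A B n. \<exists>y \<in> tensor_gens A B n. \<exists>z \<in> tensor_gens A B n.
      T x y z \<and> r = frag_of x - frag_of y - frag_of z" if "r \<in> tensor_rels A B n" for r
    using that unfolding tensor_rels_def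
  proof (elim UnE CollectE exE conjE)
    fix p a a' b
    assume "r = frag_of (p, a \<otimes>\<^bsub>grp A p\<^esub> a', b) - frag_of (p, a, b) - frag_of (p, a', b)"
      "p \<le> n" "a \<in> carrier (grp A p)" "a' \<in> carrier (grp A p)" "b \<in> carrier (grp B (n - p))"
    then show ?thesis
      by (intro bexI[of _ "(p, a \<otimes>\<^bsub>grp A p\<^esub> a', b)"] bexI[of _ "(p, a, b)"] bexI[of _ "(p, a', b)"])
        (auto simp: assms tensor_gens_def)
  next
    fix p a b b'
    assume "r = frag_of (p, a, b \<otimes>\<^bsub>grp B (n - p)\<^esub> b') - frag_of (p, a, b) - frag_of (p, a, b')"
      "p \<le> n" "a \<in> carrier (grp A p)" "b \<in> carrier (grp B (n - p))" "b' \<in> carrier (grp B (n - p))"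
    then show ?thesis
      by (intro bexI[of _ "(p, a, b \<otimes>\<^bsub>grp B (n - p)\<^esub> b')"] bexI[of _ "(p, a, b)"] bexI[of _ "(p, a, b')"])
        (auto simp: assms tensor_gens_def)
  qed
  then show ?thesis by (simp add: triple_rels_def)
qed

lemma tensor_rels_subset: "tensor_rels A B n \<subseteq> carrier (free_Abelian_group (tensor_gens A B n))"
  by (rule triple_rels_subset[OF tensor_triple_rels[of _ "\<lambda>_ _ _. True"]]) simp_all

lemma grp_tensor_comm: "comm_group (grp (tensor A B) n)"
  unfolding grp_tensor by (rule comm_group_presented[OF tensor_rels_subset])

lemma tensor_class_closed:
  "p \<le> n \<Longrightarrow> a \<in> carrier (grp A p) \<Longrightarrow> b \<in> carrier (grp B (n - p)) \<Longrightarrow>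
    tensor_class A B n (p, a, b) \<in> carrier (grp (tensor A B) n)"
  unfolding grp_tensor tensor_class_def by (rule pclass_closed) (simp add: tensor_gens_def)

lemma tensor_class_hom_left:
  assumes "p \<le> n" "b \<in> carrier (grp B (n - p))"
  shows "(\<lambda>a. tensor_class A B n (p, a, b)) \<in> hom (grp A p) (grp (tensor A B) n)"
proof (rule homI)
  show "tensor_class A B n (p, a, b) \<in> carrier (grp (tensor A B) n)" if "a \<in> carrier (grp A p)" for a
    using assms that by (simp add: tensor_class_closed)
  fix a a' assume "a \<in> carrier (grp A p)" "a' \<in> carrier (grp A p)"
  then show "tensor_class A B n (p, a \<otimes>\<^bsub>grp A p\<^esub> a', b) =
      tensor_class A B n (p, a, b) \<otimes>\<^bsub>grp (tensor A B) n\<^esub> tensor_class A B n (p, a', b)"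
    unfolding grp_tensor tensor_class_def using assms
    by (intro pclass_triple tensor_rels_subset) (auto simp: tensor_gens_def tensor_rels_def)
qed

lemma tensor_class_hom_right:
  assumes "p \<le> n" "a \<in> carrier (grp A p)"
  shows "(\<lambda>b. tensor_class A B n (p, a, b)) \<in> hom (grp B (n - p)) (grp (tensor A B) n)"
proof (rule homI)
  show "tensor_class A B n (p, a, b) \<in> carrier (grp (tensor A B) n)" if "b \<in> carrier (grp B (n - p))" for b
    using assms that by (simp add: tensor_class_closed)
  fix b b' assume "b \<in> carrier (grp B (n - p))" "b' \<in> carrier (grp B (n - p))"
  then show "tensor_class A B n (p, a, b \<otimes>\<^bsub>grp B (n - p)\<^esub> b') =
      tensor_class A B n (p, a, b) \<otimes>\<^bsub>grp (tensor A B) n\<^esub> tensor_class A B n (p, a, b')"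
    unfolding grp_tensor tensor_class_def using assms
    by (intro pclass_triple tensor_rels_subset) (auto simp: tensor_gens_def tensor_rels_def)
qed

text \<open>The universal property of the tensor product: its relations express biadditivity in each
  bidegree and nothing else.\<close>

lemma tensor_extend:
  assumes G: "comm_group G"
    and left: "\<And>p b. p \<le> n \<Longrightarrow> b \<in> carrier (grp B (n - p)) \<Longrightarrow> (\<lambda>a. \<phi> (p, a, b)) \<in> hom (grp A p) G"
    and right: "\<And>p a. p \<le> n \<Longrightarrow> a \<in> carrier (grp A p) \<Longrightarrow> (\<lambda>b. \<phi> (p, a, b)) \<in> hom (grp B (n - p)) G"
  shows "pextend G \<phi> \<in> hom (grp (tensor A B) n) G"
    and "p \<le> n \<Longrightarrow> a \<in> carrier (grp A p) \<Longrightarrow> b \<in> carrier (grp B (n - p)) \<Longrightarrow>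
      pextend G \<phi> (tensor_class A B n (p, a, b)) = \<phi> (p, a, b)"
proof -
  have cl: "\<phi> \<in> tensor_gens A B n \<rightarrow> carrier G"
    using left hom_in_carrier by (fastforce simp: tensor_gens_def)
  have rels: "triple_rels (tensor_gens A B n) (tensor_rels A B n) (\<lambda>x y z. \<phi> x = \<phi> y \<otimes>\<^bsub>G\<^esub> \<phi> z)"
    by (rule tensor_triple_rels) (auto simp: hom_mult[OF left] hom_mult[OF right])
  show "pextend G \<phi> \<in> hom (grp (tensor A B) n) G"
    unfolding grp_tensor by (rule pextend_hom[OF G cl rels])
  show "p \<le> n \<Longrightarrow> a \<in> carrier (grp A p) \<Longrightarrow> b \<in> carrier (grp B (n - p)) \<Longrightarrow>
      pextend G \<phi> (tensor_class A B n (p, a, b)) = \<phi> (p, a, b)"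
    unfolding tensor_class_def by (rule pextend_hom(2)[OF G cl rels]) (simp add: tensor_gens_def)
qed

lemma tensor_hom_eq:
  assumes "comm_group G" "f \<in> hom (grp (tensor A B) n) G" "g \<in> hom (grp (tensor A B) n) G"
    and "\<And>p a b. p \<le> n \<Longrightarrow> a \<in> carrier (grp A p) \<Longrightarrow> b \<in> carrier (grp B (n - p)) \<Longrightarrow>
      f (tensor_class A B n (p, a, b)) = g (tensor_class A B n (p, a, b))"
    and "X \<in> carrier (grp (tensor A B) n)"
  shows "f X = g X"
  using presented_hom_eq[OF tensor_rels_subset assms(1), of f n g X] assms(2-)
  by (auto simp: grp_tensor tensor_class_def tensor_gens_def)

text \<open>The Leibniz formula, with sign \<open>(-1)^p\<close> on the second term. The two
  exceptional cases drop a term whose boundary would be taken in degree 0, where \<open>bd\<close>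
  carries no meaning.\<close>

definition tensor_bd_gen where
  "tensor_bd_gen n = (\<lambda>(p, a, b).
     (if p = 0 then \<one>\<^bsub>grp (tensor A B) n\<^esub> else tensor_class A B n (p - 1, bd A p a, b))
     \<otimes>\<^bsub>grp (tensor A B) n\<^esub>
     (if p = Suc n then \<one>\<^bsub>grp (tensor A B) n\<^esub>
      else tensor_class A B n (p, a, bd B (Suc n - p) b) [^]\<^bsub>grp (tensor A B) n\<^esub> ((- 1 :: int) ^ p)))"

lemma bd_tensor_hom: "bd (tensor A B) (Suc n) \<in> hom (grp (tensor A B) (Suc n)) (grp (tensor A B) n)"
  and bd_tensor_class: "p \<le> Suc n \<Longrightarrow> a \<in> carrier (grp A p) \<Longrightarrow> b \<in> carrier (grp B (Suc n - p)) \<Longrightarrow>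
    bd (tensor A B) (Suc n) (tensor_class A B (Suc n) (p, a, b)) = tensor_bd_gen n (p, a, b)"
proof -
  let ?T = "grp (tensor A B) n"
  note G = grp_tensor_comm[of n]
  have bd: "bd (tensor A B) (Suc n) = pextend ?T (tensor_bd_gen n)"
    by (simp add: tensor_def Let_def tensor_bd_gen_def cong: if_cong)
  have left: "(\<lambda>a. tensor_bd_gen n (p, a, b)) \<in> hom (grp A p) ?T"
    if "p \<le> Suc n" "b \<in> carrier (grp B (Suc n - p))" for p b
  proof -
    have 1: "(\<lambda>a. if p = 0 then \<one>\<^bsub>?T\<^esub> else tensor_class A B n (p - 1, bd A p a, b)) \<in> hom (grp A p) ?T"
    proof (cases p)
      case 0
      then show ?thesis using hom_one_fun[OF G] by simp
    next
      case (Suc k)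
      then show ?thesis
        using that hom_comp[OF A.bd_hom[of k] tensor_class_hom_left[of k n b]] by simp
    qed
    have 2: "(\<lambda>a. if p = Suc n then \<one>\<^bsub>?T\<^esub> else
        tensor_class A B n (p, a, bd B (Suc n - p) b) [^]\<^bsub>?T\<^esub> ((- 1 :: int) ^ p)) \<in> hom (grp A p) ?T"
    proof (cases "p = Suc n")
      case True
      then show ?thesis using hom_one_fun[OF G] by simp
    next
      case False
      then have "Suc n - p = Suc (n - p)" using that by simp
      then show ?thesis
        using that False hom_pow_fun[OF G tensor_class_hom_left[of p n "bd B (Suc n - p) b"]]
        by (simp add: B.bd_closed)
    qed
    show ?thesis unfolding tensor_bd_gen_def split by (rule hom_mult_fun[OF G 1 2])
  qed
  have right: "(\<lambda>b. tensor_bd_gen n (p, a, b)) \<in> hom (grp B (Suc n - p)) ?T"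
    if "p \<le> Suc n" "a \<in> carrier (grp A p)" for p a
  proof -
    have 1: "(\<lambda>b. if p = 0 then \<one>\<^bsub>?T\<^esub> else tensor_class A B n (p - 1, bd A p a, b)) \<in> hom (grp B (Suc n - p)) ?T"
    proof (cases p)
      case 0
      then show ?thesis using hom_one_fun[OF G] by simp
    next
      case (Suc k)
      then show ?thesis
        using that tensor_class_hom_right[of k n "bd A p a"] by (simp add: A.bd_closed)
    qed
    have 2: "(\<lambda>b. if p = Suc n then \<one>\<^bsub>?T\<^esub> else
        tensor_class A B n (p, a, bd B (Suc n - p) b) [^]\<^bsub>?T\<^esub> ((- 1 :: int) ^ p)) \<in> hom (grp B (Suc n - p)) ?T"
    proof (cases "p = Suc n")
      case True
      then show ?thesis using hom_one_fun[OF G] by simp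
    next
      case False
      then have "Suc n - p = Suc (n - p)" using that by simp
      then show ?thesis
        using that False hom_pow_fun[OF G hom_comp[OF B.bd_hom[of "n - p"] tensor_class_hom_right[of p n a]]]
        by simp
    qed
    show ?thesis unfolding tensor_bd_gen_def split by (rule hom_mult_fun[OF G 1 2])
  qed
  show "bd (tensor A B) (Suc n) \<in> hom (grp (tensor A B) (Suc n)) ?T"
    unfolding bd by (rule tensor_extend[OF G left right])
  show "p \<le> Suc n \<Longrightarrow> a \<in> carrier (grp A p) \<Longrightarrow> b \<in> carrier (grp B (Suc n - p)) \<Longrightarrow>
    bd (tensor A B) (Suc n) (tensor_class A B (Suc n) (p, a, b)) = tensor_bd_gen n (p, a, b)"
    unfolding bd by (rule tensor_extend(2)[OF G left right])
qed

lemma aug_tensor_hom: "aug (tensor A B) \<in> hom (grp (tensor A B) 0) integer_group"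
  and aug_tensor_class: "a \<in> carrier (grp A 0) \<Longrightarrow> b \<in> carrier (grp B 0) \<Longrightarrow>
    aug (tensor A B) (tensor_class A B 0 (0, a, b)) = aug A a * aug B b"
proof -
  let ?\<phi> = "\<lambda>(p :: nat, a, b). aug A a * aug B b"
  have aug: "aug (tensor A B) = pextend integer_group ?\<phi>"
    by (simp add: tensor_def Let_def)
  have left: "(\<lambda>a. ?\<phi> (p, a, b)) \<in> hom (grp A p) integer_group"
    if "p \<le> 0" "b \<in> carrier (grp B (0 - p))" for p b
    using that hom_mult[OF A.aug_hom] by (auto intro!: homI simp: algebra_simps)
  have right: "(\<lambda>b. ?\<phi> (p, a, b)) \<in> hom (grp B (0 - p)) integer_group"
    if "p \<le> 0" "a \<in> carrier (grp A p)" for p a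
    using that hom_mult[OF B.aug_hom] by (auto intro!: homI simp: algebra_simps)
  show "aug (tensor A B) \<in> hom (grp (tensor A B) 0) integer_group"
    unfolding aug by (rule tensor_extend[OF abelian_integer_group left right])
  show "a \<in> carrier (grp A 0) \<Longrightarrow> b \<in> carrier (grp B 0) \<Longrightarrow>
    aug (tensor A B) (tensor_class A B 0 (0, a, b)) = aug A a * aug B b"
    unfolding aug using tensor_extend(2)[OF abelian_integer_group left right, of 0 a b] by simp
qed

lemma pos_tensor: "pos (tensor A B) n = (\<lambda>H. submonoid H (grp (tensor A B) n)) hull
    {tensor_class A B n (p, a, b) | p a b. p \<le> n \<and> a \<in> pos A p \<and> b \<in> pos B (n - p)}"
  by (simp add: tensor_def Let_def)

lemma tensor_class_pos: "p \<le> n \<Longrightarrow> a \<in> pos A p \<Longrightarrow> b \<in> pos B (n - p) \<Longrightarrow>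
    tensor_class A B n (p, a, b) \<in> pos (tensor A B) n"
  unfolding pos_tensor by (rule mem_submonoid_hull) auto

lemma tensor_hull_subset:
  assumes "comm_group G" "f \<in> hom (grp (tensor A B) n) G" "submonoid M G"
    and "\<And>p a b. p \<le> n \<Longrightarrow> a \<in> pos A p \<Longrightarrow> b \<in> pos B (n - p) \<Longrightarrow> f (tensor_class A B n (p, a, b)) \<in> M"
    and "X \<in> pos (tensor A B) n"
  shows "f X \<in> M"
proof -
  have "f ` pos (tensor A B) n \<subseteq> M"
    unfolding pos_tensor
    by (rule hom_hull_subset[OF grp_tensor_comm assms(1-3)])
      (auto simp: assms(4) tensor_class_closed A.pos_closed B.pos_closed)
  then show ?thesis using assms(5) by auto
qed

lemma precomplex_tensor: "precomplex (tensor A B)"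
proof (rule precomplex.intro)
  show "comm_group (grp (tensor A B) n)" for n by (rule grp_tensor_comm)
  show "bd (tensor A B) (Suc n) \<in> hom (grp (tensor A B) (Suc n)) (grp (tensor A B) n)" for n
    by (rule bd_tensor_hom)
  show "aug (tensor A B) \<in> hom (grp (tensor A B) 0) integer_group" by (rule aug_tensor_hom)
  show "submonoid (pos (tensor A B) n) (grp (tensor A B) n)" for n
    unfolding pos_tensor
    by (intro submonoid_hull grp_tensor_comm) (auto simp: tensor_class_closed A.pos_closed B.pos_closed)
qed

end

lemma adc_map_tensor_map:
  fixes f :: "nat \<Rightarrow> 'a \<Rightarrow> 'c" and g :: "nat \<Rightarrow> 'b \<Rightarrow> 'd"
  assumes AB: "precomplex_pair A B" and CD: "precomplex_pair C D"
    and f: "adc_map A C f" and g: "adc_map B D g"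
  shows "adc_map (tensor A B) (tensor C D) (tensor_map f g C D)"
    and "p \<le> n \<Longrightarrow> a \<in> carrier (grp A p) \<Longrightarrow> b \<in> carrier (grp B (n - p)) \<Longrightarrow>
      tensor_map f g C D n (tensor_class A B n (p, a, b)) = tensor_class C D n (p, f p a, g (n - p) b)"
proof -
  interpret AB: precomplex_pair A B by fact
  interpret CD: precomplex_pair C D by fact
  note fh = adc_mapD(1)[OF f] and gh = adc_mapD(1)[OF g]
  let ?\<phi> = "\<lambda>n (p, a, b). tensor_class C D n (p, f p a, g (n - p) b)"
  have fc: "f p a \<in> carrier (grp C p)" if "a \<in> carrier (grp A p)" for p a
    using hom_in_carrier[OF fh that] .
  have gc: "g p a \<in> carrier (grp D p)" if "a \<in> carrier (grp B p)" for p a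
    using hom_in_carrier[OF gh that] .
  have left: "(\<lambda>a. ?\<phi> n (p, a, b)) \<in> hom (grp A p) (grp (tensor C D) n)"
    if "p \<le> n" "b \<in> carrier (grp B (n - p))" for n p b
    using hom_comp[OF fh CD.tensor_class_hom_left[OF that(1) gc[OF that(2)]]] by simp
  have right: "(\<lambda>b. ?\<phi> n (p, a, b)) \<in> hom (grp B (n - p)) (grp (tensor C D) n)"
    if "p \<le> n" "a \<in> carrier (grp A p)" for n p a
    using hom_comp[OF gh CD.tensor_class_hom_right[OF that(1) fc[OF that(2)]]] by simp
  have hom: "tensor_map f g C D n \<in> hom (grp (tensor A B) n) (grp (tensor C D) n)" for n
    unfolding tensor_map_def by (rule AB.tensor_extend[OF CD.grp_tensor_comm left right])
  have val: "tensor_map f g C D n (tensor_class A B n (p, a, b)) = tensor_class C D n (p, f p a, g (n - p) b)"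
    if "p \<le> n" "a \<in> carrier (grp A p)" "b \<in> carrier (grp B (n - p))" for n p a b
    unfolding tensor_map_def using AB.tensor_extend(2)[OF CD.grp_tensor_comm left right that] by simp
  then show "p \<le> n \<Longrightarrow> a \<in> carrier (grp A p) \<Longrightarrow> b \<in> carrier (grp B (n - p)) \<Longrightarrow>
      tensor_map f g C D n (tensor_class A B n (p, a, b)) = tensor_class C D n (p, f p a, g (n - p) b)" .
  show "adc_map (tensor A B) (tensor C D) (tensor_map f g C D)"
    unfolding adc_map_def
  proof (intro conjI allI ballI hom)
    fix n X assume X: "X \<in> carrier (grp (tensor A B) (Suc n))"
    show "tensor_map f g C D n (bd (tensor A B) (Suc n) X) = bd (tensor C D) (Suc n) (tensor_map f g C D (Suc n) X)"
    proof (rule AB.tensor_hom_eq[OF CD.grp_tensor_comm hom_comp[OF AB.bd_tensor_hom hom]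
            hom_comp[OF hom CD.bd_tensor_hom] _ X])
      fix p a b assume p: "p \<le> Suc n" and a: "a \<in> carrier (grp A p)" and b: "b \<in> carrier (grp B (Suc n - p))"
      interpret T: comm_group "grp (tensor A B) n" by (rule AB.grp_tensor_comm)
      interpret T': comm_group "grp (tensor C D) n" by (rule CD.grp_tensor_comm)
      \<comment> \<open>The two terms of the Leibniz formula are matched separately: the first
        because \<open>f\<close> commutes with boundaries, the second, in fact \<open>2\<close>,
        because \<open>g\<close> does.\<close>
      have 1: "tensor_map f g C D n (if p = 0 then \<one>\<^bsub>grp (tensor A B) n\<^esub> else tensor_class A B n (p - 1, bd A p a, b))
        = (if p = 0 then \<one>\<^bsub>grp (tensor C D) n\<^esub> else tensor_class C D n (p - 1, bd C p (f p a), g (Suc n - p) b))"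
        "(if p = 0 then \<one>\<^bsub>grp (tensor A B) n\<^esub> else tensor_class A B n (p - 1, bd A p a, b)) \<in> carrier (grp (tensor A B) n)"
        using p a b by (cases p; simp add: hom_one_eq[OF hom AB.grp_tensor_comm CD.grp_tensor_comm] val
            AB.A.bd_closed adc_mapD(2)[OF f] AB.tensor_class_closed)+
      have 2: "tensor_map f g C D n (if p = Suc n then \<one>\<^bsub>grp (tensor A B) n\<^esub> else
            tensor_class A B n (p, a, bd B (Suc n - p) b) [^]\<^bsub>grp (tensor A B) n\<^esub> ((- 1 :: int) ^ p))
        = (if p = Suc n then \<one>\<^bsub>grp (tensor C D) n\<^esub> else
            tensor_class C D n (p, f p a, bd D (Suc n - p) (g (Suc n - p) b)) [^]\<^bsub>grp (tensor C D) n\<^esub> ((- 1 :: int) ^ p))"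
        "(if p = Suc n then \<one>\<^bsub>grp (tensor A B) n\<^esub> else
            tensor_class A B n (p, a, bd B (Suc n - p) b) [^]\<^bsub>grp (tensor A B) n\<^esub> ((- 1 :: int) ^ p))
          \<in> carrier (grp (tensor A B) n)"
        using p a b
        by (cases "p = Suc n"; simp add: hom_one_eq[OF hom AB.grp_tensor_comm CD.grp_tensor_comm] val
            hom_pow_eq[OF hom AB.grp_tensor_comm CD.grp_tensor_comm] Suc_diff_le
            AB.B.bd_closed adc_mapD(2)[OF g] AB.tensor_class_closed)+
      show "tensor_map f g C D n (bd (tensor A B) (Suc n) (tensor_class A B (Suc n) (p, a, b))) =
         bd (tensor C D) (Suc n) (tensor_map f g C D (Suc n) (tensor_class A B (Suc n) (p, a, b)))"
        using p a b 1 2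
        by (simp only: val AB.bd_tensor_class CD.bd_tensor_class fc gc
            AB.tensor_bd_gen_def CD.tensor_bd_gen_def split hom_mult[OF hom])
    qed
  next
    fix X assume X: "X \<in> carrier (grp (tensor A B) 0)"
    show "aug (tensor C D) (tensor_map f g C D 0 X) = aug (tensor A B) X"
      by (rule AB.tensor_hom_eq[OF abelian_integer_group hom_comp[OF hom CD.aug_tensor_hom] AB.aug_tensor_hom _ X])
        (simp add: val AB.aug_tensor_class CD.aug_tensor_class fc gc adc_mapD(3)[OF f] adc_mapD(3)[OF g])
  next
    fix n
    interpret T: precomplex "tensor C D" by (rule CD.precomplex_tensor)
    show "tensor_map f g C D n ` pos (tensor A B) n \<subseteq> pos (tensor C D) n"
    proof (rule image_subsetI, erule AB.tensor_hull_subset[OF CD.grp_tensor_comm hom T.pos_submonoid, rotated])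
      fix p a b assume "p \<le> n" "a \<in> pos A p" "b \<in> pos B (n - p)"
      then show "tensor_map f g C D n (tensor_class A B n (p, a, b)) \<in> pos (tensor C D) n"
        by (simp add: val AB.A.pos_closed AB.B.pos_closed CD.tensor_class_pos adc_mapD(4)[OF f] adc_mapD(4)[OF g])
    qed
  qed
qed

lemma adc_map_id: "adc_map A A (\<lambda>_ a. a)"
  by (auto simp: adc_map_def intro: homI)

lemma adc_retract_tensor:
  assumes A: "precomplex A" and B: "precomplex B" and D: "precomplex D" and ret: "adc_retract B D"
  shows "adc_retract (tensor A B) (tensor A D)"
proof -
  interpret AB: precomplex_pair A B using A B by (simp add: precomplex_pair_def)
  interpret AD: precomplex_pair A D using A D by (simp add: precomplex_pair_def)
  obtain i r where i: "adc_map B D i" and r: "adc_map D B r"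
    and ri: "\<And>n x. x \<in> carrier (grp B n) \<Longrightarrow> r n (i n x) = x"
    using ret by (auto simp: adc_retract_def)
  note mi = adc_map_tensor_map[OF AB.precomplex_pair_axioms AD.precomplex_pair_axioms adc_map_id i]
  note mr = adc_map_tensor_map[OF AD.precomplex_pair_axioms AB.precomplex_pair_axioms adc_map_id r]
  have "tensor_map (\<lambda>_ a. a) r A B n (tensor_map (\<lambda>_ a. a) i A D n X) = X"
    if X: "X \<in> carrier (grp (tensor A B) n)" for n X
    by (rule AB.tensor_hom_eq[OF AB.grp_tensor_comm
          hom_comp[OF adc_mapD(1)[OF mi(1)] adc_mapD(1)[OF mr(1)]] _ _ X])
      (auto intro: homI simp: mi(2) mr(2) ri hom_in_carrier[OF adc_mapD(1)[OF i]])
  then show ?thesis unfolding adc_retract_def using mi(1) mr(1) by blast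
qed

section \<open>Contractions\<close>

text \<open>The last two conjuncts are the homotopy identity \<open>d h + h d = id - const\<close>,
  where the constant map is \<open>aug K x\<close> times \<open>b\<close> in degree 0 and zero
  above. They are separate because degree 0 has no summand \<open>h d\<close>.\<close>

definition contraction :: "'a adc \<Rightarrow> 'a \<Rightarrow> (nat \<Rightarrow> 'a \<Rightarrow> 'a) \<Rightarrow> bool"
  where "contraction K b h \<longleftrightarrow>
    b \<in> pos K 0 \<and> aug K b = 1 \<and>
    (\<forall>n. h n \<in> hom (grp K n) (grp K (Suc n))) \<and>
    (\<forall>n. h n ` pos K n \<subseteq> pos K (Suc n)) \<and>
    (\<forall>x \<in> carrier (grp K 0).
       bd K (Suc 0) (h 0 x) = x \<otimes>\<^bsub>grp K 0\<^esub> inv\<^bsub>grp K 0\<^esub> (b [^]\<^bsub>grp K 0\<^esub> aug K x)) \<and>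
    (\<forall>n. \<forall>x \<in> carrier (grp K (Suc n)).
       bd K (Suc (Suc n)) (h (Suc n) x) =
         x \<otimes>\<^bsub>grp K (Suc n)\<^esub> inv\<^bsub>grp K (Suc n)\<^esub> h n (bd K (Suc n) x))"

definition contractible :: "'a adc \<Rightarrow> bool"
  where "contractible K \<longleftrightarrow> (\<exists>b h. contraction K b h)"

text \<open>The homotopy is conjugated to \<open>r h i\<close> with base point \<open>r 0 b\<close>:
  both maps commute with boundaries, and \<open>r i = id\<close> restores the identity term.\<close>

lemma contractible_retract:
  assumes K: "precomplex K" and L: "precomplex L"
    and ret: "adc_retract K L" and con: "contractible L"
  shows "contractible K"
proof -
  interpret K: precomplex K by fact
  interpret L: precomplex L by fact
  obtain i r where i: "adc_map K L i" and r: "adc_map L K r"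
    and ri: "\<And>n x. x \<in> carrier (grp K n) \<Longrightarrow> r n (i n x) = x"
    using ret by (auto simp: adc_retract_def)
  obtain b h where bh: "contraction L b h" using con by (auto simp: contractible_def)
  then have b: "b \<in> pos L 0" "aug L b = 1" and hh: "\<And>n. h n \<in> hom (grp L n) (grp L (Suc n))"
    and hp: "\<And>n x. x \<in> pos L n \<Longrightarrow> h n x \<in> pos L (Suc n)"
    and h0: "\<And>x. x \<in> carrier (grp L 0) \<Longrightarrow>
       bd L (Suc 0) (h 0 x) = x \<otimes>\<^bsub>grp L 0\<^esub> inv\<^bsub>grp L 0\<^esub> (b [^]\<^bsub>grp L 0\<^esub> aug L x)"
    and hS: "\<And>n x. x \<in> carrier (grp L (Suc n)) \<Longrightarrow> bd L (Suc (Suc n)) (h (Suc n) x) =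
         x \<otimes>\<^bsub>grp L (Suc n)\<^esub> inv\<^bsub>grp L (Suc n)\<^esub> h n (bd L (Suc n) x)"
    by (auto simp: contraction_def image_subset_iff)
  note rh = adc_mapD(1)[OF r] and ih = adc_mapD(1)[OF i]
  have ic: "i n x \<in> carrier (grp L n)" if "x \<in> carrier (grp K n)" for n x
    using hom_in_carrier[OF ih that] .
  have hc: "h n x \<in> carrier (grp L (Suc n))" if "x \<in> carrier (grp L n)" for n x
    using hom_in_carrier[OF hh that] .
  have "contraction K (r 0 b) (\<lambda>n x. r (Suc n) (h n (i n x)))"
    unfolding contraction_def
  proof (intro conjI allI ballI)
    show "r 0 b \<in> pos K 0" "aug K (r 0 b) = 1"
      using b by (simp_all add: adc_mapD(3,4)[OF r] L.pos_closed)
    show "(\<lambda>x. r (Suc n) (h n (i n x))) \<in> hom (grp K n) (grp K (Suc n))" for n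
      by (rule hom_comp[OF hom_comp[OF ih hh] rh])
    show "(\<lambda>x. r (Suc n) (h n (i n x))) ` pos K n \<subseteq> pos K (Suc n)" for n
      by (auto intro!: adc_mapD(4)[OF r] adc_mapD(4)[OF i] hp)
    fix x assume "x \<in> carrier (grp K 0)"
    then show "bd K (Suc 0) (r (Suc 0) (h 0 (i 0 x))) =
        x \<otimes>\<^bsub>grp K 0\<^esub> inv\<^bsub>grp K 0\<^esub> (r 0 b [^]\<^bsub>grp K 0\<^esub> aug K x)"
      using b by (simp add: adc_mapD(2)[OF r, symmetric] ic hc h0 hom_mult[OF rh] ri adc_mapD(3)[OF i]
          hom_inv_eq[OF rh L.grp_comm K.grp_comm] hom_pow_eq[OF rh L.grp_comm K.grp_comm] L.pos_closed)
  next
    fix n x assume x: "x \<in> carrier (grp K (Suc n))"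
    then show "bd K (Suc (Suc n)) (r (Suc (Suc n)) (h (Suc n) (i (Suc n) x))) =
        x \<otimes>\<^bsub>grp K (Suc n)\<^esub> inv\<^bsub>grp K (Suc n)\<^esub> r (Suc n) (h n (i n (bd K (Suc n) x)))"
      by (simp add: adc_mapD(2)[OF r, symmetric] ic hc hS hom_mult[OF rh] ri L.bd_closed
          hom_inv_eq[OF rh L.grp_comm K.grp_comm] adc_mapD(2)[OF i])
  qed
  then show ?thesis by (auto simp: contractible_def)
qed

section \<open>Cones on the cells of \<open>nu K\<close>\<close>

lemma nu_apply:
  "src (nu K) p x n = (if n < p then x n else if n = p then (fst (x p), fst (x p))
     else (\<one>\<^bsub>grp K n\<^esub>, \<one>\<^bsub>grp K n\<^esub>))"
  "tgt (nu K) p x n = (if n < p then x n else if n = p then (snd (x p), snd (x p))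
     else (\<one>\<^bsub>grp K n\<^esub>, \<one>\<^bsub>grp K n\<^esub>))"
  "cmp (nu K) p x y n = (if n < p then x n else if n = p then (fst (x p), snd (y p))
     else (fst (x n) \<otimes>\<^bsub>grp K n\<^esub> fst (y n), snd (x n) \<otimes>\<^bsub>grp K n\<^esub> snd (y n)))"
  by (simp_all add: nu_def)

locale contracted_complex = precomplex K
  for K :: "'a adc" +
  fixes b :: 'a and h :: "nat \<Rightarrow> 'a \<Rightarrow> 'a"
  assumes contraction: "contraction K b h"
begin

lemma base: "b \<in> pos K 0" "aug K b = 1"
  using contraction by (auto simp: contraction_def)

lemma base_closed: "b \<in> carrier (grp K 0)"
  by (rule pos_closed[OF base(1)])

lemma h_hom: "h n \<in> hom (grp K n) (grp K (Suc n))"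
  using contraction by (auto simp: contraction_def)

lemma h_closed: "x \<in> carrier (grp K n) \<Longrightarrow> h n x \<in> carrier (grp K (Suc n))"
  using h_hom hom_in_carrier by fast

lemma h_pos: "x \<in> pos K n \<Longrightarrow> h n x \<in> pos K (Suc n)"
  using contraction by (auto simp: contraction_def image_subset_iff)

lemma h_one: "h n \<one>\<^bsub>grp K n\<^esub> = \<one>\<^bsub>grp K (Suc n)\<^esub>"
  by (rule hom_one_eq[OF h_hom grp_comm grp_comm])

lemma h_inv: "x \<in> carrier (grp K n) \<Longrightarrow> h n (inv\<^bsub>grp K n\<^esub> x) = inv\<^bsub>grp K (Suc n)\<^esub> h n x"
  by (rule hom_inv_eq[OF h_hom grp_comm grp_comm])

lemma bd_h_0: "x \<in> carrier (grp K 0) \<Longrightarrow>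
    bd K (Suc 0) (h 0 x) = x \<otimes>\<^bsub>grp K 0\<^esub> inv\<^bsub>grp K 0\<^esub> (b [^]\<^bsub>grp K 0\<^esub> aug K x)"
  using contraction by (simp add: contraction_def)

lemma bd_h_Suc: "x \<in> carrier (grp K (Suc n)) \<Longrightarrow> bd K (Suc (Suc n)) (h (Suc n) x) =
    x \<otimes>\<^bsub>grp K (Suc n)\<^esub> inv\<^bsub>grp K (Suc n)\<^esub> h n (bd K (Suc n) x)"
  using contraction by (simp add: contraction_def)

text \<open>
  The cone on a cell \<open>x\<close> runs from the cone on the target of \<open>x\<close> to \<open>x\<close> composed with the cone on
  the source of \<open>x\<close>.
\<close>

definition low :: "(nat \<Rightarrow> 'a \<times> 'a) \<Rightarrow> nat \<Rightarrow> 'a"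
  where "low x n = (case n of 0 \<Rightarrow> \<one>\<^bsub>grp K 0\<^esub> | Suc m \<Rightarrow> h m (fst (x m)))"

definition cone :: "(nat \<Rightarrow> 'a \<times> 'a) \<Rightarrow> nat \<Rightarrow> 'a \<times> 'a"
  where "cone x n = (case n of 0 \<Rightarrow> b | Suc m \<Rightarrow> h m (snd (x m)), snd (x n) \<otimes>\<^bsub>grp K n\<^esub> low x n)"

definition apex :: "nat \<Rightarrow> 'a \<times> 'a"
  where "apex n = (if n = 0 then (b, b) else (\<one>\<^bsub>grp K n\<^esub>, \<one>\<^bsub>grp K n\<^esub>))"

lemma low_simps [simp]: "low x 0 = \<one>\<^bsub>grp K 0\<^esub>" "low x (Suc m) = h m (fst (x m))"
  by (simp_all add: low_def)

lemma cone_simps [simp]: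
  "cone x 0 = (b, snd (x 0) \<otimes>\<^bsub>grp K 0\<^esub> \<one>\<^bsub>grp K 0\<^esub>)"
  "cone x (Suc m) = (h m (snd (x m)), snd (x (Suc m)) \<otimes>\<^bsub>grp K (Suc m)\<^esub> h m (fst (x m)))"
  by (simp_all add: cone_def)

text \<open>The homotopy identity gives
  \<open>d (h (snd (x n))) = snd (x n) - h (d (snd (x n)))\<close>, likewise for \<open>fst\<close>,
  and \<open>d\<close> of either component of \<open>x n\<close> is the difference of the components
  one degree lower. With this, both components of the cone have the boundary that the entry below
  demands. At the bottom, augmentation one makes the constant term exactly \<open>b\<close>.\<close>

lemma cone_cell:
  assumes x: "x \<in> nu_cells K"
  shows "cone x \<in> nu_cells K"
proof -
  note cl = nu_cells_closed[OF x] and bd = nu_cells_bd[OF x] and pos = nu_cells_pos[OF x]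
  have p: "fst (cone x n) \<in> pos K n" "snd (cone x n) \<in> pos K n" for n
    by (cases n; simp add: pos h_pos base)+
  have a: "aug K (fst (cone x 0)) = 1" "aug K (snd (cone x 0)) = 1"
    using x cl by (auto simp: nu_cells_def base)
  have b1: "bd K (Suc n) (fst (cone x (Suc n))) = snd (cone x n) \<otimes>\<^bsub>grp K n\<^esub> inv\<^bsub>grp K n\<^esub> fst (cone x n)" for n
  proof (cases n)
    case 0
    have "aug K (snd (x 0)) = 1" using x by (auto simp: nu_cells_def)
    then show ?thesis using 0 cl by (simp add: bd_h_0 base_closed)
  next
    case (Suc m)
    then show ?thesis
      using cl by (simp add: bd_h_Suc bd hom_mult[OF h_hom] h_inv h_closed G.inv_mult G.m_ac)
  qed
  have b2: "bd K (Suc n) (snd (cone x (Suc n))) = snd (cone x n) \<otimes>\<^bsub>grp K n\<^esub> inv\<^bsub>grp K n\<^esub> fst (cone x n)" for n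
  proof (cases n)
    case 0
    have "aug K (fst (x 0)) = 1" using x by (auto simp: nu_cells_def)
    then have "bd K (Suc n) (snd (cone x (Suc n))) = (fst (x 0) \<otimes>\<^bsub>grp K 0\<^esub> inv\<^bsub>grp K 0\<^esub> b)
        \<otimes>\<^bsub>grp K 0\<^esub> (snd (x 0) \<otimes>\<^bsub>grp K 0\<^esub> inv\<^bsub>grp K 0\<^esub> fst (x 0))"
      using 0 cl by (simp add: bd_mult bd h_closed bd_h_0 base_closed G.m_comm)
    then show ?thesis using 0 cl by (simp add: diff_telescope[OF grp_comm] base_closed)
  next
    case (Suc m)
    let ?G = "grp K (Suc m)"
    let ?w = "h m (fst (x m)) \<otimes>\<^bsub>?G\<^esub> inv\<^bsub>?G\<^esub> h m (snd (x m))"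
    have w: "?w \<in> carrier ?G" using cl by (simp add: h_closed)
    have "bd K (Suc n) (snd (cone x (Suc n))) = (snd (x (Suc m)) \<otimes>\<^bsub>?G\<^esub> inv\<^bsub>?G\<^esub> fst (x (Suc m)))
        \<otimes>\<^bsub>?G\<^esub> (fst (x (Suc m)) \<otimes>\<^bsub>?G\<^esub> ?w)"
      using Suc cl by (simp add: bd_mult bd h_closed bd_h_Suc hom_mult[OF h_hom] h_inv G.inv_mult G.m_comm)
    also have "\<dots> = snd (x (Suc m)) \<otimes>\<^bsub>?G\<^esub> ?w"
      using cl w by (intro diff_add_telescope grp_comm) auto
    finally show ?thesis using Suc cl by (simp add: h_closed G.m_assoc)
  qed
  obtain N where N: "\<forall>n\<ge>N. x n = (\<one>\<^bsub>grp K n\<^esub>, \<one>\<^bsub>grp K n\<^esub>)"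
    using x by (auto simp: nu_cells_def)
  \<comment> \<open>Entry \<open>n\<close> of the cone involves entry \<open>n - 1\<close> of
    \<open>x\<close>, so the cone becomes trivial one degree later than \<open>x\<close>.\<close>
  have "cone x n = (\<one>\<^bsub>grp K n\<^esub>, \<one>\<^bsub>grp K n\<^esub>)" if "n \<ge> Suc N" for n
    using that N by (cases n) (simp_all add: h_one)
  then show ?thesis
    unfolding nu_cells_def using p a b1 b2 by blast
qed

lemma apex_cell: "apex \<in> nu_cells K"
  by (auto simp: nu_cells_def apex_def base base_closed bd_one intro: exI[of _ "Suc 0"])

text \<open>
  Composing a \<open>q\<close>-cell \<open>x\<close> with the cones on its sources of dimension below \<open>q\<close> gives the target
  of the cone on \<open>x\<close> (\<open>tgt_cone\<close>).  In degree \<open>q\<close> of the linearization only the last of these cones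
  is nondegenerate.
\<close>

primrec whisker :: "nat \<Rightarrow> (nat \<Rightarrow> 'a \<times> 'a) \<Rightarrow> nat \<Rightarrow> 'a \<times> 'a" where
  "whisker 0 x = x"
| "whisker (Suc k) x = cmp (nu K) k (cone (src (nu K) k x)) (whisker k x)"

lemma cone_cong: "(\<And>m. m \<le> n \<Longrightarrow> x m = y m) \<Longrightarrow> cone x n = cone y n"
  by (cases n) auto

lemma cone_src_low: "n < k \<Longrightarrow> cone (src (nu K) k x) n = cone x n"
  by (intro cone_cong) (auto simp: nu_def)

lemma low_src: "low (src (nu K) k x) k = low x k"
  by (cases k) (auto simp: nu_def)

text \<open>Composing along \<open>k\<close> with the cone on the \<open>k\<close>-source completes
  entry \<open>k\<close> to that of \<open>cone x\<close>, adds \<open>h k (fst (x k))\<close>, that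
  is \<open>low x (Suc k)\<close>, in degree \<open>Suc k\<close>, and changes nothing above, where
  that cone is trivial.\<close>

lemma whisker:
  assumes x: "x \<in> nu_cells K"
  shows whisker_cell: "whisker k x \<in> nu_cells K"
    and whisker_eq: "whisker k x = (\<lambda>n. if n < k then cone x n
      else if n = k then (fst (x k) \<otimes>\<^bsub>grp K k\<^esub> low x k, snd (x k) \<otimes>\<^bsub>grp K k\<^esub> low x k) else x n)"
    and whisker_composable: "composable (nu K) k (cone (src (nu K) k x)) (whisker k x)"
proof -
  note cl = nu_cells_closed[OF x]
  let ?W = "\<lambda>k n. if n < k then cone x n
      else if n = k then (fst (x k) \<otimes>\<^bsub>grp K k\<^esub> low x k, snd (x k) \<otimes>\<^bsub>grp K k\<^esub> low x k) else x n"
  have comp: "composable (nu K) k (cone (src (nu K) k x)) (whisker k x)"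
    if "whisker k x \<in> nu_cells K" "whisker k x = ?W k" for k
  proof -
    have "snd (src (nu K) k x k) = fst (x k)" by (simp add: nu_def)
    then have "snd (cone (src (nu K) k x) k) = fst (x k) \<otimes>\<^bsub>grp K k\<^esub> low x k"
      by (simp add: cone_def low_src)
    then show ?thesis
      using that cone_cell[OF nu_src_closed[OF x]] by (simp add: nu_composable cone_src_low)
  qed
  \<comment> \<open>Both claims go through one induction: the formula at \<open>k\<close> yields the
    composability that makes \<open>whisker (Suc k) x\<close> a cell.\<close>
  have *: "whisker k x \<in> nu_cells K \<and> whisker k x = ?W k" for k
  proof (induction k)
    case 0
    then show ?case using x cl by (auto simp: fun_eq_iff prod_eq_iff)
  next
    case (Suc k)
    note c = comp[OF conjunct1[OF Suc] conjunct2[OF Suc]]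
    have "whisker (Suc k) x = ?W (Suc k)"
    proof
      fix n
      consider "n < k" | "n = k" | "n = Suc k" | "Suc k < n" by linarith
      then show "whisker (Suc k) x n = ?W (Suc k) n"
      proof cases
        case 1
        then show ?thesis by (simp add: cone_src_low nu_def[of K]) (simp add: cone_src_low[unfolded nu_def, simplified])
      next
        case 2
        have "fst (cone (src (nu K) k x) k) = fst (cone x k)"
          by (cases k) (simp_all add: nu_apply)
        then show ?thesis using 2 conjunct2[OF Suc] by (simp add: nu_apply prod_eq_iff) (simp add: cone_def)
      next
        case 3
        then show ?thesis using conjunct2[OF Suc] cl by (simp add: nu_def G.m_comm h_closed)
      next
        case 4
        then obtain m where m: "n = Suc m" "k < m" by (cases n) auto
        then show ?thesis using conjunct2[OF Suc] cl by (simp add: nu_def h_one)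
      qed
    qed
    then show ?case using nu_cmp_closed[OF c] by simp
  qed
  show "whisker k x \<in> nu_cells K" "whisker k x = ?W k" using * by blast+
  then show "composable (nu K) k (cone (src (nu K) k x)) (whisker k x)" by (rule comp)
qed

lemma nu_qcells: "x \<in> qcells (nu K) q \<longleftrightarrow>
    x \<in> nu_cells K \<and> fst (x q) = snd (x q) \<and> (\<forall>n>q. x n = (\<one>\<^bsub>grp K n\<^esub>, \<one>\<^bsub>grp K n\<^esub>))"
proof -
  have "src (nu K) q x = x \<longleftrightarrow> fst (x q) = snd (x q) \<and> (\<forall>n>q. x n = (\<one>\<^bsub>grp K n\<^esub>, \<one>\<^bsub>grp K n\<^esub>))"
  proof
    assume e: "src (nu K) q x = x"
    have "x n = (\<one>\<^bsub>grp K n\<^esub>, \<one>\<^bsub>grp K n\<^esub>)" if "n > q" for n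
      using fun_cong[OF e, of n] that by (simp add: nu_def)
    then show "fst (x q) = snd (x q) \<and> (\<forall>n>q. x n = (\<one>\<^bsub>grp K n\<^esub>, \<one>\<^bsub>grp K n\<^esub>))"
      using fun_cong[OF e, of q] by (simp add: nu_def prod_eq_iff)
  qed (auto simp: nu_def fun_eq_iff prod_eq_iff)
  then show ?thesis by (simp add: qcells_def) (simp add: nu_def)
qed

text \<open>In degree \<open>Suc q\<close> the cone consists of \<open>h\<close> applied to the two
  components of \<open>x\<close> in degree \<open>q\<close>, which coincide for a
  \<open>q\<close>-cell.\<close>

lemma cone_qcell:
  assumes "x \<in> qcells (nu K) q"
  shows "cone x \<in> qcells (nu K) (Suc q)"
proof -
  have x: "x \<in> nu_cells K" "fst (x q) = snd (x q)" "\<forall>n>q. x n = (\<one>\<^bsub>grp K n\<^esub>, \<one>\<^bsub>grp K n\<^esub>)"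
    using assms by (auto simp: nu_qcells)
  have "cone x n = (\<one>\<^bsub>grp K n\<^esub>, \<one>\<^bsub>grp K n\<^esub>)" if "n > Suc q" for n
    using x that by (cases n) (auto simp: h_one)
  then show ?thesis
    using x cone_cell[OF x(1)] nu_cells_closed[OF x(1)] by (simp add: nu_qcells h_closed)
qed

lemma tgt_cone:
  assumes "x \<in> qcells (nu K) q"
  shows "tgt (nu K) q (cone x) = whisker q x"
proof -
  have x: "x \<in> nu_cells K" "fst (x q) = snd (x q)" "\<forall>n>q. x n = (\<one>\<^bsub>grp K n\<^esub>, \<one>\<^bsub>grp K n\<^esub>)"
    using assms by (auto simp: nu_qcells)
  then show ?thesis
    by (auto simp: fun_eq_iff nu_apply whisker_eq[OF x(1)] cone_def)
qed

lemma src_cone_Suc: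
  assumes "x \<in> qcells (nu K) (Suc m)"
  shows "src (nu K) (Suc m) (cone x) = cone (tgt (nu K) m x)"
proof
  fix n
  have x: "x \<in> nu_cells K" using assms by (simp add: nu_qcells)
  show "src (nu K) (Suc m) (cone x) n = cone (tgt (nu K) m x) n"
    using nu_cells_closed[OF x]
    by (cases n; cases "n = m"; cases "n = Suc m") (auto simp: nu_apply h_one h_closed)
qed

lemma src_cone_0: "src (nu K) 0 (cone x) = apex"
  by (auto simp: nu_def apex_def fun_eq_iff)

text \<open>For 1-cells and \<open>p = 0\<close> this pastes two triangles with a common apex:
  \<open>cone y\<close> followed by \<open>cone x\<close> extended by \<open>y\<close>. In general
  \<open>cone x\<close> is extended by \<open>y'\<close>, the (\<open>Suc p\<close>)-target of
  \<open>y\<close> with the cones on its sources below \<open>p\<close> attached. Being of dimension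
  \<open>Suc p\<close>, \<open>y'\<close> has trivial class in all higher degrees of the
  linearization, which is what makes cones additive there.\<close>

lemma cone_cmp:
  assumes c: "composable (nu K) p x y"
  defines "y' \<equiv> tgt (nu K) (Suc p) (whisker p y)"
  shows "composable (nu K) p (cone x) y'"
    and "composable (nu K) (Suc p) (cone y) (cmp (nu K) p (cone x) y')"
    and "cone (cmp (nu K) p x y) = cmp (nu K) (Suc p) (cone y) (cmp (nu K) p (cone x) y')"
proof -
  have x: "x \<in> nu_cells K" and y: "y \<in> nu_cells K" and low: "\<And>n. n < p \<Longrightarrow> x n = y n"
    and eq: "snd (x p) = fst (y p)"
    using c by (auto simp: nu_composable)
  note cl = nu_cells_closed[OF x] nu_cells_closed[OF y]
  have cone_low: "cone x n = cone y n" if "n < p" for n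
    using that by (intro cone_cong low) auto
  have low_p: "low x p = low y p" by (cases p) (auto simp: low)
  have cone_p: "fst (cone x p) = fst (cone y p)" by (cases p) (auto simp: low)
  have y'_low: "y' n = cone y n" if "n < p" for n
    using that by (simp add: y'_def whisker_eq[OF y]) (simp add: nu_def)
  have y'_p: "y' p = (fst (y p) \<otimes>\<^bsub>grp K p\<^esub> low y p, snd (y p) \<otimes>\<^bsub>grp K p\<^esub> low y p)"
    by (simp add: y'_def whisker_eq[OF y]) (simp add: nu_def)
  have y'_Suc: "y' (Suc p) = (snd (y (Suc p)), snd (y (Suc p)))"
    by (simp add: y'_def whisker_eq[OF y]) (simp add: nu_def)
  have y'_high: "y' n = (\<one>\<^bsub>grp K n\<^esub>, \<one>\<^bsub>grp K n\<^esub>)" if "Suc p < n" for n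
    using that by (simp add: y'_def) (simp add: nu_def)
  have y': "y' \<in> nu_cells K"
    unfolding y'_def by (intro nu_tgt_closed whisker_cell y)
  show c1: "composable (nu K) p (cone x) y'"
    using cone_cell[OF x] y' by (simp add: nu_composable y'_low cone_low y'_p) (simp add: cone_def eq low_p)
  \<comment> \<open>\<open>?z\<close> agrees with \<open>cone y\<close> up to degree
    \<open>p\<close>, as \<open>z_low\<close> and \<open>z_p\<close> show; the summands of
    \<open>x\<close> and \<open>y\<close> meet only from degree \<open>Suc p\<close> on.\<close>
  let ?z = "cmp (nu K) p (cone x) y'"
  have z_low: "?z n = cone y n" if "n < p" for n
    using that cone_low by (simp add: nu_def)
  have z_p: "?z p = cone y p"
    using cone_p y'_p by (simp add: prod_eq_iff) (simp add: nu_def cone_def)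
  have z_high: "?z n = (fst (cone x n) \<otimes>\<^bsub>grp K n\<^esub> fst (y' n), snd (cone x n) \<otimes>\<^bsub>grp K n\<^esub> snd (y' n))"
    if "p < n" for n using that by (simp add: nu_def)
  show "composable (nu K) (Suc p) (cone y) ?z"
    using cone_cell[OF y] nu_cmp_closed[OF c1] cl
    by (auto simp: nu_composable z_low z_p z_high y'_Suc less_Suc_eq eq h_closed G.m_comm)
  show "cone (cmp (nu K) p x y) = cmp (nu K) (Suc p) (cone y) ?z"
  proof
    fix n
    have xy_low: "cmp (nu K) p x y n = y n" if "n < p" for n
      using that low by (simp add: nu_def)
    have xy_p: "cmp (nu K) p x y p = (fst (x p), snd (y p))" by (simp add: nu_def)
    have xy_high: "cmp (nu K) p x y n = (fst (x n) \<otimes>\<^bsub>grp K n\<^esub> fst (y n), snd (x n) \<otimes>\<^bsub>grp K n\<^esub> snd (y n))"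
      if "p < n" for n using that by (simp add: nu_def)
    have r_low: "cmp (nu K) (Suc p) (cone y) ?z n = cone y n" if "n < Suc p"
      using that by (simp add: nu_def[of K])
    have r_Suc: "cmp (nu K) (Suc p) (cone y) ?z (Suc p) = (fst (cone y (Suc p)), snd (?z (Suc p)))"
      unfolding nu_def[of K] by simp
    have r_high: "cmp (nu K) (Suc p) (cone y) ?z n =
        (fst (cone y n) \<otimes>\<^bsub>grp K n\<^esub> fst (?z n), snd (cone y n) \<otimes>\<^bsub>grp K n\<^esub> snd (?z n))" if "Suc p < n"
      using that unfolding nu_def[of K] by simp
    consider "n < p" | "n = p" | "n = Suc p" | "Suc p < n" by linarith
    then show "cone (cmp (nu K) p x y) n = cmp (nu K) (Suc p) (cone y) ?z n"
    proof cases
      case 1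
      then show ?thesis using r_low by (simp add: cone_cong[of n "cmp (nu K) p x y" y] xy_low)
    next
      case 2
      then show ?thesis using r_low xy_p xy_low by (cases p) simp_all
    next
      case 3
      have "cone (cmp (nu K) p x y) n = (h p (snd (y p)),
          snd (x (Suc p)) \<otimes>\<^bsub>grp K (Suc p)\<^esub> snd (y (Suc p)) \<otimes>\<^bsub>grp K (Suc p)\<^esub> h p (fst (x p)))"
        using 3 xy_p xy_high by simp
      then show ?thesis
        using 3 cl by (simp add: r_Suc z_high y'_Suc h_closed G.m_ac)
    next
      case 4
      then obtain m where m: "n = Suc m" "p < m" by (cases n) auto
      then show ?thesis
        using r_high[OF 4] cl by (simp add: z_high y'_high xy_high hom_mult[OF h_hom] h_closed G.m_ac)
    qed
  qed
qed

text \<open>The homotopy sends the class of \<open>x\<close> to that of \<open>cone x\<close>. In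
  positive degrees its boundary is the class of the whiskered \<open>x\<close> minus that of the
  cone on the target of \<open>x\<close>; the former is the class of \<open>x\<close> plus that of
  the cone on its source, and this is the homotopy identity. In degree 0 the source of the cone is
  \<open>apex\<close>.\<close>

lemma contractible_lam_nu: "contractible (lam (nu K))"
proof -
  let ?C = "nu K"
  let ?G = "grp (lam ?C)"
  interpret C: strict_omega_category ?C by (rule strict_omega_category_nu)
  interpret L: precomplex "lam ?C" by (rule C.precomplex_lam)
  define k where "k = (\<lambda>q. pextend (?G (Suc q)) (\<lambda>x. lam_class ?C (Suc q) (cone x)))"
  have cells: "x \<in> nu_cells K" if "x \<in> qcells ?C q" for x q using that by (simp add: nu_qcells)
  have cl: "lam_class ?C (Suc q) (cone x) \<in> carrier (?G (Suc q))" if "x \<in> qcells ?C q" for q x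
    by (rule lam_class_closed[OF cone_qcell[OF that]])
  have add: "lam_class ?C (Suc q) (cone (cmp ?C p x y)) =
      lam_class ?C (Suc q) (cone x) \<otimes>\<^bsub>?G (Suc q)\<^esub> lam_class ?C (Suc q) (cone y)"
    if p: "p < q" and x: "x \<in> qcells ?C q" and y: "y \<in> qcells ?C q" and c: "composable ?C p x y" for p q x y
  proof -
    let ?y' = "tgt ?C (Suc p) (whisker p y)"
    note cc = cone_cmp[OF c]
    have "whisker p y \<in> cells ?C" using whisker_cell[OF cells[OF y]] by (simp add: nu_def)
    then have y'p: "?y' \<in> qcells ?C (Suc p)" by (rule C.tgt_qcells)
    then have y': "?y' \<in> qcells ?C (Suc q)" using C.qcells_mono[of "Suc p" "Suc q"] p by auto
    have z: "cmp ?C p (cone x) ?y' \<in> qcells ?C (Suc q)"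
      using p by (intro C.cmp_qcells cone_qcell x y' cc(1)) simp
    have "lam_class ?C (Suc q) (cone (cmp ?C p x y)) = lam_class ?C (Suc q) (cone y)
        \<otimes>\<^bsub>?G (Suc q)\<^esub> (lam_class ?C (Suc q) (cone x) \<otimes>\<^bsub>?G (Suc q)\<^esub> lam_class ?C (Suc q) ?y')"
      using p C.lam_class_cmp[OF _ cone_qcell[OF y] z cc(2)] C.lam_class_cmp[OF _ cone_qcell[OF x] y' cc(1)]
      by (simp add: cc(3))
    \<comment> \<open>\<open>?y'\<close> has dimension \<open>Suc p\<close>, strictly below the
      degree \<open>Suc q\<close>.\<close>
    also have "lam_class ?C (Suc q) ?y' = \<one>\<^bsub>?G (Suc q)\<^esub>"
      using p by (intro C.lam_class_degenerate[OF y'p]) simp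
    finally show ?thesis using cl[OF x] cl[OF y] by (simp add: L.G.m_comm)
  qed
  have k_hom: "k q \<in> hom (?G q) (?G (Suc q))" for q
    unfolding k_def by (rule C.lam_extend[OF L.grp_comm cl add])
  have k_class: "k q (lam_class ?C q x) = lam_class ?C (Suc q) (cone x)" if "x \<in> qcells ?C q" for q x
    unfolding k_def by (rule C.lam_extend(2)[OF L.grp_comm cl add that])
  have whisker_class: "whisker k x \<in> qcells ?C q \<and> lam_class ?C q (whisker k x) =
      (if k = q \<and> k > 0 then lam_class ?C q (cone (src ?C (k - 1) x)) \<otimes>\<^bsub>?G q\<^esub> lam_class ?C q x
       else lam_class ?C q x)" if x: "x \<in> qcells ?C q" and "k \<le> q" for k q x
    using \<open>k \<le> q\<close>
  proof (induction k)
    case 0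
    then show ?case using x by simp
  next
    case (Suc k)
    have kq: "k < q" using Suc by simp
    have IH: "whisker k x \<in> qcells ?C q" "lam_class ?C q (whisker k x) = lam_class ?C q x"
      using Suc by auto
    have "src ?C k x \<in> qcells ?C k" using x by (intro C.src_qcells C.qcells_cells)
    then have s: "cone (src ?C k x) \<in> qcells ?C (Suc k)" by (rule cone_qcell)
    then have sq: "cone (src ?C k x) \<in> qcells ?C q" using C.qcells_mono[of "Suc k" q] kq by auto
    note c = whisker_composable[OF cells[OF x], of k]
    have "lam_class ?C q (whisker (Suc k) x) =
        lam_class ?C q (cone (src ?C k x)) \<otimes>\<^bsub>?G q\<^esub> lam_class ?C q x"
      using C.lam_class_cmp[OF kq sq IH(1) c] IH(2) by simp
    moreover have "lam_class ?C q (cone (src ?C k x)) = \<one>\<^bsub>?G q\<^esub>" if "Suc k < q"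
      by (rule C.lam_class_degenerate[OF s that])
    ultimately show ?case
      using C.cmp_qcells[OF kq sq IH(1) c] lam_class_closed[OF x] Suc.prems by auto
  qed
  have apex: "apex \<in> qcells ?C 0"
    using apex_cell by (simp add: nu_qcells apex_def)
  have "contraction (lam ?C) (lam_class ?C 0 apex) k"
    unfolding contraction_def
  proof (intro conjI allI ballI k_hom)
    show "lam_class ?C 0 apex \<in> pos (lam ?C) 0" by (rule lam_class_pos[OF apex])
    show "aug (lam ?C) (lam_class ?C 0 apex) = 1" by (rule C.aug_lam_class[OF apex])
    show "k n ` pos (lam ?C) n \<subseteq> pos (lam ?C) (Suc n)" for n
      using C.lam_hull_subset[OF L.grp_comm k_hom L.pos_submonoid]
      by (auto simp: k_class cone_qcell lam_class_pos)
  next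
    fix X assume X: "X \<in> carrier (?G 0)"
    show "bd (lam ?C) (Suc 0) (k 0 X) = X \<otimes>\<^bsub>?G 0\<^esub>
        inv\<^bsub>?G 0\<^esub> (lam_class ?C 0 apex [^]\<^bsub>?G 0\<^esub> aug (lam ?C) X)"
    proof (rule C.lam_hom_eq[OF L.grp_comm hom_comp[OF k_hom L.bd_hom] _ _ X])
      show "(\<lambda>X. X \<otimes>\<^bsub>?G 0\<^esub> inv\<^bsub>?G 0\<^esub>
          (lam_class ?C 0 apex [^]\<^bsub>?G 0\<^esub> aug (lam ?C) X)) \<in> hom (?G 0) (?G 0)"
        by (intro hom_mult_fun hom_inv_fun hom_pow_exponent L.aug_hom L.grp_comm L.G.is_group
            lam_class_closed[OF apex]) (auto intro: homI)
      fix x assume x: "x \<in> qcells ?C 0"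
      show "bd (lam ?C) (Suc 0) (k 0 (lam_class ?C 0 x)) = lam_class ?C 0 x \<otimes>\<^bsub>?G 0\<^esub>
        inv\<^bsub>?G 0\<^esub> (lam_class ?C 0 apex [^]\<^bsub>?G 0\<^esub> aug (lam ?C) (lam_class ?C 0 x))"
        using x lam_class_closed[OF apex]
        by (simp add: k_class C.bd_lam_class cone_qcell tgt_cone src_cone_0 C.aug_lam_class)
    qed
  next
    fix n X assume X: "X \<in> carrier (?G (Suc n))"
    show "bd (lam ?C) (Suc (Suc n)) (k (Suc n) X) = X \<otimes>\<^bsub>?G (Suc n)\<^esub>
        inv\<^bsub>?G (Suc n)\<^esub> k n (bd (lam ?C) (Suc n) X)"
    proof (rule C.lam_hom_eq[OF L.grp_comm hom_comp[OF k_hom L.bd_hom] _ _ X])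
      show "(\<lambda>X. X \<otimes>\<^bsub>?G (Suc n)\<^esub> inv\<^bsub>?G (Suc n)\<^esub> k n (bd (lam ?C) (Suc n) X))
          \<in> hom (?G (Suc n)) (?G (Suc n))"
        by (intro hom_mult_fun hom_inv_fun L.grp_comm L.G.is_group hom_comp[OF L.bd_hom k_hom])
          (auto intro: homI)
      fix x assume x: "x \<in> qcells ?C (Suc n)"
      have st: "src ?C n x \<in> qcells ?C n" "tgt ?C n x \<in> qcells ?C n"
        using x by (auto intro: C.src_qcells C.tgt_qcells C.qcells_cells)
      have "bd (lam ?C) (Suc (Suc n)) (k (Suc n) (lam_class ?C (Suc n) x)) =
          (lam_class ?C (Suc n) (cone (src ?C n x)) \<otimes>\<^bsub>?G (Suc n)\<^esub> lam_class ?C (Suc n) x)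
          \<otimes>\<^bsub>?G (Suc n)\<^esub> inv\<^bsub>?G (Suc n)\<^esub> lam_class ?C (Suc n) (cone (tgt ?C n x))"
        using x whisker_class[OF x order_refl]
        by (simp add: k_class C.bd_lam_class cone_qcell tgt_cone src_cone_Suc)
      also have "\<dots> = lam_class ?C (Suc n) x \<otimes>\<^bsub>?G (Suc n)\<^esub>
        inv\<^bsub>?G (Suc n)\<^esub> k n (bd (lam ?C) (Suc n) (lam_class ?C (Suc n) x))"
        using x st cl[OF st(1)] cl[OF st(2)] lam_class_closed[OF x]
        by (simp add: C.bd_lam_class hom_mult[OF k_hom] hom_inv_eq[OF k_hom L.grp_comm L.grp_comm]
            lam_class_closed k_class L.G.inv_mult L.G.m_ac)
      finally show "bd (lam ?C) (Suc (Suc n)) (k (Suc n) (lam_class ?C (Suc n) x)) =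
        lam_class ?C (Suc n) x \<otimes>\<^bsub>?G (Suc n)\<^esub>
        inv\<^bsub>?G (Suc n)\<^esub> k n (bd (lam ?C) (Suc n) (lam_class ?C (Suc n) x))" .
    qed
  qed
  then show ?thesis by (auto simp: contractible_def)
qed

end

lemma contractible_lam_nu:
  assumes "precomplex K" "contractible K"
  shows "contractible (lam (nu K))"
proof -
  obtain b h where "contraction K b h" using assms(2) by (auto simp: contractible_def)
  then interpret contracted_complex K b h
    using assms(1) by (simp add: contracted_complex_def contracted_complex_axioms_def)
  show ?thesis by (rule contractible_lam_nu)
qed

section \<open>Cylinders\<close>

locale lam_tensor = C: strict_omega_category C + B: precomplex B
  for C :: "'c omega_cat" and B :: "'b adc"
begin

sublocale precomplex_pair "lam C" B
  by (intro precomplex_pair.intro C.precomplex_lam B.precomplex_axioms)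

text \<open>Degenerate cells have trivial class, where any two homomorphisms agree, so each cell
  needs testing only in its own dimension. For \<open>arrow\<close> this leaves two objects and one
  edge, for \<open>point\<close> a single object.\<close>

lemma hom_eq:
  assumes G: "comm_group G" and f: "f \<in> hom (grp (tensor (lam C) B) n) G"
    and g: "g \<in> hom (grp (tensor (lam C) B) n) G"
    and eq: "\<And>p x b. p \<le> n \<Longrightarrow> x \<in> qcells C p \<Longrightarrow> (\<And>q. q < p \<Longrightarrow> x \<notin> qcells C q) \<Longrightarrow> b \<in> carrier (grp B (n - p)) \<Longrightarrow>
      f (tensor_class (lam C) B n (p, lam_class C p x, b)) = g (tensor_class (lam C) B n (p, lam_class C p x, b))"
    and X: "X \<in> carrier (grp (tensor (lam C) B) n)"
  shows "f X = g X"
proof (rule tensor_hom_eq[OF G f g _ X])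
  fix p a b assume p: "p \<le> n" and a: "a \<in> carrier (grp (lam C) p)" and b: "b \<in> carrier (grp B (n - p))"
  note t = tensor_class_hom_left[OF p b]
  show "f (tensor_class (lam C) B n (p, a, b)) = g (tensor_class (lam C) B n (p, a, b))"
  proof (rule C.lam_hom_eq[OF G hom_comp[OF t f] hom_comp[OF t g] _ a])
    fix x assume x: "x \<in> qcells C p"
    show "f (tensor_class (lam C) B n (p, lam_class C p x, b)) = g (tensor_class (lam C) B n (p, lam_class C p x, b))"
    proof (cases "\<exists>q<p. x \<in> qcells C q")
      case True
      then have "lam_class C p x = \<one>\<^bsub>grp (lam C) p\<^esub>" using C.lam_class_degenerate by blast
      then show ?thesis
        by (simp add: hom_one_eq[OF t A.grp_comm grp_tensor_comm] hom_one_eq[OF f grp_tensor_comm G]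
            hom_one_eq[OF g grp_tensor_comm G])
    next
      case False
      then show ?thesis using eq[OF p x _ b] by blast
    qed
  qed
qed

lemma hull_subset:
  assumes G: "comm_group G" and f: "f \<in> hom (grp (tensor (lam C) B) n) G" and M: "submonoid M G"
    and eq: "\<And>p x b. p \<le> n \<Longrightarrow> x \<in> qcells C p \<Longrightarrow> (\<And>q. q < p \<Longrightarrow> x \<notin> qcells C q) \<Longrightarrow> b \<in> pos B (n - p) \<Longrightarrow>
      f (tensor_class (lam C) B n (p, lam_class C p x, b)) \<in> M"
    and X: "X \<in> pos (tensor (lam C) B) n"
  shows "f X \<in> M"
proof (rule tensor_hull_subset[OF G f M _ X])
  fix p a b assume p: "p \<le> n" and a: "a \<in> pos (lam C) p" and b: "b \<in> pos B (n - p)"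
  note t = tensor_class_hom_left[OF p B.pos_closed[OF b]]
  show "f (tensor_class (lam C) B n (p, a, b)) \<in> M"
  proof (rule C.lam_hull_subset[OF G hom_comp[OF t f] M _ a])
    fix x assume x: "x \<in> qcells C p"
    show "f (tensor_class (lam C) B n (p, lam_class C p x, b)) \<in> M"
    proof (cases "\<exists>q<p. x \<in> qcells C q")
      case True
      then have "lam_class C p x = \<one>\<^bsub>grp (lam C) p\<^esub>" using C.lam_class_degenerate by blast
      then show ?thesis
        by (simp add: hom_one_eq[OF t A.grp_comm grp_tensor_comm] hom_one_eq[OF f grp_tensor_comm G]
            submonoid.one_closed[OF M])
    next
      case False
      then show ?thesis using eq[OF p x _ b] by blast
    qed
  qed
qed

definition V where "V n x b = tensor_class (lam C) B n (0, lam_class C 0 x, b)"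

lemma V_hom: "x \<in> qcells C 0 \<Longrightarrow> V n x \<in> hom (grp B n) (grp (tensor (lam C) B) n)"
  unfolding V_def[abs_def]
  using tensor_class_hom_right[of 0 n "lam_class C 0 x"] by (simp add: lam_class_closed)

lemma V_pos: "x \<in> qcells C 0 \<Longrightarrow> b \<in> pos B n \<Longrightarrow> V n x b \<in> pos (tensor (lam C) B) n"
  unfolding V_def by (rule tensor_class_pos) (auto simp: lam_class_pos)

lemma aug_V: "x \<in> qcells C 0 \<Longrightarrow> b \<in> carrier (grp B 0) \<Longrightarrow> aug (tensor (lam C) B) (V 0 x b) = aug B b"
  by (simp add: V_def aug_tensor_class lam_class_closed C.aug_lam_class)

text \<open>An object has degree 0, so the Leibniz formula has no first term and no sign, and each
  object carries a chain map from \<open>B\<close>.\<close>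

lemma bd_V:
  assumes "x \<in> qcells C 0" "b \<in> carrier (grp B (Suc n))"
  shows "bd (tensor (lam C) B) (Suc n) (V (Suc n) x b) = V n x (bd B (Suc n) b)"
proof -
  interpret T: comm_group "grp (tensor (lam C) B) n" by (rule grp_tensor_comm)
  show ?thesis
    unfolding V_def using assms
    by (subst bd_tensor_class)
      (auto simp: lam_class_closed tensor_bd_gen_def B.bd_closed tensor_class_closed)
qed

end

section \<open>Coordinates on the linearized arrow\<close>

lemma qcells_arrow: "qcells arrow 0 = {(False, False), (True, True)}"
    "qcells arrow (Suc q) = {(False, False), (True, True), (False, True)}"
  by (auto simp: qcells_def arrow_def)

lemma qcells_arrow_boundary: "qcells arrow_boundary q = {(False, False), (True, True)}"
  by (auto simp: qcells_def arrow_boundary_def arrow_def)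

lemma qcells_point: "qcells point q = {()}"
  by (auto simp: qcells_def point_def)

interpretation arrow: strict_omega_category arrow
  by (rule strict_omega_category_arrow)

definition edge_coeff :: "(bool \<times> bool \<Rightarrow>\<^sub>0 int) set \<Rightarrow> int"
  where "edge_coeff = pextend integer_group (\<lambda>x. if x = (False, True) then 1 else 0)"

text \<open>There is no dimension below 0 to compose along, so degree 0 of \<open>lam C\<close> has
  no relations and every integer function on objects extends.\<close>

lemma end_coeff:
  assumes "strict_omega_category C"
  shows "end_coeff e \<in> hom (grp (lam C) 0) integer_group"
    "x \<in> qcells C 0 \<Longrightarrow> end_coeff e (lam_class C 0 x) = (if x = (e, e) then 1 else 0)"
proof -
  interpret strict_omega_category C by fact
  show "end_coeff e \<in> hom (grp (lam C) 0) integer_group"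
    unfolding end_coeff_def by (rule lam_extend[OF abelian_integer_group]) auto
  assume "x \<in> qcells C 0"
  then show "end_coeff e (lam_class C 0 x) = (if x = (e, e) then 1 else 0)"
    unfolding end_coeff_def by (subst lam_extend(2)[OF abelian_integer_group]) auto
qed

text \<open>A composite along dimension 0 is the edge exactly when one factor is the edge and the
  other an identity, so the indicator of the edge is additive.\<close>

lemma edge_coeff: "edge_coeff \<in> hom (grp (lam arrow) (Suc 0)) integer_group"
    "edge_coeff (lam_class arrow (Suc 0) (False, True)) = 1"
proof -
  have add: "(if cmp arrow p x y = (False, True) then 1 else 0 :: int) =
      (if x = (False, True) then 1 else 0) \<otimes>\<^bsub>integer_group\<^esub> (if y = (False, True) then 1 else 0)"
    if "p < Suc 0" "x \<in> qcells arrow (Suc 0)" "y \<in> qcells arrow (Suc 0)" "composable arrow p x y" for p x y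
    using that by (auto simp: qcells_arrow composable_def arrow_def)
  show "edge_coeff \<in> hom (grp (lam arrow) (Suc 0)) integer_group"
    unfolding edge_coeff_def by (rule arrow.lam_extend[OF abelian_integer_group _ add]) auto
  show "edge_coeff (lam_class arrow (Suc 0) (False, True)) = 1"
    unfolding edge_coeff_def
    by (subst arrow.lam_extend(2)[OF abelian_integer_group _ add]) (auto simp: qcells_arrow)
qed

definition vertex :: "bool \<Rightarrow> (bool \<times> bool \<Rightarrow>\<^sub>0 int) set"
  where "vertex e = lam_class arrow 0 (e, e)"

definition edge :: "(bool \<times> bool \<Rightarrow>\<^sub>0 int) set"
  where "edge = lam_class arrow (Suc 0) (False, True)"

lemma vertex_closed: "vertex e \<in> carrier (grp (lam arrow) 0)"
  by (cases e) (auto simp: vertex_def qcells_arrow intro!: lam_class_closed)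

lemma edge_closed: "edge \<in> carrier (grp (lam arrow) (Suc 0))"
  by (auto simp: edge_def qcells_arrow intro!: lam_class_closed)

lemma edge_pos: "edge \<in> pos (lam arrow) (Suc 0)"
  by (auto simp: edge_def qcells_arrow intro!: lam_class_pos)

lemma bd_edge: "bd (lam arrow) (Suc 0) edge =
    vertex True \<otimes>\<^bsub>grp (lam arrow) 0\<^esub> inv\<^bsub>grp (lam arrow) 0\<^esub> vertex False"
  unfolding edge_def vertex_def
  by (subst arrow.bd_lam_class) (auto simp: qcells_arrow, simp_all add: arrow_def)

lemma end_coeff_vertex: "end_coeff e (vertex e') = (if e = e' then 1 else 0)"
  unfolding vertex_def
  by (subst end_coeff(2)[OF strict_omega_category_arrow]) (auto simp: qcells_arrow)

section \<open>The cylinder on a complex\<close>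

locale cylinder = B: precomplex B for B :: "'b adc"
begin

abbreviation "X \<equiv> tensor (lam arrow) B"

sublocale T: lam_tensor arrow B
  by (intro lam_tensor.intro strict_omega_category_arrow B.precomplex_axioms)

sublocale X: precomplex X by (rule T.precomplex_tensor)

definition E where "E n e = T.V n (e, e)"

lemma E_eq: "E n e b = tensor_class (lam arrow) B n (0, vertex e, b)"
  by (simp add: E_def T.V_def vertex_def)

lemma diagonal: "(e, e) \<in> qcells arrow 0"
  by (cases e) (auto simp: qcells_arrow)

text \<open>The prism operator: a homotopy from the end inclusion \<open>E n False\<close> to
  \<open>E n True\<close>, which together with these two inclusions generates the cylinder.\<close>

definition J where "J n b = tensor_class (lam arrow) B (Suc n) (Suc 0, edge, b)"

lemma E_hom: "E n e \<in> hom (grp B n) (grp X n)"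
  unfolding E_def by (rule T.V_hom[OF diagonal])

lemma J_hom: "J n \<in> hom (grp B n) (grp X (Suc n))"
  unfolding J_def[abs_def] using T.tensor_class_hom_right[of "Suc 0" "Suc n" edge] by (simp add: edge_closed)

lemma E_closed: "b \<in> carrier (grp B n) \<Longrightarrow> E n e b \<in> carrier (grp X n)"
  by (rule hom_in_carrier[OF E_hom])

lemma J_closed: "b \<in> carrier (grp B n) \<Longrightarrow> J n b \<in> carrier (grp X (Suc n))"
  by (rule hom_in_carrier[OF J_hom])

lemma E_pos: "b \<in> pos B n \<Longrightarrow> E n e b \<in> pos X n"
  unfolding E_def by (rule T.V_pos[OF diagonal])

lemma J_pos: "b \<in> pos B n \<Longrightarrow> J n b \<in> pos X (Suc n)"
  unfolding J_def by (rule T.tensor_class_pos) (auto simp: edge_pos)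

lemma E_one: "E n e \<one>\<^bsub>grp B n\<^esub> = \<one>\<^bsub>grp X n\<^esub>"
  by (rule hom_one_eq[OF E_hom B.grp_comm X.grp_comm])

lemma E_inv: "b \<in> carrier (grp B n) \<Longrightarrow> E n e (inv\<^bsub>grp B n\<^esub> b) = inv\<^bsub>grp X n\<^esub> E n e b"
  by (rule hom_inv_eq[OF E_hom B.grp_comm X.grp_comm])

lemma E_pow: "b \<in> carrier (grp B n) \<Longrightarrow> E n e (b [^]\<^bsub>grp B n\<^esub> (k :: int)) = E n e b [^]\<^bsub>grp X n\<^esub> k"
  by (rule hom_pow_eq[OF E_hom B.grp_comm X.grp_comm])

lemma aug_E: "b \<in> carrier (grp B 0) \<Longrightarrow> aug X (E 0 e b) = aug B b"
  unfolding E_def by (rule T.aug_V[OF diagonal])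

lemma bd_E: "b \<in> carrier (grp B (Suc n)) \<Longrightarrow> bd X (Suc n) (E (Suc n) e b) = E n e (bd B (Suc n) b)"
  unfolding E_def by (rule T.bd_V[OF diagonal])

lemma bd_J_0: 
  assumes b: "b \<in> carrier (grp B 0)"
  shows "bd X (Suc 0) (J 0 b) = E 0 True b \<otimes>\<^bsub>grp X 0\<^esub> inv\<^bsub>grp X 0\<^esub> E 0 False b"
proof -
  have t: "(\<lambda>a. tensor_class (lam arrow) B 0 (0, a, b)) \<in> hom (grp (lam arrow) 0) (grp X 0)"
    using b by (intro T.tensor_class_hom_left) auto
  show ?thesis
    unfolding J_def E_eq using b
    by (subst T.bd_tensor_class)
      (auto simp: edge_closed vertex_closed T.tensor_bd_gen_def T.tensor_class_closed bd_edge hom_mult[OF t]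
        hom_inv_eq[OF t T.A.grp_comm X.grp_comm])
qed

text \<open>The edge has degree one, so the Leibniz sign turns the last summand into an
  inverse.\<close>

lemma bd_J_Suc:
  assumes b: "b \<in> carrier (grp B (Suc n))"
  shows "bd X (Suc (Suc n)) (J (Suc n) b) = (E (Suc n) True b \<otimes>\<^bsub>grp X (Suc n)\<^esub> inv\<^bsub>grp X (Suc n)\<^esub> E (Suc n) False b)
    \<otimes>\<^bsub>grp X (Suc n)\<^esub> inv\<^bsub>grp X (Suc n)\<^esub> J n (bd B (Suc n) b)"
proof -
  have t: "(\<lambda>a. tensor_class (lam arrow) B (Suc n) (0, a, b)) \<in> hom (grp (lam arrow) 0) (grp X (Suc n))"
    using b by (intro T.tensor_class_hom_left) auto
  have c: "tensor_class (lam arrow) B (Suc n) (Suc 0, edge, bd B (Suc n) b) \<in> carrier (grp X (Suc n))"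
    using J_closed[OF B.bd_closed[OF b]] by (simp add: J_def)
  show ?thesis
    unfolding J_def E_eq using b c
    by (subst T.bd_tensor_class)
      (auto simp: edge_closed vertex_closed T.tensor_bd_gen_def T.tensor_class_closed bd_edge hom_mult[OF t]
        hom_inv_eq[OF t T.A.grp_comm X.grp_comm] X.G.int_pow_neg)
qed

lemma nondegenerate_cases:
  assumes "x \<in> qcells arrow p" "\<And>q. q < p \<Longrightarrow> x \<notin> qcells arrow q"
  shows "(p = 0 \<and> (\<exists>e. x = (e, e))) \<or> (p = Suc 0 \<and> x = (False, True))"
proof -
  consider "p = 0" | "p = Suc 0" | q where "p = Suc (Suc q)" by (metis not0_implies_Suc)
  then show ?thesis
  proof cases
    case 1
    then show ?thesis using assms(1) by (auto simp: qcells_arrow)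
  next
    case 2
    then show ?thesis using assms(1) assms(2)[of 0] by (auto simp: qcells_arrow)
  next
    case 3
    then show ?thesis using assms(1) assms(2)[of "Suc 0"] by (auto simp: qcells_arrow)
  qed
qed

lemma cylinder_hom_eq:
  assumes G: "comm_group G" and f: "f \<in> hom (grp X n) G" and g: "g \<in> hom (grp X n) G"
    and E: "\<And>e b. b \<in> carrier (grp B n) \<Longrightarrow> f (E n e b) = g (E n e b)"
    and J: "\<And>m b. n = Suc m \<Longrightarrow> b \<in> carrier (grp B m) \<Longrightarrow> f (J m b) = g (J m b)"
    and x: "x \<in> carrier (grp X n)"
  shows "f x = g x"
proof (rule T.hom_eq[OF G f g _ x])
  fix p x b assume p: "p \<le> n" and x: "x \<in> qcells arrow p" "\<And>q. q < p \<Longrightarrow> x \<notin> qcells arrow q"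
    and b: "b \<in> carrier (grp B (n - p))"
  from nondegenerate_cases[OF x] consider e where "p = 0" "x = (e, e)" | "p = Suc 0" "x = (False, True)"
    by blast
  then show "f (tensor_class (lam arrow) B n (p, lam_class arrow p x, b)) =
      g (tensor_class (lam arrow) B n (p, lam_class arrow p x, b))"
  proof cases
    case 1
    then show ?thesis using E[of b] b by (simp add: E_eq vertex_def)
  next
    case 2
    then show ?thesis using J[of "n - 1" b] b p by (simp add: J_def edge_def)
  qed
qed

lemma cylinder_hull_subset:
  assumes G: "comm_group G" and f: "f \<in> hom (grp X n) G" and M: "submonoid M G"
    and E: "\<And>e b. b \<in> pos B n \<Longrightarrow> f (E n e b) \<in> M"
    and J: "\<And>m b. n = Suc m \<Longrightarrow> b \<in> pos B m \<Longrightarrow> f (J m b) \<in> M"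
    and x: "x \<in> pos X n"
  shows "f x \<in> M"
proof (rule T.hull_subset[OF G f M _ x])
  fix p x b assume p: "p \<le> n" and x: "x \<in> qcells arrow p" "\<And>q. q < p \<Longrightarrow> x \<notin> qcells arrow q"
    and b: "b \<in> pos B (n - p)"
  from nondegenerate_cases[OF x] consider e where "p = 0" "x = (e, e)" | "p = Suc 0" "x = (False, True)"
    by blast
  then show "f (tensor_class (lam arrow) B n (p, lam_class arrow p x, b)) \<in> M"
  proof cases
    case 1
    then show ?thesis using E[of b] b by (simp add: E_eq vertex_def)
  next
    case 2
    then show ?thesis using J[of "n - 1" b] b p by (simp add: J_def edge_def)
  qed
qed

text \<open>A homomorphism out of the cylinder given by its values \<open>f\<close> on the two ends
  and \<open>g\<close> on prisms: the coordinates of a chain of the arrow become exponents. Above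
  degree one every cell of the arrow is degenerate, hence the trivial value there.\<close>

definition cylinder_lift :: "('h, 'm) monoid_scheme \<Rightarrow> (bool \<Rightarrow> 'b \<Rightarrow> 'h) \<Rightarrow> ('b \<Rightarrow> 'h) \<Rightarrow>
    (nat \<times> (bool \<times> bool \<Rightarrow>\<^sub>0 int) set \<times> 'b \<Rightarrow>\<^sub>0 int) set \<Rightarrow> 'h"
  where "cylinder_lift G f g = pextend G (\<lambda>(p, a, b).
    if p = 0 then f False b [^]\<^bsub>G\<^esub> end_coeff False a \<otimes>\<^bsub>G\<^esub> f True b [^]\<^bsub>G\<^esub> end_coeff True a
    else if p = Suc 0 then g b [^]\<^bsub>G\<^esub> edge_coeff a
    else \<one>\<^bsub>G\<^esub>)"

lemma cylinder_lift:
  assumes G: "comm_group G" and f: "\<And>e. f e \<in> hom (grp B n) G"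
    and g: "\<And>m. n = Suc m \<Longrightarrow> g \<in> hom (grp B m) G"
  shows "cylinder_lift G f g \<in> hom (grp X n) G"
    and "b \<in> carrier (grp B n) \<Longrightarrow> cylinder_lift G f g (E n e b) = f e b"
    and "n = Suc m \<Longrightarrow> c \<in> carrier (grp B m) \<Longrightarrow> cylinder_lift G f g (J m c) = g c"
proof -
  interpret comm_group G by fact
  let ?\<phi> = "\<lambda>(p, a, b).
    if p = 0 then f False b [^]\<^bsub>G\<^esub> end_coeff False a \<otimes>\<^bsub>G\<^esub> f True b [^]\<^bsub>G\<^esub> end_coeff True a
    else if p = Suc 0 then g b [^]\<^bsub>G\<^esub> edge_coeff a
    else \<one>\<^bsub>G\<^esub>"
  have fc: "f e b \<in> carrier G" if "b \<in> carrier (grp B n)" for e b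
    by (rule hom_in_carrier[OF f that])
  have gc: "g b \<in> carrier G" if "n = Suc m" "b \<in> carrier (grp B m)" for m b
    by (rule hom_in_carrier[OF g[OF that(1)] that(2)])
  have left: "(\<lambda>a. ?\<phi> (p, a, b)) \<in> hom (grp (lam arrow) p) G"
    if "p \<le> n" "b \<in> carrier (grp B (n - p))" for p b
  proof -
    consider "p = 0" | m where "p = Suc 0" "n = Suc m" | "p \<noteq> 0" "p \<noteq> Suc 0"
      using \<open>p \<le> n\<close> by (cases n) auto
    then show ?thesis
    proof cases
      case 1
      then show ?thesis using that
        by (simp, intro hom_mult_fun[OF G] hom_pow_exponent end_coeff(1) strict_omega_category_arrow fc is_group)
    next
      case 2
      then show ?thesis using that gc by (simp add: hom_pow_exponent edge_coeff is_group)
    next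
      case 3
      then show ?thesis by (simp add: hom_one_fun[OF G])
    qed
  qed
  have right: "(\<lambda>b. ?\<phi> (p, a, b)) \<in> hom (grp B (n - p)) G"
    if "p \<le> n" "a \<in> carrier (grp (lam arrow) p)" for p a
  proof -
    consider "p = 0" | m where "p = Suc 0" "n = Suc m" | "p \<noteq> 0" "p \<noteq> Suc 0"
      using \<open>p \<le> n\<close> by (cases n) auto
    then show ?thesis
    proof cases
      case 1
      then show ?thesis by (simp add: hom_mult_fun[OF G] hom_pow_fun[OF G] f)
    next
      case 2
      then show ?thesis using g[of m] by (simp add: hom_pow_fun[OF G])
    next
      case 3
      then show ?thesis by (simp add: hom_one_fun[OF G])
    qed
  qed
  show "cylinder_lift G f g \<in> hom (grp X n) G"
    unfolding cylinder_lift_def by (rule T.tensor_extend[OF G left right])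
  show "cylinder_lift G f g (E n e b) = f e b" if "b \<in> carrier (grp B n)"
    unfolding cylinder_lift_def E_eq
    by (subst T.tensor_extend(2)[OF G left right])
      (use that fc in \<open>auto simp: vertex_closed end_coeff_vertex int_pow_1\<close>)
  show "cylinder_lift G f g (J m c) = g c" if "n = Suc m" "c \<in> carrier (grp B m)"
    unfolding cylinder_lift_def J_def that(1)[symmetric]
    by (subst T.tensor_extend(2)[OF G left right])
      (use that gc[OF that] in \<open>auto simp: edge_closed edge_coeff[folded edge_def] int_pow_1\<close>)
qed

end

section \<open>Contracting the cylinder\<close>

locale contracted_cylinder = cylinder B + contracted_complex B b h
  for B :: "'b adc" and b :: 'b and h :: "nat \<Rightarrow> 'b \<Rightarrow> 'b"
begin

text \<open>The path to \<open>1 \<otimes> x\<close> runs inside the 0-end from the base point to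
  \<open>0 \<otimes> x\<close>, by \<open>h\<close>, and then along the edge, by \<open>J\<close>;
  adding the two pieces gives the value on the 1-end. Prisms go to zero, which \<open>H_bd_J\<close>
  justifies.\<close>

definition H :: "nat \<Rightarrow> (nat \<times> (bool \<times> bool \<Rightarrow>\<^sub>0 int) set \<times> 'b \<Rightarrow>\<^sub>0 int) set \<Rightarrow>
    (nat \<times> (bool \<times> bool \<Rightarrow>\<^sub>0 int) set \<times> 'b \<Rightarrow>\<^sub>0 int) set"
  where "H n = cylinder_lift (grp X (Suc n))
    (\<lambda>e x. if e then J n x \<otimes>\<^bsub>grp X (Suc n)\<^esub> E (Suc n) False (h n x) else E (Suc n) False (h n x))
    (\<lambda>_. \<one>\<^bsub>grp X (Suc n)\<^esub>)"

lemma Eh_hom: "(\<lambda>x. E (Suc n) e (h n x)) \<in> hom (grp B n) (grp X (Suc n))"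
  by (rule hom_comp[OF h_hom E_hom])

lemma H_hom: "H n \<in> hom (grp X n) (grp X (Suc n))"
  and H_E: "x \<in> carrier (grp B n) \<Longrightarrow> H n (E n e x) =
    (if e then J n x \<otimes>\<^bsub>grp X (Suc n)\<^esub> E (Suc n) False (h n x) else E (Suc n) False (h n x))"
  and H_J: "n = Suc m \<Longrightarrow> y \<in> carrier (grp B m) \<Longrightarrow> H n (J m y) = \<one>\<^bsub>grp X (Suc n)\<^esub>"
proof -
  have f: "(\<lambda>x. if e then J n x \<otimes>\<^bsub>grp X (Suc n)\<^esub> E (Suc n) False (h n x) else E (Suc n) False (h n x))
    \<in> hom (grp B n) (grp X (Suc n))" for e
    by (cases e) (simp_all add: hom_mult_fun[OF X.grp_comm J_hom Eh_hom] Eh_hom)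
  have g: "(\<lambda>_. \<one>\<^bsub>grp X (Suc n)\<^esub>) \<in> hom (grp B m) (grp X (Suc n))" for m
    by (rule hom_one_fun[OF X.grp_comm])
  note m = cylinder_lift[OF X.grp_comm f g]
  show "H n \<in> hom (grp X n) (grp X (Suc n))" unfolding H_def by (rule m)
  show "x \<in> carrier (grp B n) \<Longrightarrow> H n (E n e x) =
    (if e then J n x \<otimes>\<^bsub>grp X (Suc n)\<^esub> E (Suc n) False (h n x) else E (Suc n) False (h n x))"
    unfolding H_def by (rule m)
  show "n = Suc m \<Longrightarrow> y \<in> carrier (grp B m) \<Longrightarrow> H n (J m y) = \<one>\<^bsub>grp X (Suc n)\<^esub>"
    unfolding H_def by (rule m)
qed

lemma bd_Eh_0: "x \<in> carrier (grp B 0) \<Longrightarrow> bd X (Suc 0) (E (Suc 0) e (h 0 x)) =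
    E 0 e x \<otimes>\<^bsub>grp X 0\<^esub> inv\<^bsub>grp X 0\<^esub> (E 0 e b [^]\<^bsub>grp X 0\<^esub> aug B x)"
  by (simp add: bd_E h_closed bd_h_0 hom_mult[OF E_hom] E_inv E_pow base_closed)

lemma bd_Eh_Suc: "x \<in> carrier (grp B (Suc n)) \<Longrightarrow> bd X (Suc (Suc n)) (E (Suc (Suc n)) e (h (Suc n) x)) =
    E (Suc n) e x \<otimes>\<^bsub>grp X (Suc n)\<^esub> inv\<^bsub>grp X (Suc n)\<^esub> E (Suc n) e (h n (bd B (Suc n) x))"
  by (simp add: bd_E h_closed bd_h_Suc hom_mult[OF E_hom] E_inv B.bd_closed)

text \<open>The copy of \<open>x\<close> in the 0-end cancels between the prism and the contracted
  0-end. The same chain is the value of \<open>\<sigma>\<close> on a prism, so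
  \<open>bd_JEh_0\<close> and \<open>bd_JEh_Suc\<close> serve both the contraction of the cylinder
  and the section of the join.\<close>

lemma bd_JEh_0: 
  assumes x: "x \<in> carrier (grp B 0)"
  shows "bd X (Suc 0) (J 0 x \<otimes>\<^bsub>grp X (Suc 0)\<^esub> E (Suc 0) False (h 0 x)) =
    E 0 True x \<otimes>\<^bsub>grp X 0\<^esub> inv\<^bsub>grp X 0\<^esub> (E 0 False b [^]\<^bsub>grp X 0\<^esub> aug B x)"
  using x by (simp add: X.bd_mult J_closed E_closed h_closed bd_J_0 bd_Eh_0
      diff_add_telescope[OF X.grp_comm] base_closed)

lemma bd_JEh_Suc: 
  assumes x: "x \<in> carrier (grp B (Suc n))"
  shows "bd X (Suc (Suc n)) (J (Suc n) x \<otimes>\<^bsub>grp X (Suc (Suc n))\<^esub> E (Suc (Suc n)) False (h (Suc n) x)) =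
    E (Suc n) True x \<otimes>\<^bsub>grp X (Suc n)\<^esub> inv\<^bsub>grp X (Suc n)\<^esub>
      (J n (bd B (Suc n) x) \<otimes>\<^bsub>grp X (Suc n)\<^esub> E (Suc n) False (h n (bd B (Suc n) x)))"
  using x by (simp add: X.bd_mult J_closed E_closed h_closed bd_J_Suc bd_Eh_Suc B.bd_closed
      diff_diff_add_telescope[OF X.grp_comm])

text \<open>The two contracted 0-ends cancel and \<open>H\<close> kills the lower prism, so the term
  \<open>H d\<close> alone already yields the identity on prisms. Hence \<open>H\<close> may vanish
  on them.\<close>

lemma H_bd_J:
  assumes x: "x \<in> carrier (grp B n)"
  shows "H n (bd X (Suc n) (J n x)) = J n x"
proof -
  let ?G = "grp X (Suc n)"
  have "H n (E n True x \<otimes>\<^bsub>grp X n\<^esub> inv\<^bsub>grp X n\<^esub> E n False x) =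
      (J n x \<otimes>\<^bsub>?G\<^esub> E (Suc n) False (h n x)) \<otimes>\<^bsub>?G\<^esub> inv\<^bsub>?G\<^esub> E (Suc n) False (h n x)"
    using x by (simp add: hom_mult[OF H_hom] hom_inv_eq[OF H_hom X.grp_comm X.grp_comm] E_closed H_E)
  also have "\<dots> = J n x"
    using x by (simp add: X.G.m_assoc J_closed E_closed h_closed)
  finally have 1: "H n (E n True x \<otimes>\<^bsub>grp X n\<^esub> inv\<^bsub>grp X n\<^esub> E n False x) = J n x" .
  show ?thesis
  proof (cases n)
    case 0
    then show ?thesis using 1 x by (simp add: bd_J_0)
  next
    case (Suc m)
    then show ?thesis
      using 1 x by (simp add: bd_J_Suc hom_mult[OF H_hom] hom_inv_eq[OF H_hom X.grp_comm X.grp_comm] 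
          E_closed J_closed B.bd_closed H_J)
  qed
qed

lemma contraction_cylinder: "contraction X (E 0 False b) H"
  unfolding contraction_def
proof (intro conjI allI ballI H_hom)
  show "E 0 False b \<in> pos X 0" "aug X (E 0 False b) = 1"
    using base base_closed by (auto simp: E_pos aug_E)
  show "H n ` pos X n \<subseteq> pos X (Suc n)" for n
  proof (rule image_subsetI, erule cylinder_hull_subset[OF X.grp_comm H_hom X.pos_submonoid, rotated 2])
    show "H n (E n e x) \<in> pos X (Suc n)" if "x \<in> pos B n" for e x
      using that by (auto simp: H_E B.pos_closed E_pos J_pos h_pos)
    show "H n (J m x) \<in> pos X (Suc n)" if "n = Suc m" "x \<in> pos B m" for m x
      using that by (simp add: H_J B.pos_closed)
  qed
next
  fix x assume x: "x \<in> carrier (grp X 0)"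
  show "bd X (Suc 0) (H 0 x) = x \<otimes>\<^bsub>grp X 0\<^esub> inv\<^bsub>grp X 0\<^esub> (E 0 False b [^]\<^bsub>grp X 0\<^esub> aug X x)"
  proof (rule cylinder_hom_eq[OF X.grp_comm hom_comp[OF H_hom X.bd_hom] _ _ _ x])
    show "(\<lambda>x. x \<otimes>\<^bsub>grp X 0\<^esub> inv\<^bsub>grp X 0\<^esub> (E 0 False b [^]\<^bsub>grp X 0\<^esub> aug X x)) \<in> hom (grp X 0) (grp X 0)"
      by (intro hom_mult_fun hom_inv_fun hom_pow_exponent X.aug_hom X.grp_comm X.G.is_group
            E_closed base_closed) (auto intro: homI)
    fix e x assume "x \<in> carrier (grp B 0)"
    then show "bd X (Suc 0) (H 0 (E 0 e x)) =
        E 0 e x \<otimes>\<^bsub>grp X 0\<^esub> inv\<^bsub>grp X 0\<^esub> (E 0 False b [^]\<^bsub>grp X 0\<^esub> aug X (E 0 e x))"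
      by (cases e) (simp_all add: H_E aug_E bd_Eh_0 bd_JEh_0)
  qed auto
next
  fix n x assume x: "x \<in> carrier (grp X (Suc n))"
  show "bd X (Suc (Suc n)) (H (Suc n) x) = x \<otimes>\<^bsub>grp X (Suc n)\<^esub> inv\<^bsub>grp X (Suc n)\<^esub> H n (bd X (Suc n) x)"
  proof (rule cylinder_hom_eq[OF X.grp_comm hom_comp[OF H_hom X.bd_hom] _ _ _ x])
    show "(\<lambda>x. x \<otimes>\<^bsub>grp X (Suc n)\<^esub> inv\<^bsub>grp X (Suc n)\<^esub> H n (bd X (Suc n) x)) \<in> hom (grp X (Suc n)) (grp X (Suc n))"
      by (intro hom_mult_fun hom_inv_fun X.grp_comm X.G.is_group hom_comp[OF X.bd_hom H_hom])
        (auto intro: homI)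
    fix e x assume "x \<in> carrier (grp B (Suc n))"
    then show "bd X (Suc (Suc n)) (H (Suc n) (E (Suc n) e x)) =
        E (Suc n) e x \<otimes>\<^bsub>grp X (Suc n)\<^esub> inv\<^bsub>grp X (Suc n)\<^esub> H n (bd X (Suc n) (E (Suc n) e x))"
      by (cases e) (simp_all add: H_E bd_E bd_Eh_Suc bd_JEh_Suc B.bd_closed)
  next
    fix m x assume "Suc n = Suc m" "x \<in> carrier (grp B m)"
    then show "bd X (Suc (Suc n)) (H (Suc n) (J m x)) =
        J m x \<otimes>\<^bsub>grp X (Suc n)\<^esub> inv\<^bsub>grp X (Suc n)\<^esub> H n (bd X (Suc n) (J m x))"
      by (simp add: H_bd_J H_J X.bd_one J_closed)
  qed
qed

end

lemma contractible_cylinder: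
  assumes "precomplex B" "contractible B"
  shows "contractible (tensor (lam arrow) B)"
proof -
  obtain b h where "contraction B b h" using assms(2) by (auto simp: contractible_def)
  then interpret contracted_cylinder B b h
    using assms(1) by (simp add: contracted_complex_def contracted_complex_axioms_def
        contracted_cylinder_def cylinder_def)
  show ?thesis using contraction_cylinder by (auto simp: contractible_def)
qed

section \<open>Pushouts\<close>

text \<open>Elements of the coset differ from \<open>z\<close> by elements of \<open>N\<close>,
  which \<open>s\<close> kills. For \<open>pushout\<close> this does what \<open>pextend_hom\<close>
  does for presented groups.\<close>

lemma coset_some:
  assumes S: "comm_group S" and G: "comm_group G" and N: "subgroup N S" and s: "s \<in> hom S G"
    and ker: "\<And>k. k \<in> N \<Longrightarrow> s k = \<one>\<^bsub>G\<^esub>" and z: "z \<in> carrier S"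
  shows "s (SOME w. w \<in> N #>\<^bsub>S\<^esub> z) = s z"
proof -
  interpret S: comm_group S by fact
  interpret G: comm_group G by fact
  have "(SOME w. w \<in> N #>\<^bsub>S\<^esub> z) \<in> N #>\<^bsub>S\<^esub> z"
    by (rule someI[of _ z]) (rule S.rcos_self[OF z N])
  then obtain k where k: "k \<in> N" "(SOME w. w \<in> N #>\<^bsub>S\<^esub> z) = k \<otimes>\<^bsub>S\<^esub> z"
    by (auto simp: r_coset_def)
  have "s (k \<otimes>\<^bsub>S\<^esub> z) = s k \<otimes>\<^bsub>G\<^esub> s z"
    using k(1) subgroup.subset[OF N] z by (intro hom_mult[OF s]) auto
  then show ?thesis using k ker hom_in_carrier[OF s z] by simp
qed

lemma coset_extend_hom:
  assumes S: "comm_group S" and G: "comm_group G" and N: "subgroup N S" and s: "s \<in> hom S G"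
    and ker: "\<And>k. k \<in> N \<Longrightarrow> s k = \<one>\<^bsub>G\<^esub>"
  shows "(\<lambda>X. s (SOME w. w \<in> X)) \<in> hom (S Mod N) G"
proof (rule homI)
  interpret S: comm_group S by fact
  have q: "(\<lambda>z. N #>\<^bsub>S\<^esub> z) \<in> hom S (S Mod N)"
    by (intro normal.r_coset_hom_Mod S.subgroup_imp_normal N)
  note some = coset_some[OF S G N s ker]
  fix X assume "X \<in> carrier (S Mod N)"
  then obtain x where x: "x \<in> carrier S" "X = N #>\<^bsub>S\<^esub> x" by (auto simp: carrier_FactGroup)
  then show "s (SOME w. w \<in> X) \<in> carrier G" by (simp add: some hom_in_carrier[OF s])
  fix Y assume "Y \<in> carrier (S Mod N)"
  then obtain y where y: "y \<in> carrier S" "Y = N #>\<^bsub>S\<^esub> y" by (auto simp: carrier_FactGroup)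
  have "X \<otimes>\<^bsub>S Mod N\<^esub> Y = N #>\<^bsub>S\<^esub> (x \<otimes>\<^bsub>S\<^esub> y)"
    unfolding x y by (rule hom_mult[OF q x(1) y(1), symmetric])
  then show "s (SOME w. w \<in> X \<otimes>\<^bsub>S Mod N\<^esub> Y) = s (SOME w. w \<in> X) \<otimes>\<^bsub>G\<^esub> s (SOME w. w \<in> Y)"
    using x y by (simp add: some hom_mult[OF s])
qed

lemma hom_Pair_fun: "f \<in> hom A G \<Longrightarrow> g \<in> hom A H \<Longrightarrow> (\<lambda>x. (f x, g x)) \<in> hom A (G \<times>\<times> H)"
  by (auto intro!: homI simp: hom_in_carrier hom_mult)

lemma hom_id: "(\<lambda>x. x) \<in> hom A A"
  by (auto intro: homI)

context precomplex_pair
begin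

lemma adc_sum_simps:
  "grp (adc_sum A B) n = grp A n \<times>\<times> grp B n"
  "bd (adc_sum A B) n z = (bd A n (fst z), bd B n (snd z))"
  "aug (adc_sum A B) z = aug A (fst z) + aug B (snd z)"
  "pos (adc_sum A B) n = pos A n \<times> pos B n"
  by (simp_all add: adc_sum_def case_prod_beta)

lemma comm_group_DirProd: "comm_group (grp A n \<times>\<times> grp B n)"
  by (rule group.group_comm_groupI)
    (auto simp: DirProd_group A.G.is_group B.G.is_group A.G.m_comm B.G.m_comm)

lemma precomplex_sum: "precomplex (adc_sum A B)"
proof (rule precomplex.intro)
  show "comm_group (grp (adc_sum A B) n)" for n
    by (simp add: adc_sum_simps comm_group_DirProd)
  show "bd (adc_sum A B) (Suc n) \<in> hom (grp (adc_sum A B) (Suc n)) (grp (adc_sum A B) n)" for n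
    by (auto intro!: homI simp: adc_sum_simps A.bd_closed B.bd_closed A.bd_mult B.bd_mult)
  show "aug (adc_sum A B) \<in> hom (grp (adc_sum A B) 0) integer_group"
    by (auto intro!: homI simp: adc_sum_simps hom_mult[OF A.aug_hom] hom_mult[OF B.aug_hom])
  show "submonoid (pos (adc_sum A B) n) (grp (adc_sum A B) n)" for n
    by unfold_locales (auto simp: adc_sum_simps A.pos_closed B.pos_closed)
qed

end

locale pushout_complex = precomplex_pair A B + C: precomplex C
  for A :: "'a adc" and B :: "'b adc" and C :: "'c adc" +
  fixes f :: "nat \<Rightarrow> 'c \<Rightarrow> 'a" and g :: "nat \<Rightarrow> 'c \<Rightarrow> 'b"
  assumes f_hom: "f n \<in> hom (grp C n) (grp A n)"
    and f_bd: "c \<in> carrier (grp C (Suc n)) \<Longrightarrow> f n (bd C (Suc n) c) = bd A (Suc n) (f (Suc n) c)"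
    and f_aug: "c \<in> carrier (grp C 0) \<Longrightarrow> aug A (f 0 c) = aug C c"
    and g_hom: "g n \<in> hom (grp C n) (grp B n)"
    and g_bd: "c \<in> carrier (grp C (Suc n)) \<Longrightarrow> g n (bd C (Suc n) c) = bd B (Suc n) (g (Suc n) c)"
    and g_aug: "c \<in> carrier (grp C 0) \<Longrightarrow> aug B (g 0 c) = aug C c"
begin

abbreviation "S \<equiv> adc_sum A B"
abbreviation "N n \<equiv> pushout_rels C f g B n"
abbreviation "P \<equiv> pushout C f g A B"

sublocale S: precomplex S by (rule precomplex_sum)

definition q where "q n z = N n #>\<^bsub>grp S n\<^esub> z"

lemma f_closed: "c \<in> carrier (grp C n) \<Longrightarrow> f n c \<in> carrier (grp A n)"
  by (rule hom_in_carrier[OF f_hom])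

lemma g_closed: "c \<in> carrier (grp C n) \<Longrightarrow> g n c \<in> carrier (grp B n)"
  by (rule hom_in_carrier[OF g_hom])

lemma subgroup_N: "subgroup (N n) (grp S n)"
proof -
  have "(\<lambda>c. (f n c, inv\<^bsub>grp B n\<^esub> g n c)) \<in> hom (grp C n) (grp S n)"
    unfolding adc_sum_simps
    by (intro hom_Pair_fun hom_inv_fun f_hom g_hom B.grp_comm C.G.is_group)
  then have "group_hom (grp C n) (grp S n) (\<lambda>c. (f n c, inv\<^bsub>grp B n\<^esub> g n c))"
    by (simp add: group_hom_def group_hom_axioms_def C.G.is_group S.G.is_group)
  then show ?thesis
    unfolding pushout_rels_def by (rule group_hom.img_is_subgroup)
qed

lemma grp_P: "grp P n = grp S n Mod N n"
  by (simp add: pushout_def Let_def)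

lemma comm_P: "comm_group (grp P n)"
  unfolding grp_P by (rule comm_group.abelian_FactGroup[OF S.grp_comm subgroup_N])

lemma q_hom: "q n \<in> hom (grp S n) (grp P n)"
  unfolding q_def[abs_def] grp_P
  by (intro normal.r_coset_hom_Mod comm_group.subgroup_imp_normal S.grp_comm subgroup_N)

lemma q_surj: "X \<in> carrier (grp P n) \<Longrightarrow> \<exists>z \<in> carrier (grp S n). X = q n z"
  by (auto simp: grp_P carrier_FactGroup q_def)

lemma q_N: "k \<in> N n \<Longrightarrow> q n k = \<one>\<^bsub>grp P n\<^esub>"
  unfolding q_def grp_P using subgroup.rcos_const[OF subgroup_N S.G.is_group] by simp

text \<open>The two elements differ by \<open>(f n c, - g n c)\<close>, an element of
  \<open>N n\<close>.\<close>

lemma q_glue: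
  assumes c: "c \<in> carrier (grp C n)"
  shows "q n (f n c, \<one>\<^bsub>grp B n\<^esub>) = q n (\<one>\<^bsub>grp A n\<^esub>, g n c)"
proof -
  have k: "(f n c, inv\<^bsub>grp B n\<^esub> g n c) \<in> N n" using c by (auto simp: pushout_rels_def)
  have "(f n c, \<one>\<^bsub>grp B n\<^esub>) = (f n c, inv\<^bsub>grp B n\<^esub> g n c) \<otimes>\<^bsub>grp S n\<^esub> (\<one>\<^bsub>grp A n\<^esub>, g n c)"
    using c by (simp add: adc_sum_simps f_closed g_closed)
  moreover have "(f n c, inv\<^bsub>grp B n\<^esub> g n c) \<in> carrier (grp S n)" "(\<one>\<^bsub>grp A n\<^esub>, g n c) \<in> carrier (grp S n)"
    using c by (auto simp: adc_sum_simps f_closed g_closed)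
  ultimately show ?thesis
    using q_N[OF k] comm_P[of n] hom_in_carrier[OF q_hom]
    by (simp add: hom_mult[OF q_hom] comm_group_def comm_monoid_def monoid.l_one)
qed

text \<open>The universal property of the pushout: every element of \<open>N n\<close> is
  \<open>(f n c, 0)\<close> minus \<open>(0, g n c)\<close>, so \<open>glue\<close> says that
  \<open>s\<close> vanishes on \<open>N n\<close>.\<close>

lemma extend:
  assumes G: "comm_group G" and s: "s \<in> hom (grp S n) G"
    and glue: "\<And>c. c \<in> carrier (grp C n) \<Longrightarrow> s (f n c, \<one>\<^bsub>grp B n\<^esub>) = s (\<one>\<^bsub>grp A n\<^esub>, g n c)"
  shows "(\<lambda>X. s (SOME z. z \<in> X)) \<in> hom (grp P n) G"
    and "z \<in> carrier (grp S n) \<Longrightarrow> s (SOME w. w \<in> q n z) = s z"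
proof -
  interpret G: comm_group G by fact
  have ker: "s k = \<one>\<^bsub>G\<^esub>" if k: "k \<in> N n" for k
  proof -
    obtain c where c: "c \<in> carrier (grp C n)" "k = (f n c, inv\<^bsub>grp B n\<^esub> g n c)"
      using k by (auto simp: pushout_rels_def)
    have car: "(f n c, \<one>\<^bsub>grp B n\<^esub>) \<in> carrier (grp S n)" "(\<one>\<^bsub>grp A n\<^esub>, g n c) \<in> carrier (grp S n)"
      using c by (auto simp: adc_sum_simps f_closed g_closed)
    have "k = (f n c, \<one>\<^bsub>grp B n\<^esub>) \<otimes>\<^bsub>grp S n\<^esub> inv\<^bsub>grp S n\<^esub> (\<one>\<^bsub>grp A n\<^esub>, g n c)"
      using c by (simp add: adc_sum_simps f_closed g_closed A.G.is_group B.G.is_group)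
    then have "s k = s (f n c, \<one>\<^bsub>grp B n\<^esub>) \<otimes>\<^bsub>G\<^esub> inv\<^bsub>G\<^esub> s (\<one>\<^bsub>grp A n\<^esub>, g n c)"
      using car by (simp add: hom_mult[OF s] hom_inv_eq[OF s S.grp_comm G])
    then show ?thesis using glue[OF c(1)] hom_in_carrier[OF s car(2)] by simp
  qed
  show "(\<lambda>X. s (SOME z. z \<in> X)) \<in> hom (grp P n) G"
    unfolding grp_P by (rule coset_extend_hom[OF S.grp_comm G subgroup_N s ker])
  show "z \<in> carrier (grp S n) \<Longrightarrow> s (SOME w. w \<in> q n z) = s z"
    unfolding q_def by (rule coset_some[OF S.grp_comm G subgroup_N s ker])
qed

lemma bd_P_hom: "bd P (Suc n) \<in> hom (grp P (Suc n)) (grp P n)"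
  and bd_P: "z \<in> carrier (grp S (Suc n)) \<Longrightarrow> bd P (Suc n) (q (Suc n) z) = q n (bd S (Suc n) z)"
proof -
  have bd: "bd P (Suc n) X = q n (bd S (Suc n) (SOME z. z \<in> X))" for X
    by (simp add: pushout_def Let_def q_def)
  have s: "(\<lambda>z. q n (bd S (Suc n) z)) \<in> hom (grp S (Suc n)) (grp P n)"
    by (rule hom_comp[OF S.bd_hom q_hom])
  \<comment> \<open>Boundaries of identified chains are identified again, by \<open>q_glue\<close>
    for the boundary of \<open>c\<close>.\<close>
  have glue: "q n (bd S (Suc n) (f (Suc n) c, \<one>\<^bsub>grp B (Suc n)\<^esub>)) = q n (bd S (Suc n) (\<one>\<^bsub>grp A (Suc n)\<^esub>, g (Suc n) c))"
    if "c \<in> carrier (grp C (Suc n))" for c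
    using q_glue[OF C.bd_closed[OF that]]
    by (simp add: adc_sum_simps A.bd_one B.bd_one f_bd g_bd that)
  show "bd P (Suc n) \<in> hom (grp P (Suc n)) (grp P n)"
    unfolding bd[abs_def] by (rule extend[OF comm_P s glue])
  show "z \<in> carrier (grp S (Suc n)) \<Longrightarrow> bd P (Suc n) (q (Suc n) z) = q n (bd S (Suc n) z)"
    unfolding bd by (rule extend(2)[OF comm_P s glue])
qed

lemma aug_P_hom: "aug P \<in> hom (grp P 0) integer_group"
  and aug_P: "z \<in> carrier (grp S 0) \<Longrightarrow> aug P (q 0 z) = aug S z"
proof -
  have aug: "aug P X = aug S (SOME z. z \<in> X)" for X
    by (simp add: pushout_def Let_def)
  have glue: "aug S (f 0 c, \<one>\<^bsub>grp B 0\<^esub>) = aug S (\<one>\<^bsub>grp A 0\<^esub>, g 0 c)" if "c \<in> carrier (grp C 0)" for c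
    using that hom_one_eq[OF A.aug_hom A.grp_comm abelian_integer_group]
      hom_one_eq[OF B.aug_hom B.grp_comm abelian_integer_group]
    by (simp add: adc_sum_simps f_aug g_aug)
  show "aug P \<in> hom (grp P 0) integer_group"
    unfolding aug[abs_def] by (rule extend[OF abelian_integer_group S.aug_hom glue])
  show "z \<in> carrier (grp S 0) \<Longrightarrow> aug P (q 0 z) = aug S z"
    unfolding aug by (rule extend(2)[OF abelian_integer_group S.aug_hom glue])
qed

lemma pos_P: "pos P n = q n ` pos S n"
  by (simp add: pushout_def Let_def q_def)

lemma precomplex_P: "precomplex P"
proof (rule precomplex.intro[OF comm_P bd_P_hom aug_P_hom])
  fix n
  show "submonoid (pos P n) (grp P n)"
  proof
    show "pos P n \<subseteq> carrier (grp P n)"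
      by (auto simp: pos_P intro!: hom_in_carrier[OF q_hom] S.pos_closed)
    show "x \<otimes>\<^bsub>grp P n\<^esub> y \<in> pos P n" if "x \<in> pos P n" "y \<in> pos P n" for x y
    proof -
      obtain v w where "v \<in> pos S n" "w \<in> pos S n" "x = q n v" "y = q n w"
        using \<open>x \<in> pos P n\<close> \<open>y \<in> pos P n\<close> by (auto simp: pos_P)
      then show ?thesis
        by (auto simp: pos_P hom_mult[OF q_hom, symmetric] S.pos_closed intro!: imageI S.M.m_closed)
    qed
    show "\<one>\<^bsub>grp P n\<^esub> \<in> pos P n"
      unfolding pos_P using hom_one_eq[OF q_hom S.grp_comm comm_P] S.M.one_closed
      by (metis imageI)
  qed
qed

end

section \<open>The join with a point\<close>

interpretation point: strict_omega_category point
  by (rule strict_omega_category_point)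

interpretation arrow_boundary: strict_omega_category arrow_boundary
  by (rule strict_omega_category_arrow_boundary)

interpretation lam_point: precomplex "lam point"
  by (rule point.precomplex_lam)

definition pt :: "(unit \<Rightarrow>\<^sub>0 int) set"
  where "pt = lam_class point 0 ()"

lemma pt_closed: "pt \<in> carrier (grp (lam point) 0)"
  by (simp add: pt_def lam_class_closed qcells_point)

lemma pt_pos: "pt \<in> pos (lam point) 0"
  by (simp add: pt_def lam_class_pos qcells_point)

lemma aug_pt: "aug (lam point) pt = 1"
  by (simp add: pt_def point.aug_lam_class qcells_point)

lemma lam_point_high: "lam_class point (Suc n) () = \<one>\<^bsub>grp (lam point) (Suc n)\<^esub>"
  by (rule point.lam_class_degenerate[of _ 0]) (auto simp: qcells_point)

text \<open>Above degree 0 the only generator is degenerate, so two homomorphisms can differ only at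
  \<open>pt\<close>.\<close>

lemma lam_point_hom_eq:
  assumes "comm_group G" "f \<in> hom (grp (lam point) n) G" "g \<in> hom (grp (lam point) n) G"
    and "n = 0 \<Longrightarrow> f pt = g pt" and "a \<in> carrier (grp (lam point) n)"
  shows "f a = g a"
proof (rule point.lam_hom_eq[OF assms(1-3) _ assms(5)])
  fix x
  show "f (lam_class point n x) = g (lam_class point n x)"
    using assms(4) hom_one_eq[OF assms(2) lam_point.grp_comm assms(1)]
      hom_one_eq[OF assms(3) lam_point.grp_comm assms(1)]
    by (cases n) (simp_all add: pt_def lam_point_high)
qed

section \<open>Tensoring with the point\<close>

locale point_tensor = Y: precomplex Y for Y :: "'b adc"
begin

sublocale T: lam_tensor point Y
  by (intro lam_tensor.intro strict_omega_category_point Y.precomplex_axioms)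

sublocale PY: precomplex "tensor (lam point) Y" by (rule T.precomplex_tensor)

definition \<iota> where "\<iota> n = T.V n ()"

lemma \<iota>_eq: "\<iota> n y = tensor_class (lam point) Y n (0, pt, y)"
  by (simp add: \<iota>_def T.V_def pt_def)

lemma \<iota>_hom: "\<iota> n \<in> hom (grp Y n) (grp (tensor (lam point) Y) n)"
  unfolding \<iota>_def by (rule T.V_hom) (simp add: qcells_point)

lemma \<iota>_closed: "y \<in> carrier (grp Y n) \<Longrightarrow> \<iota> n y \<in> carrier (grp (tensor (lam point) Y) n)"
  by (rule hom_in_carrier[OF \<iota>_hom])

lemma \<iota>_pos: "y \<in> pos Y n \<Longrightarrow> \<iota> n y \<in> pos (tensor (lam point) Y) n"
  unfolding \<iota>_def by (rule T.V_pos) (simp_all add: qcells_point)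

lemma aug_\<iota>: "y \<in> carrier (grp Y 0) \<Longrightarrow> aug (tensor (lam point) Y) (\<iota> 0 y) = aug Y y"
  unfolding \<iota>_def by (rule T.aug_V) (simp_all add: qcells_point)

lemma bd_\<iota>: "y \<in> carrier (grp Y (Suc n)) \<Longrightarrow>
    bd (tensor (lam point) Y) (Suc n) (\<iota> (Suc n) y) = \<iota> n (bd Y (Suc n) y)"
  unfolding \<iota>_def by (rule T.bd_V) (simp_all add: qcells_point)

lemma hom_eq:
  assumes "comm_group G" "f \<in> hom (grp (tensor (lam point) Y) n) G" "g \<in> hom (grp (tensor (lam point) Y) n) G"
    and "\<And>y. y \<in> carrier (grp Y n) \<Longrightarrow> f (\<iota> n y) = g (\<iota> n y)"
    and "t \<in> carrier (grp (tensor (lam point) Y) n)"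
  shows "f t = g t"
proof (rule T.hom_eq[OF assms(1-3) _ assms(5)])
  fix p x y assume "x \<in> qcells point p" "\<And>q. q < p \<Longrightarrow> x \<notin> qcells point q" "y \<in> carrier (grp Y (n - p))"
  then show "f (tensor_class (lam point) Y n (p, lam_class point p x, y)) =
      g (tensor_class (lam point) Y n (p, lam_class point p x, y))"
    using assms(4)[of y] by (cases p) (auto simp: \<iota>_eq pt_def qcells_point)
qed

lemma hull_subset:
  assumes "comm_group G" "f \<in> hom (grp (tensor (lam point) Y) n) G" "submonoid M G"
    and "\<And>y. y \<in> pos Y n \<Longrightarrow> f (\<iota> n y) \<in> M"
    and "t \<in> pos (tensor (lam point) Y) n"
  shows "f t \<in> M"
proof (rule T.hull_subset[OF assms(1-3) _ assms(5)])
  fix p x y assume "x \<in> qcells point p" "\<And>q. q < p \<Longrightarrow> x \<notin> qcells point q" "y \<in> pos Y (n - p)"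
  then show "f (tensor_class (lam point) Y n (p, lam_class point p x, y)) \<in> M"
    using assms(4)[of y] by (cases p) (auto simp: \<iota>_eq pt_def qcells_point)
qed

text \<open>The left unitor, sending \<open>a \<otimes> y\<close> to \<open>aug a\<close> times
  \<open>y\<close>. It strips off the factor \<open>lam point\<close> that the definition of the
  join carries.\<close>

definition unitor where
  "unitor n = pextend (grp Y n) (\<lambda>(p, a, y). if p = 0 then y [^]\<^bsub>grp Y n\<^esub> aug (lam point) a else \<one>\<^bsub>grp Y n\<^esub>)"

lemma unitor_hom: "unitor n \<in> hom (grp (tensor (lam point) Y) n) (grp Y n)"
  and unitor_\<iota>: "y \<in> carrier (grp Y n) \<Longrightarrow> unitor n (\<iota> n y) = y"
proof -
  let ?\<phi> = "\<lambda>(p :: nat, a, y). if p = 0 then y [^]\<^bsub>grp Y n\<^esub> aug (lam point) a else \<one>\<^bsub>grp Y n\<^esub>"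
  have left: "(\<lambda>a. ?\<phi> (p, a, y)) \<in> hom (grp (lam point) p) (grp Y n)"
    if "p \<le> n" "y \<in> carrier (grp Y (n - p))" for p y
    using that by (cases p)
      (simp_all add: hom_pow_exponent Y.G.is_group lam_point.aug_hom hom_one_fun[OF Y.grp_comm])
  have right: "(\<lambda>y. ?\<phi> (p, a, y)) \<in> hom (grp Y (n - p)) (grp Y n)"
    if "p \<le> n" "a \<in> carrier (grp (lam point) p)" for p a
    by (cases p) (simp_all add: hom_pow_fun[OF Y.grp_comm hom_id] hom_one_fun[OF Y.grp_comm])
  show "unitor n \<in> hom (grp (tensor (lam point) Y) n) (grp Y n)"
    unfolding unitor_def by (rule T.tensor_extend[OF Y.grp_comm left right])
  show "unitor n (\<iota> n y) = y" if "y \<in> carrier (grp Y n)"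
    unfolding unitor_def \<iota>_eq using that
    by (subst T.tensor_extend(2)[OF Y.grp_comm left right]) (auto simp: pt_closed aug_pt Y.G.int_pow_1)
qed

lemma unitor_bd:
  assumes t: "t \<in> carrier (grp (tensor (lam point) Y) (Suc n))"
  shows "unitor n (bd (tensor (lam point) Y) (Suc n) t) = bd Y (Suc n) (unitor (Suc n) t)"
  by (rule hom_eq[OF Y.grp_comm hom_comp[OF PY.bd_hom unitor_hom] hom_comp[OF unitor_hom Y.bd_hom] _ t])
    (simp add: bd_\<iota> unitor_\<iota> Y.bd_closed)

lemma unitor_aug:
  assumes t: "t \<in> carrier (grp (tensor (lam point) Y) 0)"
  shows "aug Y (unitor 0 t) = aug (tensor (lam point) Y) t"
  by (rule hom_eq[OF abelian_integer_group hom_comp[OF unitor_hom Y.aug_hom] PY.aug_hom _ t])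
    (simp add: aug_\<iota> unitor_\<iota>)

lemma unitor_pos: "t \<in> pos (tensor (lam point) Y) n \<Longrightarrow> unitor n t \<in> pos Y n"
  by (rule hull_subset[OF Y.grp_comm unitor_hom Y.pos_submonoid])
    (simp_all add: unitor_\<iota> Y.pos_closed)

end

section \<open>The join with a point as a quotient of the cylinder\<close>

locale cone_join = cylinder B for B :: "'b adc" +
  assumes aug_bd: "x \<in> carrier (grp B (Suc 0)) \<Longrightarrow> aug B (bd B (Suc 0) x) = 0"
begin

abbreviation "Y \<equiv> tensor (lam arrow_boundary) B"
abbreviation "L \<equiv> grp (lam point)"
abbreviation "UX \<equiv> tensor (lam point) X"
abbreviation "UY \<equiv> tensor (lam point) Y"
abbreviation "Q \<equiv> adc_sum (lam point) B"

sublocale TY: lam_tensor arrow_boundary B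
  by (intro lam_tensor.intro strict_omega_category_arrow_boundary B.precomplex_axioms)

sublocale Y: precomplex Y by (rule TY.precomplex_tensor)

sublocale PX: point_tensor X by (intro point_tensor.intro X.precomplex_axioms)

sublocale PY: point_tensor Y by (intro point_tensor.intro Y.precomplex_axioms)

sublocale PB: precomplex_pair "lam point" B
  by (intro precomplex_pair.intro lam_point.precomplex_axioms B.precomplex_axioms)

sublocale Q: precomplex Q by (rule PB.precomplex_sum)

definition D where "D n e = TY.V n (e, e)"

lemma diagonal_boundary: "(e, e) \<in> qcells arrow_boundary n"
  by (cases e) (auto simp: qcells_arrow_boundary)

lemma D_hom: "D n e \<in> hom (grp B n) (grp Y n)"
  unfolding D_def by (rule TY.V_hom[OF diagonal_boundary])

lemma D_closed: "b \<in> carrier (grp B n) \<Longrightarrow> D n e b \<in> carrier (grp Y n)"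
  by (rule hom_in_carrier[OF D_hom])

lemma aug_D: "b \<in> carrier (grp B 0) \<Longrightarrow> aug Y (D 0 e b) = aug B b"
  unfolding D_def by (rule TY.aug_V[OF diagonal_boundary])

lemma bd_D: "b \<in> carrier (grp B (Suc n)) \<Longrightarrow> bd Y (Suc n) (D (Suc n) e b) = D n e (bd B (Suc n) b)"
  unfolding D_def by (rule TY.bd_V[OF diagonal_boundary])

lemma D_eq: "D n e b = tensor_class (lam arrow_boundary) B n (0, lam_class arrow_boundary 0 (e, e), b)"
  by (simp add: D_def TY.V_def)

lemma PY_hom_eq:
  assumes G: "comm_group G" and f: "f \<in> hom (grp UY n) G"
    and g: "g \<in> hom (grp UY n) G"
    and eq: "\<And>e b. b \<in> carrier (grp B n) \<Longrightarrow> f (PY.\<iota> n (D n e b)) = g (PY.\<iota> n (D n e b))"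
    and t: "t \<in> carrier (grp UY n)"
  shows "f t = g t"
proof (rule PY.hom_eq[OF G f g _ t])
  fix y assume y: "y \<in> carrier (grp Y n)"
  show "f (PY.\<iota> n y) = g (PY.\<iota> n y)"
  proof (rule TY.hom_eq[OF G hom_comp[OF PY.\<iota>_hom f] hom_comp[OF PY.\<iota>_hom g] _ y])
    fix p x b assume x: "x \<in> qcells arrow_boundary p" "\<And>q. q < p \<Longrightarrow> x \<notin> qcells arrow_boundary q"
      and b: "b \<in> carrier (grp B (n - p))"
    then have "p = 0" by (cases p) (auto simp: qcells_arrow_boundary)
    moreover obtain e where "x = (e, e)" using x by (auto simp: qcells_arrow_boundary)
    ultimately show "f (PY.\<iota> n (tensor_class (lam arrow_boundary) B n (p, lam_class arrow_boundary p x, b))) =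
        g (PY.\<iota> n (tensor_class (lam arrow_boundary) B n (p, lam_class arrow_boundary p x, b)))"
      using eq[of b e] b by (simp add: D_eq)
  qed
qed

definition incl where
  "incl = tensor_map (lam_map id arrow) (\<lambda>_ b. b) (lam arrow) B"

lemma incl_map: "adc_map Y X incl"
  and incl_D: "b \<in> carrier (grp B n) \<Longrightarrow> incl n (D n e b) = E n e b"
proof -
  have id: "strict_functor arrow_boundary arrow id"
    by (auto simp: strict_functor_def arrow_boundary_def arrow_def composable_def)
  note l = adc_map_lam_map[OF strict_omega_category_arrow_boundary strict_omega_category_arrow id]
  note t = adc_map_tensor_map[OF TY.precomplex_pair_axioms T.precomplex_pair_axioms l(1) adc_map_id]
  show "adc_map Y X incl" unfolding incl_def by (rule t)
  show "b \<in> carrier (grp B n) \<Longrightarrow> incl n (D n e b) = E n e b"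
    unfolding incl_def D_eq E_eq
    by (subst t(2)) (auto simp: lam_class_closed diagonal_boundary l(2) vertex_def)
qed

definition glue_left where
  "glue_left = tensor_map (\<lambda>_ a. a) incl (lam point) X"

lemma glue_left_map: "adc_map UY UX glue_left"
  and glue_left_\<iota>: "y \<in> carrier (grp Y n) \<Longrightarrow> glue_left n (PY.\<iota> n y) = PX.\<iota> n (incl n y)"
proof -
  note t = adc_map_tensor_map[OF PY.T.precomplex_pair_axioms PX.T.precomplex_pair_axioms adc_map_id incl_map]
  show "adc_map UY UX glue_left"
    unfolding glue_left_def by (rule t)
  show "y \<in> carrier (grp Y n) \<Longrightarrow> glue_left n (PY.\<iota> n y) = PX.\<iota> n (incl n y)"
    unfolding glue_left_def PY.\<iota>_eq PX.\<iota>_eq by (subst t(2)) (auto simp: pt_closed)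
qed

text \<open>\<open>end0\<close> and \<open>end1\<close> name the two inner \<open>pextend\<close>
  terms of \<open>join_ends\<close>, so that homomorphy can be shown from the inside out.
  \<open>end0\<close> is evaluated in degree 0 only: \<open>join_ends\<close> uses it when the left
  factor takes up the whole degree.\<close>

definition end0 where
  "end0 = pextend integer_group (\<lambda>(k :: nat, x, b). end_coeff False x * aug B b)"

definition end1 where
  "end1 n = pextend (grp B n)
     (\<lambda>(k :: nat, x, b). if k = 0 then b [^]\<^bsub>grp B n\<^esub> end_coeff True x else \<one>\<^bsub>grp B n\<^esub>)"

lemma end_coeff_boundary:
  "end_coeff e \<in> hom (grp (lam arrow_boundary) 0) integer_group"
  "end_coeff e (lam_class arrow_boundary 0 (e', e')) = (if e = e' then 1 else 0)"
  using end_coeff[OF strict_omega_category_arrow_boundary, where e = e] diagonal_boundary[of e' 0] by auto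

lemma end0_hom: "end0 \<in> hom (grp Y 0) integer_group"
  and end0_D: "b \<in> carrier (grp B 0) \<Longrightarrow> end0 (D 0 e b) = (if e then 0 else aug B b)"
proof -
  let ?\<phi> = "\<lambda>(k :: nat, x, b). end_coeff False x * aug B b"
  have left: "(\<lambda>x. ?\<phi> (p, x, b)) \<in> hom (grp (lam arrow_boundary) p) integer_group"
    if "p \<le> 0" "b \<in> carrier (grp B (0 - p))" for p b
    using that hom_mult[OF end_coeff_boundary(1)] by (auto intro!: homI simp: algebra_simps)
  have right: "(\<lambda>b. ?\<phi> (p, x, b)) \<in> hom (grp B (0 - p)) integer_group"
    if "p \<le> 0" "x \<in> carrier (grp (lam arrow_boundary) p)" for p x
    using that hom_mult[OF B.aug_hom] by (auto intro!: homI simp: algebra_simps)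
  show "end0 \<in> hom (grp Y 0) integer_group"
    unfolding end0_def by (rule TY.tensor_extend[OF abelian_integer_group left right])
  show "end0 (D 0 e b) = (if e then 0 else aug B b)" if "b \<in> carrier (grp B 0)"
    unfolding end0_def D_eq using that
    by (subst TY.tensor_extend(2)[OF abelian_integer_group left right])
      (auto simp: lam_class_closed diagonal_boundary end_coeff_boundary(2))
qed

lemma end1_hom: "end1 n \<in> hom (grp Y n) (grp B n)"
  and end1_D: "b \<in> carrier (grp B n) \<Longrightarrow> end1 n (D n e b) = (if e then b else \<one>\<^bsub>grp B n\<^esub>)"
proof -
  let ?\<phi> = "\<lambda>(k :: nat, x, b). if k = 0 then b [^]\<^bsub>grp B n\<^esub> end_coeff True x else \<one>\<^bsub>grp B n\<^esub>"
  have left: "(\<lambda>x. ?\<phi> (p, x, b)) \<in> hom (grp (lam arrow_boundary) p) (grp B n)"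
    if "p \<le> n" "b \<in> carrier (grp B (n - p))" for p b
    using that by (cases p)
      (simp_all add: hom_pow_exponent B.G.is_group end_coeff_boundary hom_one_fun[OF B.grp_comm])
  have right: "(\<lambda>b. ?\<phi> (p, x, b)) \<in> hom (grp B (n - p)) (grp B n)"
    if "p \<le> n" "x \<in> carrier (grp (lam arrow_boundary) p)" for p x
    by (cases p) (simp_all add: hom_pow_fun[OF B.grp_comm hom_id] hom_one_fun[OF B.grp_comm])
  show "end1 n \<in> hom (grp Y n) (grp B n)"
    unfolding end1_def by (rule TY.tensor_extend[OF B.grp_comm left right])
  show "end1 n (D n e b) = (if e then b else \<one>\<^bsub>grp B n\<^esub>)" if "b \<in> carrier (grp B n)"
    unfolding end1_def D_eq using that
    by (subst TY.tensor_extend(2)[OF B.grp_comm left right])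
      (auto simp: lam_class_closed diagonal_boundary end_coeff_boundary(2) B.G.int_pow_1)
qed

abbreviation "glue_right \<equiv> join_ends (lam point) B"

definition pts :: "nat \<Rightarrow> int \<Rightarrow> (unit \<Rightarrow>\<^sub>0 int) set"
  where "pts n k = (if n = 0 then pt [^]\<^bsub>L n\<^esub> k else \<one>\<^bsub>L n\<^esub>)"

lemma pts_closed: "pts n k \<in> carrier (L n)"
  by (auto simp: pts_def pt_closed)

lemma aug_pts: "aug (lam point) (pts 0 k) = k"
  by (simp add: pts_def hom_pow_eq[OF lam_point.aug_hom lam_point.grp_comm abelian_integer_group] pt_closed aug_pt)

lemma glue_right_hom: "glue_right n \<in> hom (grp UY n) (grp Q n)"
  and glue_right_\<iota>: "b \<in> carrier (grp B n) \<Longrightarrow> glue_right n (PY.\<iota> n (D n e b)) =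
    (if e then \<one>\<^bsub>L n\<^esub> else pts n (aug B b), if e then b else \<one>\<^bsub>grp B n\<^esub>)"
proof -
  let ?L = "L n"
  let ?\<phi> = "\<lambda>(p, a, y). (if p = n then a [^]\<^bsub>?L\<^esub> end0 y else \<one>\<^bsub>?L\<^esub>,
      if p = 0 then end1 n y [^]\<^bsub>grp B n\<^esub> aug (lam point) a else \<one>\<^bsub>grp B n\<^esub>)"
  have j: "glue_right n = pextend (grp Q n) ?\<phi>"
    by (simp add: join_ends_def end0_def end1_def cong: if_cong)
  have e1: "end1 n y \<in> carrier (grp B n)" if "y \<in> carrier (grp Y n)" for y
    by (rule hom_in_carrier[OF end1_hom that])
  have left: "(\<lambda>a. ?\<phi> (p, a, y)) \<in> hom (L p) (grp Q n)"
    if "p \<le> n" "y \<in> carrier (grp Y (n - p))" for p y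
    unfolding PB.adc_sum_simps split
  proof (rule hom_Pair_fun)
    show "(\<lambda>a. if p = n then a [^]\<^bsub>?L\<^esub> end0 y else \<one>\<^bsub>?L\<^esub>) \<in> hom (L p) ?L"
      by (cases "p = n") (simp_all add: hom_pow_fun[OF lam_point.grp_comm hom_id] hom_one_fun[OF lam_point.grp_comm])
    show "(\<lambda>a. if p = 0 then end1 n y [^]\<^bsub>grp B n\<^esub> aug (lam point) a else \<one>\<^bsub>grp B n\<^esub>) \<in> hom (L p) (grp B n)"
      using that
      by (cases "p = 0") (simp_all add: hom_pow_exponent B.G.is_group lam_point.aug_hom e1 hom_one_fun[OF B.grp_comm])
  qed
  have right: "(\<lambda>y. ?\<phi> (p, a, y)) \<in> hom (grp Y (n - p)) (grp Q n)"
    if "p \<le> n" "a \<in> carrier (L p)" for p a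
    unfolding PB.adc_sum_simps split
  proof (rule hom_Pair_fun)
    show "(\<lambda>y. if p = n then a [^]\<^bsub>?L\<^esub> end0 y else \<one>\<^bsub>?L\<^esub>) \<in> hom (grp Y (n - p)) ?L"
      using that
      by (cases "p = n") (simp_all add: hom_pow_exponent lam_point.G.is_group end0_hom hom_one_fun[OF lam_point.grp_comm])
    show "(\<lambda>y. if p = 0 then end1 n y [^]\<^bsub>grp B n\<^esub> aug (lam point) a else \<one>\<^bsub>grp B n\<^esub>) \<in> hom (grp Y (n - p)) (grp B n)"
      by (cases "p = 0") (simp_all add: hom_pow_fun[OF B.grp_comm end1_hom] hom_one_fun[OF B.grp_comm])
  qed
  show "glue_right n \<in> hom (grp UY n) (grp Q n)"
    unfolding j by (rule PY.T.tensor_extend[OF Q.grp_comm left right])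
  show "glue_right n (PY.\<iota> n (D n e b)) =
    (if e then \<one>\<^bsub>?L\<^esub> else pts n (aug B b), if e then b else \<one>\<^bsub>grp B n\<^esub>)" if "b \<in> carrier (grp B n)"
    unfolding j PY.\<iota>_eq using that
    by (subst PY.T.tensor_extend(2)[OF Q.grp_comm left right])
      (auto simp: pt_closed D_closed end0_D end1_D aug_pt pts_def B.G.int_pow_1)
qed

lemma glue_right_bd:
  assumes t: "t \<in> carrier (grp UY (Suc n))"
  shows "glue_right n (bd UY (Suc n) t) = bd Q (Suc n) (glue_right (Suc n) t)"
proof (rule PY_hom_eq[OF Q.grp_comm hom_comp[OF PY.PY.bd_hom glue_right_hom] hom_comp[OF glue_right_hom Q.bd_hom] _ t])
  fix e x assume x: "x \<in> carrier (grp B (Suc n))"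
  \<comment> \<open>For \<open>n = 0\<close> this is \<open>aug_bd\<close>: the 0-end collapses to
    augmentation times the cone point, which must vanish on boundaries for the collapse to be a
    chain map.\<close>
  have "pts n (aug B (bd B (Suc n) x)) = \<one>\<^bsub>L n\<^esub>"
    using x by (cases n) (auto simp: pts_def aug_bd)
  then show "glue_right n (bd UY (Suc n) (PY.\<iota> (Suc n) (D (Suc n) e x))) =
      bd Q (Suc n) (glue_right (Suc n) (PY.\<iota> (Suc n) (D (Suc n) e x)))"
    using x by (simp add: PY.bd_\<iota> D_closed bd_D glue_right_\<iota> B.bd_closed PB.adc_sum_simps
        lam_point.bd_one B.bd_one) (simp add: pts_def lam_point.bd_one)
qed

lemma glue_right_aug:
  assumes t: "t \<in> carrier (grp UY 0)"
  shows "aug Q (glue_right 0 t) = aug UY t"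
proof (rule PY_hom_eq[OF abelian_integer_group hom_comp[OF glue_right_hom Q.aug_hom] PY.PY.aug_hom _ t])
  fix e x assume x: "x \<in> carrier (grp B 0)"
  then show "aug Q (glue_right 0 (PY.\<iota> 0 (D 0 e x))) = aug UY (PY.\<iota> 0 (D 0 e x))"
    using hom_one_eq[OF B.aug_hom B.grp_comm abelian_integer_group]
      hom_one_eq[OF lam_point.aug_hom lam_point.grp_comm abelian_integer_group]
    by (simp add: glue_right_\<iota> PY.aug_\<iota> D_closed aug_D PB.adc_sum_simps aug_pts)
qed

sublocale J: pushout_complex UX Q UY glue_left glue_right
  using adc_mapD(1-3)[OF glue_left_map] glue_right_hom glue_right_bd glue_right_aug
  by (intro pushout_complex.intro precomplex_pair.intro pushout_complex_axioms.intro
      PX.PY.precomplex_axioms PY.PY.precomplex_axioms Q.precomplex_axioms)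

lemma adc_join_eq: "adc_join (lam point) B = J.P"
  by (simp add: adc_join_def glue_left_def incl_def)

definition \<rho> where "\<rho> n x = J.q n (PX.\<iota> n x, \<one>\<^bsub>grp Q n\<^esub>)"

lemma \<rho>_hom: "\<rho> n \<in> hom (grp X n) (grp J.P n)"
proof -
  have "(\<lambda>x. (PX.\<iota> n x, \<one>\<^bsub>grp Q n\<^esub>)) \<in> hom (grp X n) (grp J.S n)"
    unfolding J.adc_sum_simps by (intro hom_Pair_fun PX.\<iota>_hom hom_one_fun Q.grp_comm)
  from hom_comp[OF this J.q_hom] show ?thesis by (simp add: \<rho>_def[abs_def])
qed

lemma \<rho>_map: "adc_map X J.P \<rho>"
  unfolding adc_map_def
proof (intro conjI allI ballI \<rho>_hom)
  fix n x assume "x \<in> carrier (grp X (Suc n))"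
  then show "\<rho> n (bd X (Suc n) x) = bd J.P (Suc n) (\<rho> (Suc n) x)"
    unfolding \<rho>_def by (subst J.bd_P) (simp_all add: J.adc_sum_simps PX.\<iota>_closed PX.bd_\<iota> Q.bd_one)
next
  fix x assume "x \<in> carrier (grp X 0)"
  then show "aug J.P (\<rho> 0 x) = aug X x"
    unfolding \<rho>_def using hom_one_eq[OF Q.aug_hom Q.grp_comm abelian_integer_group]
    by (subst J.aug_P) (simp_all add: J.adc_sum_simps PX.\<iota>_closed PX.aug_\<iota>)
next
  fix n show "\<rho> n ` pos X n \<subseteq> pos J.P n"
    by (auto simp: \<rho>_def J.pos_P J.adc_sum_simps intro!: imageI PX.\<iota>_pos)
qed

text \<open>Both ends of the cylinder come from the boundary cylinder, so \<open>J.q_glue\<close>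
  moves them to the second summand of the pushout.\<close>

lemma \<rho>_E:
  assumes b: "b \<in> carrier (grp B n)"
  shows "\<rho> n (E n e b) = J.q n (\<one>\<^bsub>grp UX n\<^esub>,
      if e then \<one>\<^bsub>L n\<^esub> else pts n (aug B b), if e then b else \<one>\<^bsub>grp B n\<^esub>)"
  using J.q_glue[OF PY.\<iota>_closed[OF D_closed[OF b]], of e] b
  by (simp add: \<rho>_def glue_left_\<iota> D_closed incl_D glue_right_\<iota> PB.adc_sum_simps)

end

locale contracted_join = cone_join B + contracted_cylinder B b h
  for B :: "'b adc" and b :: 'b and h :: "nat \<Rightarrow> 'b \<Rightarrow> 'b"
begin

text \<open>
  \<open>\<sigma>\<close> is the idempotent on the cylinder obtained by composing the projection \<open>\<rho>\<close> to the join with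
  its section \<open>\<tau>\<close>; it is also the restriction of \<open>\<tau>\<close> to the first summand of the pushout.
\<close>

definition \<sigma> where
  "\<sigma> n = cylinder_lift (grp X n)
    (\<lambda>e x. if e then E n True x else if n = 0 then E n False b [^]\<^bsub>grp X n\<^esub> aug B x else \<one>\<^bsub>grp X n\<^esub>)
    (\<lambda>x. J (n - 1) x \<otimes>\<^bsub>grp X n\<^esub> E n False (h (n - 1) x))"

lemma \<sigma>_hom: "\<sigma> n \<in> hom (grp X n) (grp X n)"
  and \<sigma>_E: "x \<in> carrier (grp B n) \<Longrightarrow> \<sigma> n (E n e x) =
    (if e then E n True x else if n = 0 then E n False b [^]\<^bsub>grp X n\<^esub> aug B x else \<one>\<^bsub>grp X n\<^esub>)"
  and \<sigma>_J: "y \<in> carrier (grp B m) \<Longrightarrow>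
    \<sigma> (Suc m) (J m y) = J m y \<otimes>\<^bsub>grp X (Suc m)\<^esub> E (Suc m) False (h m y)"
proof -
  have f: "(\<lambda>x. if e then E n True x else if n = 0 then E n False b [^]\<^bsub>grp X n\<^esub> aug B x else \<one>\<^bsub>grp X n\<^esub>)
    \<in> hom (grp B n) (grp X n)" for n e
    by (cases e; cases "n = 0")
      (simp_all add: E_hom hom_pow_exponent X.G.is_group B.aug_hom E_closed base_closed hom_one_fun[OF X.grp_comm])
  have g: "(\<lambda>x. J (n - 1) x \<otimes>\<^bsub>grp X n\<^esub> E n False (h (n - 1) x)) \<in> hom (grp B m) (grp X n)"
    if "n = Suc m" for n m
    unfolding that by (simp add: hom_mult_fun[OF X.grp_comm J_hom Eh_hom])
  note m = cylinder_lift[OF X.grp_comm f g]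
  show "\<sigma> n \<in> hom (grp X n) (grp X n)" unfolding \<sigma>_def by (rule m)
  show "x \<in> carrier (grp B n) \<Longrightarrow> \<sigma> n (E n e x) =
    (if e then E n True x else if n = 0 then E n False b [^]\<^bsub>grp X n\<^esub> aug B x else \<one>\<^bsub>grp X n\<^esub>)"
    unfolding \<sigma>_def by (rule m)
  show "y \<in> carrier (grp B m) \<Longrightarrow>
    \<sigma> (Suc m) (J m y) = J m y \<otimes>\<^bsub>grp X (Suc m)\<^esub> E (Suc m) False (h m y)"
    unfolding \<sigma>_def by (subst m(3)[OF _ refl]) simp_all
qed

lemma \<sigma>_closed: "x \<in> carrier (grp X n) \<Longrightarrow> \<sigma> n x \<in> carrier (grp X n)"
  by (rule hom_in_carrier[OF \<sigma>_hom])

text \<open>On the 0-end this rests on \<open>aug_bd\<close>, since \<open>aug B x\<close> times the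
  base point has to vanish on boundaries. On prisms the extra \<open>E False (h x)\<close> makes up
  for replacing the 0-end by the base point, as computed in \<open>bd_JEh_0\<close> and
  \<open>bd_JEh_Suc\<close>.\<close>

lemma \<sigma>_bd:
  assumes x: "x \<in> carrier (grp X (Suc n))"
  shows "\<sigma> n (bd X (Suc n) x) = bd X (Suc n) (\<sigma> (Suc n) x)"
proof (rule cylinder_hom_eq[OF X.grp_comm hom_comp[OF X.bd_hom \<sigma>_hom] hom_comp[OF \<sigma>_hom X.bd_hom] _ _ x])
  fix e x assume "x \<in> carrier (grp B (Suc n))"
  then show "\<sigma> n (bd X (Suc n) (E (Suc n) e x)) = bd X (Suc n) (\<sigma> (Suc n) (E (Suc n) e x))"
    by (cases n) (auto simp: bd_E \<sigma>_E B.bd_closed aug_bd X.bd_one)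
next
  fix m x assume m: "Suc n = Suc m" and x: "x \<in> carrier (grp B m)"
  note inv = hom_inv_eq[OF \<sigma>_hom X.grp_comm X.grp_comm]
  show "\<sigma> n (bd X (Suc n) (J m x)) = bd X (Suc n) (\<sigma> (Suc n) (J m x))"
  proof (cases m)
    case 0
    then show ?thesis
      using m x by (simp add: bd_J_0 \<sigma>_J bd_JEh_0 hom_mult[OF \<sigma>_hom] inv E_closed \<sigma>_E)
  next
    case (Suc k)
    then show ?thesis
      using m x by (simp add: bd_J_Suc \<sigma>_J bd_JEh_Suc hom_mult[OF \<sigma>_hom] inv E_closed \<sigma>_E J_closed B.bd_closed)
  qed
qed

lemma aug_power: "x \<in> carrier (grp X 0) \<Longrightarrow> aug X (x [^]\<^bsub>grp X 0\<^esub> (k :: int)) = k * aug X x"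
  by (simp add: hom_pow_eq[OF X.aug_hom X.grp_comm abelian_integer_group])

lemma aug_Eb: "aug X (E 0 False b) = 1"
  by (simp add: aug_E base base_closed)

lemma \<sigma>_aug:
  assumes x: "x \<in> carrier (grp X 0)"
  shows "aug X (\<sigma> 0 x) = aug X x"
  by (rule cylinder_hom_eq[OF abelian_integer_group hom_comp[OF \<sigma>_hom X.aug_hom] X.aug_hom _ _ x])
    (auto simp: \<sigma>_E aug_E aug_power aug_Eb E_closed base_closed)

text \<open>In degree 0 the element \<open>0 \<otimes> x\<close> goes to \<open>aug B x\<close>
  copies of \<open>0 \<otimes> b\<close>, a positive chain because that number is
  nonnegative.\<close>

lemma \<sigma>_pos: 
  assumes aug_pos: "\<And>x. x \<in> pos B 0 \<Longrightarrow> 0 \<le> aug B x" and x: "x \<in> pos X n"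
  shows "\<sigma> n x \<in> pos X n"
  by (rule cylinder_hull_subset[OF X.grp_comm \<sigma>_hom X.pos_submonoid _ _ x])
    (auto simp: \<sigma>_E \<sigma>_J B.pos_closed E_pos J_pos h_pos base intro!: submonoid_pow_nonneg[OF X.pos_submonoid] aug_pos)

text \<open>The section on the summand \<open>lam point\<close>: the cone point \<open>pt\<close>
  goes to \<open>0 \<otimes> b\<close>.\<close>

definition \<upsilon> where
  "\<upsilon> n a = (if n = 0 then E n False b [^]\<^bsub>grp X n\<^esub> aug (lam point) a else \<one>\<^bsub>grp X n\<^esub>)"

lemma \<upsilon>_hom: "\<upsilon> n \<in> hom (L n) (grp X n)"
  by (cases n) (simp_all add: \<upsilon>_def[abs_def] hom_pow_exponent X.G.is_group lam_point.aug_hom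
      E_closed base_closed hom_one_fun[OF X.grp_comm])

lemma \<upsilon>_closed: "a \<in> carrier (L n) \<Longrightarrow> \<upsilon> n a \<in> carrier (grp X n)"
  by (rule hom_in_carrier[OF \<upsilon>_hom])

text \<open>The section before passing to the quotient, as the sum of its restrictions to the three
  summands: the cylinder with its point factor removed, the cone point, and \<open>B\<close> placed
  at the 1-end.\<close>

definition \<theta> where
  "\<theta> n z = \<sigma> n (PX.unitor n (fst z)) \<otimes>\<^bsub>grp X n\<^esub>
    (\<upsilon> n (fst (snd z)) \<otimes>\<^bsub>grp X n\<^esub> E n True (snd (snd z)))"

lemma J_S_carrier: "(t, a, c) \<in> carrier (grp J.S n) \<longleftrightarrow>
    t \<in> carrier (grp UX n) \<and> a \<in> carrier (L n) \<and> c \<in> carrier (grp B n)"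
  by (simp add: J.adc_sum_simps PB.adc_sum_simps)

lemma unitor_closed: "t \<in> carrier (grp UX n) \<Longrightarrow> PX.unitor n t \<in> carrier (grp X n)"
  by (rule hom_in_carrier[OF PX.unitor_hom])

lemma \<theta>_hom: "\<theta> n \<in> hom (grp J.S n) (grp X n)"
proof -
  have 1: "fst \<in> hom (grp J.S n) (grp UX n)"
    "(\<lambda>z. fst (snd z)) \<in> hom (grp J.S n) (L n)"
    "(\<lambda>z. snd (snd z)) \<in> hom (grp J.S n) (grp B n)"
    by (auto intro!: homI simp: J.adc_sum_simps PB.adc_sum_simps)
  show ?thesis
    unfolding \<theta>_def[abs_def]
    by (intro hom_mult_fun X.grp_comm hom_comp[OF hom_comp[OF 1(1) PX.unitor_hom] \<sigma>_hom]
        hom_comp[OF 1(2) \<upsilon>_hom] hom_comp[OF 1(3) E_hom])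
qed

lemma \<upsilon>_one: "\<upsilon> n \<one>\<^bsub>L n\<^esub> = \<one>\<^bsub>grp X n\<^esub>"
  by (rule hom_one_eq[OF \<upsilon>_hom lam_point.grp_comm X.grp_comm])

lemma \<theta>_left: "t \<in> carrier (grp UX n) \<Longrightarrow>
    \<theta> n (t, \<one>\<^bsub>grp Q n\<^esub>) = \<sigma> n (PX.unitor n t)"
  by (simp add: \<theta>_def PB.adc_sum_simps \<upsilon>_one E_one \<sigma>_closed unitor_closed)

lemma \<theta>_right: "a \<in> carrier (L n) \<Longrightarrow> c \<in> carrier (grp B n) \<Longrightarrow>
    \<theta> n (\<one>\<^bsub>grp UX n\<^esub>, a, c) = \<upsilon> n a \<otimes>\<^bsub>grp X n\<^esub> E n True c"
  by (simp add: \<theta>_def \<upsilon>_closed E_closed hom_one_eq[OF PX.unitor_hom PX.PY.grp_comm X.grp_comm]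
      hom_one_eq[OF \<sigma>_hom X.grp_comm X.grp_comm])

text \<open>Only the two ends of the boundary cylinder have to be compared. At the 1-end both sides
  are \<open>E n True x\<close>; at the 0-end both are \<open>aug B x\<close> times the base point
  in degree 0 and trivial above.\<close>

lemma \<theta>_glue:
  assumes t: "t \<in> carrier (grp UY n)"
  shows "\<theta> n (glue_left n t, \<one>\<^bsub>grp Q n\<^esub>) = \<theta> n (\<one>\<^bsub>grp UX n\<^esub>, glue_right n t)"
proof (rule PY_hom_eq[OF X.grp_comm _ _ _ t])
  show "(\<lambda>t. \<theta> n (glue_left n t, \<one>\<^bsub>grp Q n\<^esub>)) \<in> hom (grp UY n) (grp X n)"
    by (rule hom_comp[OF _ \<theta>_hom], unfold J.adc_sum_simps)
      (intro hom_Pair_fun J.f_hom hom_one_fun Q.grp_comm)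
  show "(\<lambda>t. \<theta> n (\<one>\<^bsub>grp UX n\<^esub>, glue_right n t)) \<in> hom (grp UY n) (grp X n)"
    by (rule hom_comp[OF _ \<theta>_hom], unfold J.adc_sum_simps)
      (intro hom_Pair_fun J.g_hom hom_one_fun PX.PY.grp_comm)
  fix e x assume x: "x \<in> carrier (grp B n)"
  have "\<upsilon> n (pts n (aug B x)) = (if n = 0 then E n False b [^]\<^bsub>grp X n\<^esub> aug B x else \<one>\<^bsub>grp X n\<^esub>)"
    by (cases n) (simp_all add: \<upsilon>_def aug_pts)
  then show "\<theta> n (glue_left n (PY.\<iota> n (D n e x)), \<one>\<^bsub>grp Q n\<^esub>) =
      \<theta> n (\<one>\<^bsub>grp UX n\<^esub>, glue_right n (PY.\<iota> n (D n e x)))"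
    using x by (auto simp: glue_left_\<iota> D_closed incl_D E_closed PX.\<iota>_closed \<theta>_left PX.unitor_\<iota> \<sigma>_E
        glue_right_\<iota> \<theta>_right pts_closed \<upsilon>_one E_one base_closed)
qed

definition \<tau> where "\<tau> n Z = \<theta> n (SOME z. z \<in> Z)"

lemma \<tau>_hom: "\<tau> n \<in> hom (grp J.P n) (grp X n)"
  unfolding \<tau>_def[abs_def] by (rule J.extend[OF X.grp_comm \<theta>_hom \<theta>_glue])

lemma \<tau>_q: "z \<in> carrier (grp J.S n) \<Longrightarrow> \<tau> n (J.q n z) = \<theta> n z"
  unfolding \<tau>_def by (rule J.extend(2)[OF X.grp_comm \<theta>_hom \<theta>_glue])

lemma \<upsilon>_bd:
  assumes "a \<in> carrier (L (Suc n))"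
  shows "\<upsilon> n (bd (lam point) (Suc n) a) = bd X (Suc n) (\<upsilon> (Suc n) a)"
  using assms by (cases n) (simp_all add: \<upsilon>_def X.bd_one point.aug_bd_lam)

lemma \<theta>_bd:
  assumes z: "z \<in> carrier (grp J.S (Suc n))"
  shows "\<theta> n (bd J.S (Suc n) z) = bd X (Suc n) (\<theta> (Suc n) z)"
proof -
  obtain t a c where [simp]: "z = (t, a, c)" by (cases z)
  have "t \<in> carrier (grp UX (Suc n))" "a \<in> carrier (L (Suc n))"
      "c \<in> carrier (grp B (Suc n))"
    using z by (simp_all add: J_S_carrier)
  then show ?thesis
    by (simp add: \<theta>_def J.adc_sum_simps PB.adc_sum_simps X.bd_mult \<sigma>_closed unitor_closed \<upsilon>_closed E_closed
        PX.unitor_bd \<sigma>_bd \<upsilon>_bd bd_E)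
qed

lemma \<theta>_aug:
  assumes z: "z \<in> carrier (grp J.S 0)"
  shows "aug X (\<theta> 0 z) = aug J.S z"
proof -
  obtain t a c where [simp]: "z = (t, a, c)" by (cases z)
  have "t \<in> carrier (grp UX 0)" "a \<in> carrier (L 0)" "c \<in> carrier (grp B 0)"
    using z by (simp_all add: J_S_carrier)
  moreover from this have "aug X (\<upsilon> 0 a) = aug (lam point) a"
    by (simp add: \<upsilon>_def aug_power aug_Eb E_closed base_closed)
  ultimately show ?thesis
    by (simp add: \<theta>_def J.adc_sum_simps PB.adc_sum_simps hom_mult[OF X.aug_hom] \<sigma>_closed unitor_closed
        \<upsilon>_closed E_closed \<sigma>_aug PX.unitor_aug aug_E)
qed

lemma \<upsilon>_pos: "a \<in> pos (lam point) n \<Longrightarrow> \<upsilon> n a \<in> pos X n"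
proof (erule point.lam_hull_subset[OF X.grp_comm \<upsilon>_hom X.pos_submonoid, rotated])
  fix x show "\<upsilon> n (lam_class point n x) \<in> pos X n"
    using E_pos[OF base(1)] E_closed[OF base_closed]
    by (cases n) (auto simp: \<upsilon>_def point.aug_lam_class qcells_point X.G.int_pow_1)
qed

lemma \<tau>_map:
  assumes aug_pos: "\<And>x. x \<in> pos B 0 \<Longrightarrow> 0 \<le> aug B x"
  shows "adc_map J.P X \<tau>"
  unfolding adc_map_def
proof (intro conjI allI ballI \<tau>_hom)
  fix n Z assume "Z \<in> carrier (grp J.P (Suc n))"
  then obtain z where "z \<in> carrier (grp J.S (Suc n))" "Z = J.q (Suc n) z" using J.q_surj by blast
  then show "\<tau> n (bd J.P (Suc n) Z) = bd X (Suc n) (\<tau> (Suc n) Z)"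
    by (simp add: J.bd_P \<tau>_q J.S.bd_closed \<theta>_bd)
next
  fix Z assume "Z \<in> carrier (grp J.P 0)"
  then obtain z where "z \<in> carrier (grp J.S 0)" "Z = J.q 0 z" using J.q_surj by blast
  then show "aug X (\<tau> 0 Z) = aug J.P Z"
    by (simp add: J.aug_P \<tau>_q \<theta>_aug)
next
  fix n show "\<tau> n ` pos J.P n \<subseteq> pos X n"
  proof (rule image_subsetI)
    fix Z assume "Z \<in> pos J.P n"
    then obtain t a c where z: "(t, a, c) \<in> pos J.S n" "Z = J.q n (t, a, c)" by (auto simp: J.pos_P)
    then have "t \<in> pos UX n" "a \<in> pos (lam point) n" "c \<in> pos B n"
      by (auto simp: J.adc_sum_simps PB.adc_sum_simps)
    then have "\<theta> n (t, a, c) \<in> pos X n"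
      by (auto simp: \<theta>_def intro!: X.M.m_closed \<sigma>_pos[OF aug_pos] PX.unitor_pos \<upsilon>_pos E_pos)
    then show "\<tau> n Z \<in> pos X n"
      using z by (simp add: \<tau>_q J.S.pos_closed)
  qed
qed

text \<open>In positive degrees \<open>\<rho>\<close> kills the 0-end, so the correction
  \<open>E False (h y)\<close> disappears and prisms are preserved. In degree 0,
  \<open>E 0 False y\<close> and \<open>aug B y\<close> times \<open>E 0 False b\<close> have the
  same image because \<open>b\<close> has augmentation one.\<close>

lemma \<rho>_\<sigma>:
  assumes x: "x \<in> carrier (grp X n)"
  shows "\<rho> n (\<sigma> n x) = \<rho> n x"
proof (rule cylinder_hom_eq[OF J.comm_P hom_comp[OF \<sigma>_hom \<rho>_hom] \<rho>_hom _ _ x])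
  interpret JP: comm_group "grp J.P n" by (rule J.comm_P)
  have one: "\<rho> n \<one>\<^bsub>grp X n\<^esub> = \<one>\<^bsub>grp J.P n\<^esub>"
    by (rule hom_one_eq[OF \<rho>_hom X.grp_comm J.comm_P])
  have q_one: "J.q n (\<one>\<^bsub>grp UX n\<^esub>, \<one>\<^bsub>L n\<^esub>, \<one>\<^bsub>grp B n\<^esub>) = \<one>\<^bsub>grp J.P n\<^esub>"
    using hom_one_eq[OF J.q_hom J.S.grp_comm J.comm_P, of n] by (simp add: J.adc_sum_simps PB.adc_sum_simps)
  have degenerate: "\<rho> n (E n False y) = \<one>\<^bsub>grp J.P n\<^esub>" if "y \<in> carrier (grp B n)" "n \<noteq> 0" for y
    using that q_one by (simp add: \<rho>_E pts_def)
  fix e y assume y: "y \<in> carrier (grp B n)"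
  show "\<rho> n (\<sigma> n (E n e y)) = \<rho> n (E n e y)"
  proof (cases "e \<or> n \<noteq> 0")
    case True
    then show ?thesis using y by (auto simp: \<sigma>_E one degenerate)
  next
    case False
    then have [simp]: "n = 0" "e = False" by auto
    have "aug B (b [^]\<^bsub>grp B 0\<^esub> aug B y) = aug B y"
      by (simp add: hom_pow_eq[OF B.aug_hom B.grp_comm abelian_integer_group] base base_closed)
    moreover have "E 0 False b [^]\<^bsub>grp X 0\<^esub> aug B y = E 0 False (b [^]\<^bsub>grp B 0\<^esub> aug B y)"
      by (simp add: E_pow base_closed)
    ultimately show ?thesis
      using y by (simp add: \<sigma>_E \<rho>_E base_closed)
  qed
next
  fix m y assume m: "n = Suc m" and y: "y \<in> carrier (grp B m)"
  interpret JP: comm_group "grp J.P (Suc m)" by (rule J.comm_P)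
  have "\<rho> n (E n False (h m y)) = \<one>\<^bsub>grp J.P n\<^esub>"
    using hom_one_eq[OF J.q_hom J.S.grp_comm J.comm_P, of n] m y
    by (simp add: \<rho>_E h_closed pts_def J.adc_sum_simps PB.adc_sum_simps)
  then show "\<rho> n (\<sigma> n (J m y)) = \<rho> n (J m y)"
    using m y hom_in_carrier[OF \<rho>_hom, of "J m y" n]
    by (simp add: \<sigma>_J hom_mult[OF \<rho>_hom] J_closed E_closed h_closed)
qed

lemma \<rho>_\<upsilon>:
  assumes a: "a \<in> carrier (L n)"
  shows "\<rho> n (\<upsilon> n a) = J.q n (\<one>\<^bsub>grp UX n\<^esub>, a, \<one>\<^bsub>grp B n\<^esub>)"
proof (rule lam_point_hom_eq[OF J.comm_P hom_comp[OF \<upsilon>_hom \<rho>_hom] _ _ a])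
  show "(\<lambda>a. J.q n (\<one>\<^bsub>grp UX n\<^esub>, a, \<one>\<^bsub>grp B n\<^esub>)) \<in> hom (L n) (grp J.P n)"
    by (rule hom_comp[OF _ J.q_hom], unfold J.adc_sum_simps PB.adc_sum_simps)
      (intro hom_Pair_fun hom_one_fun PX.PY.grp_comm B.grp_comm hom_id)
  assume "n = 0"
  then show "\<rho> n (\<upsilon> n pt) = J.q n (\<one>\<^bsub>grp UX n\<^esub>, pt, \<one>\<^bsub>grp B n\<^esub>)"
    by (simp add: \<upsilon>_def aug_pt X.G.int_pow_1 E_closed base_closed \<rho>_E base pts_def lam_point.G.int_pow_1 pt_closed)
qed

text \<open>A representative splits into its three components, and each is returned to its own
  class: by \<open>\<rho>_\<sigma>\<close> on the cylinder, \<open>\<rho>_\<upsilon>\<close> on the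
  cone point and \<open>\<rho>_E\<close> on \<open>B\<close>.\<close>

lemma \<rho>_\<tau>:
  assumes Z: "Z \<in> carrier (grp J.P n)"
  shows "\<rho> n (\<tau> n Z) = Z"
proof -
  let ?u = "\<one>\<^bsub>grp UX n\<^esub>"
  obtain t a c where z: "(t, a, c) \<in> carrier (grp J.S n)" "Z = J.q n (t, a, c)"
    using J.q_surj[OF Z] by auto
  then have tac: "t \<in> carrier (grp UX n)" "a \<in> carrier (L n)"
      "c \<in> carrier (grp B n)" by (simp_all add: J_S_carrier)
  have "\<rho> n (PX.unitor n t) = J.q n (t, \<one>\<^bsub>grp Q n\<^esub>)"
  proof (rule PX.hom_eq[OF J.comm_P hom_comp[OF PX.unitor_hom \<rho>_hom] _ _ tac(1)])
    show "(\<lambda>t. J.q n (t, \<one>\<^bsub>grp Q n\<^esub>)) \<in> hom (grp UX n) (grp J.P n)"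
      by (rule hom_comp[OF _ J.q_hom], unfold J.adc_sum_simps)
        (intro hom_Pair_fun hom_one_fun Q.grp_comm hom_id)
  qed (simp add: PX.unitor_\<iota> \<rho>_def)
  then have "\<rho> n (\<tau> n Z) = J.q n (t, \<one>\<^bsub>grp Q n\<^esub>) \<otimes>\<^bsub>grp J.P n\<^esub>
      (J.q n (?u, a, \<one>\<^bsub>grp B n\<^esub>) \<otimes>\<^bsub>grp J.P n\<^esub> J.q n (?u, \<one>\<^bsub>L n\<^esub>, c))"
    using tac z by (simp add: \<tau>_q \<theta>_def hom_mult[OF \<rho>_hom] \<sigma>_closed unitor_closed \<upsilon>_closed E_closed
        \<rho>_\<sigma> \<rho>_\<upsilon> \<rho>_E)
  also have "\<dots> = J.q n ((t, \<one>\<^bsub>grp Q n\<^esub>) \<otimes>\<^bsub>grp J.S n\<^esub> ((?u, a, \<one>\<^bsub>grp B n\<^esub>) \<otimes>\<^bsub>grp J.S n\<^esub> (?u, \<one>\<^bsub>L n\<^esub>, c)))"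
  proof -
    have "(t, \<one>\<^bsub>grp Q n\<^esub>) \<in> carrier (grp J.S n)" "(?u, a, \<one>\<^bsub>grp B n\<^esub>) \<in> carrier (grp J.S n)"
      "(?u, \<one>\<^bsub>L n\<^esub>, c) \<in> carrier (grp J.S n)"
      using tac by (simp_all add: J.adc_sum_simps PB.adc_sum_simps)
    then show ?thesis by (simp only: hom_mult[OF J.q_hom] J.S.G.m_closed)
  qed
  also have "\<dots> = Z"
    using tac z by (simp add: J.adc_sum_simps PB.adc_sum_simps)
  finally show ?thesis .
qed

end

lemma join_retract:
  assumes B: "precomplex B" "contractible B"
    and bd: "\<And>x. x \<in> carrier (grp B (Suc 0)) \<Longrightarrow> aug B (bd B (Suc 0) x) = 0"
    and pos: "\<And>x. x \<in> pos B 0 \<Longrightarrow> 0 \<le> aug B x"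
  shows "precomplex (adc_join (lam point) B)"
    and "adc_retract (adc_join (lam point) B) (tensor (lam arrow) B)"
proof -
  obtain b h where "contraction B b h" using B(2) by (auto simp: contractible_def)
  then interpret contracted_join B b h
    using B(1) bd by (simp add: contracted_complex_def contracted_complex_axioms_def
        contracted_cylinder_def cylinder_def cone_join_def cone_join_axioms_def contracted_join_def)
  show "precomplex (adc_join (lam point) B)"
    unfolding adc_join_eq by (rule J.precomplex_P)
  show "adc_retract (adc_join (lam point) B) (tensor (lam arrow) B)"
    unfolding adc_retract_def adc_join_eq using \<tau>_map[OF pos] \<rho>_map \<rho>_\<tau> by blast
qed

section \<open>Oriented simplices and cubes\<close>

lemma (in strict_omega_category) aug_lam_nonneg:
  assumes "X \<in> pos (lam C) 0"
  shows "0 \<le> aug (lam C) X"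
proof -
  have "submonoid {0..} integer_group" by unfold_locales auto
  from lam_hull_subset[OF abelian_integer_group aug_lam_hom this _ assms] show ?thesis
    by (simp add: aug_lam_class)
qed

text \<open>The zero homotopy works: every chain of degree 0 equals its augmentation times
  \<open>pt\<close>, and the higher groups are trivial.\<close>

lemma contractible_lam_point: "contractible (lam point)"
proof -
  have "contraction (lam point) pt (\<lambda>n _. \<one>\<^bsub>grp (lam point) (Suc n)\<^esub>)"
    unfolding contraction_def
  proof (intro conjI allI ballI)
    show "(\<lambda>_. \<one>\<^bsub>grp (lam point) (Suc n)\<^esub>) \<in> hom (grp (lam point) n) (grp (lam point) (Suc n))" for n
      by (rule hom_one_fun[OF lam_point.grp_comm])
    show "(\<lambda>_. \<one>\<^bsub>grp (lam point) (Suc n)\<^esub>) ` pos (lam point) n \<subseteq> pos (lam point) (Suc n)" for n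
      by auto
  next
    fix x assume x: "x \<in> carrier (grp (lam point) 0)"
    have "x \<otimes>\<^bsub>grp (lam point) 0\<^esub> inv\<^bsub>grp (lam point) 0\<^esub> (pt [^]\<^bsub>grp (lam point) 0\<^esub> aug (lam point) x)
        = \<one>\<^bsub>grp (lam point) 0\<^esub>"
      by (rule lam_point_hom_eq[OF lam_point.grp_comm _ hom_one_fun[OF lam_point.grp_comm] _ x],
          intro hom_mult_fun hom_inv_fun hom_pow_exponent hom_id lam_point.grp_comm lam_point.G.is_group
            lam_point.aug_hom pt_closed)
        (simp add: aug_pt lam_point.G.int_pow_1 pt_closed)
    then show "bd (lam point) (Suc 0) \<one>\<^bsub>grp (lam point) (Suc 0)\<^esub> = x \<otimes>\<^bsub>grp (lam point) 0\<^esub>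
        inv\<^bsub>grp (lam point) 0\<^esub> (pt [^]\<^bsub>grp (lam point) 0\<^esub> aug (lam point) x)"
      by (simp add: lam_point.bd_one)
  next
    fix n x assume x: "x \<in> carrier (grp (lam point) (Suc n))"
    have "x = \<one>\<^bsub>grp (lam point) (Suc n)\<^esub>"
      by (rule lam_point_hom_eq[OF lam_point.grp_comm hom_id hom_one_fun[OF lam_point.grp_comm] _ x]) simp
    then show "bd (lam point) (Suc (Suc n)) \<one>\<^bsub>grp (lam point) (Suc (Suc n))\<^esub> = x \<otimes>\<^bsub>grp (lam point) (Suc n)\<^esub>
        inv\<^bsub>grp (lam point) (Suc n)\<^esub> \<one>\<^bsub>grp (lam point) (Suc n)\<^esub>"
      by (simp add: lam_point.bd_one)
  qed (simp_all add: pt_pos aug_pt)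
  then show ?thesis by (auto simp: contractible_def)
qed

section \<open>Retracts of strict omega-categories and relabelling\<close>

lemma strict_functor_comp:
  assumes f: "strict_functor A B f" and g: "strict_functor B C g"
  shows "strict_functor A C (\<lambda>x. g (f x))"
proof -
  have "composable B p (f x) (f y)" if "composable A p x y" for p x y
    using f that unfolding strict_functor_def composable_def by metis
  then show ?thesis
    using f g by (auto simp: strict_functor_def)
qed

lemma omega_retract_trans:
  assumes "omega_retract A B" "omega_retract B C"
  shows "omega_retract A C"
proof -
  obtain i r where i: "strict_functor A B i" and r: "strict_functor B A r" and ri: "\<forall>x \<in> cells A. r (i x) = x"
    using assms(1) by (auto simp: omega_retract_def)
  obtain j s where j: "strict_functor B C j" and s: "strict_functor C B s" and sj: "\<forall>x \<in> cells B. s (j x) = x"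
    using assms(2) by (auto simp: omega_retract_def)
  have "\<forall>x \<in> cells A. r (s (j (i x))) = x"
    using i ri sj by (auto simp: strict_functor_def)
  then show ?thesis
    using assms strict_functor_comp[OF i j] strict_functor_comp[OF s r]
    unfolding omega_retract_def by blast
qed

text \<open>Transport of structure along an injection into the naturals: \<open>compE\<close> pulls
  a composable pair back to \<open>C\<close>, where the axioms are available.\<close>

lemma strict_omega_category_encode:
  assumes C: "strict_omega_category C" and "countable (cells C)"
  shows "strict_omega_category (encode C)"
proof -
  interpret strict_omega_category C by fact
  let ?f = "to_nat_on (cells C)" and ?g = "inv_into (cells C) (to_nat_on (cells C))"
  have inj: "inj_on ?f (cells C)" using assms(2) by (rule inj_on_to_nat_on)
  have gf: "?g (?f x) = x" if "x \<in> cells C" for x using inj that by simp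
  have cells: "cells (encode C) = ?f ` cells C" by (simp add: encode_def relabel_def Let_def)
  have src: "src (encode C) p (?f x) = ?f (src C p x)" and tgt: "tgt (encode C) p (?f x) = ?f (tgt C p x)"
    if "x \<in> cells C" for p x
    using that by (simp_all add: encode_def relabel_def Let_def gf)
  have cmp: "cmp (encode C) p (?f x) (?f y) = ?f (cmp C p x y)"
    if "x \<in> cells C" "y \<in> cells C" for p x y
    using that by (simp add: encode_def relabel_def Let_def gf)
  have eq: "?f x = ?f y \<longleftrightarrow> x = y" if "x \<in> cells C" "y \<in> cells C" for x y
    using inj that by (auto dest: inj_onD)
  have comp: "composable (encode C) p (?f x) (?f y) \<longleftrightarrow> composable C p x y"
    if "x \<in> cells C" "y \<in> cells C" for p x y
    using that by (simp add: composable_def cells src tgt eq src_closed tgt_closed)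
  have compE: "\<exists>u v. u \<in> cells C \<and> v \<in> cells C \<and> x = ?f u \<and> y = ?f v \<and> composable C p u v"
    if c: "composable (encode C) p x y" for p x y
  proof -
    obtain u v where "u \<in> cells C" "v \<in> cells C" "x = ?f u" "y = ?f v"
      using c unfolding composable_def cells by blast
    then show ?thesis using c comp by blast
  qed
  have q: "?f x \<in> qcells (encode C) q" if "x \<in> qcells C q" for x q
    using that by (auto simp: qcells_def cells src)
  note simps = src tgt cmp cells src_closed tgt_closed cmp_closed
  show ?thesis
  proof (rule strict_omega_category.intro)
    fix x p q assume "x \<in> cells (encode C)"
    then obtain u where u: "u \<in> cells C" "x = ?f u" by (auto simp: cells)
    show "src (encode C) p x \<in> cells (encode C)" "tgt (encode C) p x \<in> cells (encode C)"
      "src (encode C) q (src (encode C) p x) = (if q < p then src (encode C) q x else src (encode C) p x)"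
      "src (encode C) q (tgt (encode C) p x) = (if q < p then src (encode C) q x else tgt (encode C) p x)"
      "tgt (encode C) q (src (encode C) p x) = (if q < p then tgt (encode C) q x else src (encode C) p x)"
      "tgt (encode C) q (tgt (encode C) p x) = (if q < p then tgt (encode C) q x else tgt (encode C) p x)"
      "cmp (encode C) p (src (encode C) p x) x = x" "cmp (encode C) p x (tgt (encode C) p x) = x"
      using u by (simp_all add: simps src_src src_tgt tgt_src tgt_tgt left_unit right_unit)
    show "\<exists>q. x \<in> qcells (encode C) q" using finite_dim[OF u(1)] q u(2) by blast
  next
    fix x y p assume "composable (encode C) p x y"
    then obtain u v where uv: "u \<in> cells C" "v \<in> cells C" "x = ?f u" "y = ?f v" "composable C p u v"
      using compE by blast
    then show "cmp (encode C) p x y \<in> cells (encode C)"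
      "src (encode C) p (cmp (encode C) p x y) = src (encode C) p x"
      "tgt (encode C) p (cmp (encode C) p x y) = tgt (encode C) p y"
      by (simp_all add: simps src_cmp tgt_cmp)
    fix q assume "p < q"
    then show "src (encode C) q (cmp (encode C) p x y) = cmp (encode C) p (src (encode C) q x) (src (encode C) q y)"
      "tgt (encode C) q (cmp (encode C) p x y) = cmp (encode C) p (tgt (encode C) q x) (tgt (encode C) q y)"
      using uv by (simp_all add: simps src_cmp_high tgt_cmp_high)
  next
    fix x y z p assume "composable (encode C) p x y" "composable (encode C) p y z"
    then obtain u v w where "u \<in> cells C" "v \<in> cells C" "w \<in> cells C" "x = ?f u" "y = ?f v" "z = ?f w"
      "composable C p u v" "composable C p v w"
      using compE eq by (metis (no_types, lifting))
    then show "cmp (encode C) p (cmp (encode C) p x y) z = cmp (encode C) p x (cmp (encode C) p y z)"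
      by (simp add: simps assoc)
  next
    fix p q x y x' y'
    assume pq: "p < q" and c: "composable (encode C) q x y" "composable (encode C) q x' y'"
      "composable (encode C) p x x'" "composable (encode C) p y y'"
    obtain u v where u: "u \<in> cells C" "v \<in> cells C" "x = ?f u" "y = ?f v" using compE[OF c(1)] by blast
    obtain u' v' where v: "u' \<in> cells C" "v' \<in> cells C" "x' = ?f u'" "y' = ?f v'" using compE[OF c(2)] by blast
    have c': "composable C q u v" "composable C q u' v'" "composable C p u u'" "composable C p v v'"
      using c u v comp by simp_all
    then show "cmp (encode C) p (cmp (encode C) q x y) (cmp (encode C) q x' y') =
        cmp (encode C) q (cmp (encode C) p x x') (cmp (encode C) p y y')"
      using u v interchange[OF pq c'] by (simp add: simps)
  qed
qed

text \<open>Relabelling is an isomorphism by \<open>encode_iso\<close>; recording it as a retraction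
  in both directions lets it be chained by \<open>omega_retract_trans\<close>.\<close>

lemma omega_retract_encode:
  assumes "strict_omega_category C" "countable (cells C)"
  shows "omega_retract C (encode C)" "omega_retract (encode C) C"
proof -
  note e = encode_iso[OF assms]
  have inj: "inj_on (to_nat_on (cells C)) (cells C)" using assms(2) by (rule inj_on_to_nat_on)
  have cells: "cells (encode C) = to_nat_on (cells C) ` cells C"
    by (simp add: encode_def relabel_def Let_def)
  note cat = assms(1) strict_omega_category_encode[OF assms]
  show "omega_retract C (encode C)"
    unfolding omega_retract_def using cat e(1,2) inj by (metis inv_into_f_f)
  show "omega_retract (encode C) C"
    unfolding omega_retract_def using cat e(1,2) cells by (metis f_inv_into_f)
qed

theorem theorem1p5p3:
  fixes n :: nat
  shows "omega_retract (oriented_simplex n) (oriented_cube n)"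
proof -
  \<comment> \<open>Contractibility of the cube is carried along in the induction, because the join
    step needs a contraction of the preceding simplex.\<close>
  have "omega_retract (oriented_simplex n) (oriented_cube n) \<and> contractible (lam (oriented_cube n))"
  proof (induction n)
    case 0
    have p: "countable (cells point)" by (simp add: point_def)
    note e = omega_retract_encode[OF strict_omega_category_point p]
    have "strict_omega_category (encode point)" by (rule strict_omega_category_encode[OF strict_omega_category_point p])
    moreover have "contractible (lam (encode point))"
      using calculation contractible_lam_point
      by (intro contractible_retract[OF strict_omega_category.precomplex_lam lam_point.precomplex_axioms
            adc_retract_lam[OF e(2)]])
    ultimately show ?case using omega_retract_trans[OF e(2) e(1)] by simp
  next
    case (Suc n)
    let ?S = "oriented_simplex n" and ?C = "oriented_cube n"
    have ret: "omega_retract ?S ?C" and con: "contractible (lam ?C)" using Suc by auto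
    have S: "strict_omega_category ?S" and C: "strict_omega_category ?C"
      using ret by (auto simp: omega_retract_def)
    interpret S: strict_omega_category ?S by fact
    interpret C: strict_omega_category ?C by fact
    have countable: "countable (cells ?S)" "countable (cells ?C)" by simp_all
    \<comment> \<open>The simplex obtains its contraction as a retract of the cube.\<close>
    have conS: "contractible (lam ?S)"
      by (rule contractible_retract[OF S.precomplex_lam C.precomplex_lam adc_retract_lam[OF ret] con])
    have tS: "precomplex (tensor (lam arrow) (lam ?S))" and tC: "precomplex (tensor (lam arrow) (lam ?C))"
      by (intro precomplex_pair.precomplex_tensor precomplex_pair.intro arrow.precomplex_lam
          S.precomplex_lam C.precomplex_lam)+
    note j = join_retract[OF S.precomplex_lam conS S.aug_bd_lam S.aug_lam_nonneg]
    \<comment> \<open>Two retractions compose: the join into the cylinder on the same simplex, by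
      its contraction, and that cylinder into the one on the cube, by the induction
      hypothesis.\<close>
    have "omega_retract (omega_join point ?S) (nu (tensor (lam arrow) (lam ?S)))"
      unfolding omega_join_def by (rule omega_retract_nu[OF j(1) tS j(2)])
    moreover have "omega_retract (nu (tensor (lam arrow) (lam ?S))) (gray arrow ?C)"
      unfolding gray_def
      by (rule omega_retract_nu[OF tS tC adc_retract_tensor[OF arrow.precomplex_lam S.precomplex_lam
              C.precomplex_lam adc_retract_lam[OF ret]]])
    ultimately have r: "omega_retract (omega_join point ?S) (gray arrow ?C)"
      by (rule omega_retract_trans)
    then have cat: "strict_omega_category (omega_join point ?S)" "strict_omega_category (gray arrow ?C)"
      by (auto simp: omega_retract_def)
    have cnt: "countable (cells (omega_join point ?S))" "countable (cells (gray arrow ?C))"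
      using countable strict_omega_category_point S C strict_omega_category_arrow
      by (auto intro!: countable_omega_join countable_gray simp: point_def)
    note eS = omega_retract_encode[OF cat(1) cnt(1)] and eC = omega_retract_encode[OF cat(2) cnt(2)]
    have "omega_retract (encode (omega_join point ?S)) (encode (gray arrow ?C))"
      by (rule omega_retract_trans[OF eS(2) omega_retract_trans[OF r eC(1)]])
    \<comment> \<open>The contraction passes from the cube to its cylinder, then through
      \<open>nu\<close> and \<open>lam\<close> by means of cones; relabelling comes last.\<close>
    moreover have "contractible (lam (gray arrow ?C))"
      unfolding gray_def
      by (intro contractible_lam_nu tC contractible_cylinder C.precomplex_lam con)
    then have "contractible (lam (encode (gray arrow ?C)))"
      using strict_omega_category_encode[OF cat(2) cnt(2)] cat(2)
      by (intro contractible_retract[OF strict_omega_category.precomplex_lam strict_omega_category.precomplex_lam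
            adc_retract_lam[OF eC(2)]])
    ultimately show ?case by simp
  qed
  then show ?thesis ..
qed

end
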